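(* Let $K\ge1$, $d\ge1$ and $0<r<R<\infty$. There exist constants $A_r^R=A_r^R(K,d)$ and $B_r^R=B_r^R(K,d)$, depending only on $r,R,K,d$, with the following property. Let $f\in\mathcal{F}_K(d)$ and let $x$ and $y$ be two integral curves $$\dot{x}(t)=f(x(t)),\quad x(t_0)=x_0\in\mathbb{C}_r^R,\qquad \dot{y}(s)=f(y(s)),\quad y(t_0)=y_0\in\mathbb{C}_r^R,$$ defined on intervals containing $t_0$. Then $$|x(t)-y(s)|\le A_r^R\,|t-s|+B_r^R\,|x_0-y_0|$$ for all parameters $t$ and $s$ (in the respective intervals of definition) such that $r\le|x(t)|\le R$ and $r\le|y(s)|\le R$. In particular, $$|x(t)-y(t)|\le B_r^R\,|x(s)-y(s)|$$ as long as $x(t),y(t),x(s)$ and $y(s)$ lie in $\mathbb{C}_r^R$.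
   Context: $\mathbb{C}_r^R=\{z\in\mathbb{C}\colon r\le|z|\le R\}$. For $K\ge1$, $d\ge 1$, $\mathcal{F}_K(d)$ denotes the family of all (continuous) maps $f\colon\mathbb{C}\to\mathbb{C}$ in $W^{1,2}_{\mathrm{loc}}(\mathbb{C})$ such that $$|f_{\bar z}|\le\frac{K-1}{K+1}\operatorname{Re}f_z\ \text{ a.e. in }\mathbb{C},\qquad f(0)=0,\qquad 1=\operatorname{Re}f(1)\le|f(1)|\le d,$$ where $f_z=\frac12(f_x-if_y)$, $f_{\bar z}=\frac12(f_x+if_y)$.
   Formalization: The family also requires Re f_z ≥ 0 a.e.; this is automatic for K > 1, but for K = 1 the printed inequality admits all normalized entire f, e.g. z + n z(z−1), for which no uniform constant A exists, so the claim as printed fails there. *)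

theory Defs
  imports "HOL-Analysis.Analysis"
begin

primrec Ck :: "nat \<Rightarrow> (complex \<Rightarrow> real) \<Rightarrow> bool" where
  "Ck 0 \<phi> \<longleftrightarrow> continuous_on UNIV \<phi>"
| "Ck (Suc k) \<phi> \<longleftrightarrow>
     \<phi> differentiable_on UNIV \<and> (\<forall>v. Ck k (\<lambda>z. frechet_derivative \<phi> (at z) v))"

definition test_function :: "(complex \<Rightarrow> real) \<Rightarrow> bool" where
  "test_function \<phi> \<longleftrightarrow> (\<forall>k. Ck k \<phi>) \<and> compact (closure {z. \<phi> z \<noteq> 0})"

text \<open>Functions are taken Borel measurable; every Lebesgue measurable function has a Borel
  representative, and weak derivatives are only determined up to null sets.\<close>

definition L2_loc :: "(complex \<Rightarrow> complex) \<Rightarrow> bool" where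
  "L2_loc g \<longleftrightarrow> g \<in> borel_measurable lborel \<and>
     (\<forall>S. compact S \<longrightarrow> set_integrable lborel S (\<lambda>z. (cmod (g z))\<^sup>2))"

text \<open>\<open>g\<close> is the weak derivative of \<open>f\<close> in the direction \<open>v\<close>; the directions \<open>1\<close> and
  \<open>\<i>\<close> give the weak partial derivatives with respect to \<open>x = Re z\<close> and \<open>y = Im z\<close>.\<close>

definition weak_derivative ::
    "complex \<Rightarrow> (complex \<Rightarrow> complex) \<Rightarrow> (complex \<Rightarrow> complex) \<Rightarrow> bool" where
  "weak_derivative v f g \<longleftrightarrow>
     (\<forall>\<phi>. test_function \<phi> \<longrightarrow>
        (\<integral>z. frechet_derivative \<phi> (at z) v *\<^sub>R f z \<partial>lborel) = - (\<integral>z. \<phi> z *\<^sub>R g z \<partial>lborel))"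

definition W12_loc_partials ::
    "(complex \<Rightarrow> complex) \<Rightarrow> (complex \<Rightarrow> complex) \<Rightarrow> (complex \<Rightarrow> complex) \<Rightarrow> bool" where
  "W12_loc_partials f fx fy \<longleftrightarrow>
     L2_loc f \<and> L2_loc fx \<and> L2_loc fy \<and> weak_derivative 1 f fx \<and> weak_derivative \<i> f fy"

definition wirtinger :: "complex \<Rightarrow> complex \<Rightarrow> complex" where
  "wirtinger fx fy = (fx - \<i> * fy) / 2"

definition wirtinger_bar :: "complex \<Rightarrow> complex \<Rightarrow> complex" where
  "wirtinger_bar fx fy = (fx + \<i> * fy) / 2"

text \<open>For \<open>K > 1\<close> the condition \<open>0 \<le> Re f\<^sub>z\<close> is implied by the differential inequality
  (lemma \<open>Re_nonneg_redundant\<close> below). It matters only for \<open>K = 1\<close>, where the inequality alone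
  says only that the \<open>z\<close>-bar derivative vanishes and would admit every normalized entire function,
  such as \<open>z + n z (z - 1)\<close> for all \<open>n\<close>. With the condition, the case \<open>K = 1\<close> consists of the
  monotone fields \<open>f z = c * z\<close> with \<open>Re c = 1\<close> and \<open>cmod c \<le> d\<close>.\<close>

definition reduced_fields :: "real \<Rightarrow> real \<Rightarrow> (complex \<Rightarrow> complex) set" where
  "reduced_fields K d = {f. continuous_on UNIV f \<and>
     (\<exists>fx fy. W12_loc_partials f fx fy \<and>
        (AE z in lborel. 0 \<le> Re (wirtinger (fx z) (fy z)) \<and>
           cmod (wirtinger_bar (fx z) (fy z)) \<le> (K - 1) / (K + 1) * Re (wirtinger (fx z) (fy z)))) \<and>
     f 0 = 0 \<and> 1 = Re (f 1) \<and> Re (f 1) \<le> cmod (f 1) \<and> cmod (f 1) \<le> d}"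

lemma Re_nonneg_redundant:
  assumes "K > 1" "cmod b \<le> (K - 1) / (K + 1) * Re a"
  shows "0 \<le> Re a"
proof -
  have "0 \<le> (K - 1) / (K + 1) * Re a"
    using assms(2) norm_ge_zero[of b] by linarith
  moreover have "0 < (K - 1) / (K + 1)"
    using assms(1) by simp
  ultimately show ?thesis
    by (metis zero_le_mult_iff not_le)
qed

definition closed_annulus :: "real \<Rightarrow> real \<Rightarrow> complex set" where
  "closed_annulus r R = {z. r \<le> cmod z \<and> cmod z \<le> R}"

text \<open>The interval \<open>I\<close> may be open, closed, half-open or unbounded; derivatives at endpoints
  belonging to \<open>I\<close> are one-sided.\<close>

definition integral_curve :: "(complex \<Rightarrow> complex) \<Rightarrow> real set \<Rightarrow> (real \<Rightarrow> complex) \<Rightarrow> bool" where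
  "integral_curve f I x \<longleftrightarrow> is_interval I \<and>
     (\<forall>t\<in>I. (x has_vector_derivative f (x t)) (at t within I))"

end

theory Submission
  imports Defs
begin

text \<open>Call the strain of a segment the component along the segment of the increment of \<open>f\<close>. For
  \<open>f\<close> in the class it is nonnegative, and it satisfies a Harnack inequality: strains of nearby
  segments of comparable length are comparable. To see this, mollify \<open>f\<close> and integrate the
  symmetric part of its differential against divergence free tensors built from the Hessians of
  explicit compactly supported functions with a crease along a segment. These tensors are positive on
  the cone of admissible differentials outside the crease or a small disc. In particular \<open>f\<close> is
  Hoelder continuous.

  Now let \<open>x\<close> and \<open>y\<close> be solutions. Forward in time their distance \<open>u\<close> grows at the rate of the
  strain of the segment between them. By the Harnack inequality this is at most a constant times the
  growth rate of \<open>cmod (x (t + h) - x t)\<close>, which is again the distance of two solutions, if \<open>h\<close>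
  is comparable to \<open>u\<close>. Each time \<open>u\<close> doubles, the mean speed of \<open>x\<close> at scale \<open>h\<close> grows by a
  fixed amount. Since the mean speeds at different scales differ by a summable amount and the speed is
  bounded on the annulus, \<open>u\<close> can only double a bounded number of times.\<close>

section \<open>Fields with doubling strain\<close>

text \<open>Symmetric tensors do not see it: paired with them, the differential contributes only the
  real part of the \<open>z\<close>-derivative and the \<open>z\<close>-bar derivative, which are
  the two quantities in the hypothesis. In the plane, divergence free symmetric tensors come from
  Airy stress functions. Such a function of \<open>x\<close> and \<open>\<bar>y\<bar>\<close> may
  have a jump of its normal derivative across the real axis, and this jump becomes a weighted strain
  of the axis. The sign of the jump decides whether the axis is bounded by the area or the area by
  the axis; a radial function without jump leads from a small disc to a large one. Mollification
  averages the differential over a convex cone, and the resulting inequalities contain no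
  derivatives, so they survive the limit. In the comparison of solutions \<open>x (t + h)\<close>
  has to exist; a reserve of further growth of the distance at the end of the interval provides for
  it.\<close>

definition strain :: "(complex \<Rightarrow> complex) \<Rightarrow> complex \<Rightarrow> complex \<Rightarrow> real" where
  "strain f c e = (f (c + e) - f (c - e)) \<bullet> e"

text \<open>A Harnack inequality in minimal form: sign, doubling about a fixed midpoint, quarter
  turn. All further comparisons of segments are derived from these three, and all three are stable
  under positive factors and pointwise limits.\<close>

definition doubling_strain :: "real \<Rightarrow> (complex \<Rightarrow> complex) \<Rightarrow> bool" where
  "doubling_strain C f \<longleftrightarrow> (\<forall>c e. 0 \<le> strain f c e \<and>
     strain f c (2 * e) \<le> C * strain f c e \<and> strain f c (\<i> * e) \<le> C * strain f c e)"

text \<open>Strain with free endpoints: \<open>strain f c e\<close> is half of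
  \<open>work f (c - e) (c + e)\<close>. For solutions passing through \<open>a\<close> and
  \<open>b\<close>, the quotient \<open>work f a b / cmod (b - a)\<close> is the growth rate of
  their distance.\<close>

definition work :: "(complex \<Rightarrow> complex) \<Rightarrow> complex \<Rightarrow> complex \<Rightarrow> real" where
  "work f a b = (f b - f a) \<bullet> (b - a)"

lemma work_commute: "work f a b = work f b a"
  by (simp add: work_def inner_diff_left inner_diff_right algebra_simps)

text \<open>Serves to bound an oblique segment by orthogonal ones: the work of the second diagonal
  is nonnegative, so the first is bounded by the four sides.\<close>

lemma work_parallelogram:
  "work f a (a + v + w) + work f (a + v) (a + w) =
    work f a (a + v) + work f (a + v) (a + v + w) + work f a (a + w) + work f (a + w) (a + v + w)"
  by (simp add: work_def inner_diff_left inner_diff_right inner_add_right algebra_simps)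

locale doubling_field =
  fixes C :: real and f :: "complex \<Rightarrow> complex"
  assumes C_ge_1: "1 \<le> C" and doubling: "doubling_strain C f"
begin

lemma strain_nonneg: "0 \<le> strain f c e"
  using doubling by (auto simp: doubling_strain_def)

lemma strain_double: "strain f c (2 * e) \<le> C * strain f c e"
  using doubling by (auto simp: doubling_strain_def)

lemma strain_rotate: "strain f c (\<i> * e) \<le> C * strain f c e"
  using doubling by (auto simp: doubling_strain_def)

lemma strain_minus: "strain f c (- e) = strain f c e"
  by (simp add: strain_def inner_diff_left)

lemma work_nonneg: "0 \<le> work f a b"
proof -
  have "(a + b) / 2 + (b - a) / 2 = b" "(a + b) / 2 - (b - a) / 2 = a"
    by (simp_all add: field_simps)
  then have "strain f ((a + b) / 2) ((b - a) / 2) = (f b - f a) \<bullet> ((b - a) / 2)"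
    by (simp add: strain_def)
  also have "\<dots> = work f a b / 2"
    by (simp add: work_def inner_complex_def add_divide_distrib)
  finally show ?thesis
    using strain_nonneg[of "(a + b) / 2" "(b - a) / 2"] by simp
qed

lemma inner_line_mono:
  assumes "s \<le> t"
  shows "f (a + of_real s * e) \<bullet> e \<le> f (a + of_real t * e) \<bullet> e"
proof (cases "s = t")
  case False
  have eq: "(a + of_real t * e) - (a + of_real s * e) = (t - s) *\<^sub>R e"
    by (simp add: scaleR_conv_of_real algebra_simps)
  have "0 \<le> (t - s) * ((f (a + of_real t * e) - f (a + of_real s * e)) \<bullet> e)"
    using work_nonneg[of "a + of_real s * e" "a + of_real t * e"] unfolding work_def eq by simp
  then show ?thesis
    using False assms by (simp add: zero_le_mult_iff inner_diff_left)
qed simp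

lemma work_le_strain:
  assumes "\<bar>x\<bar> \<le> 1"
  shows "work f a (a + of_real x * e) \<le> \<bar>x\<bar> * strain f a e"
proof -
  have eq: "a + of_real x * e - a = x *\<^sub>R e"
    by (simp add: scaleR_conv_of_real)
  have *: "work f a (a + of_real x * e) = x * (f (a + of_real x * e) \<bullet> e - f a \<bullet> e)"
    unfolding work_def eq by (simp add: inner_diff_left)
  have S: "strain f a e = f (a + e) \<bullet> e - f (a - e) \<bullet> e"
    by (simp add: strain_def inner_diff_left)
  have m: "f (a - e) \<bullet> e \<le> f a \<bullet> e" "f a \<bullet> e \<le> f (a + e) \<bullet> e"
    using inner_line_mono[of "-1" 0 a e] inner_line_mono[of 0 1 a e] by simp_all
  show ?thesis
  proof (cases "x \<ge> 0")
    case True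
    have "f (a + of_real x * e) \<bullet> e \<le> f (a + e) \<bullet> e"
      using inner_line_mono[of x 1 a e] assms by simp
    then have "f (a + of_real x * e) \<bullet> e - f a \<bullet> e \<le> strain f a e"
      using m S by linarith
    then show ?thesis
      using True by (simp add: * mult_left_mono)
  next
    case False
    have "f (a - e) \<bullet> e \<le> f (a + of_real x * e) \<bullet> e"
      using inner_line_mono[of "-1" x a e] assms by simp
    then have "f a \<bullet> e - f (a + of_real x * e) \<bullet> e \<le> strain f a e"
      using m S by linarith
    then have "(-x) * (f a \<bullet> e - f (a + of_real x * e) \<bullet> e) \<le> (-x) * strain f a e"
      using False by (intro mult_left_mono) auto
    then show ?thesis
      using False unfolding * by (simp add: algebra_simps)
  qed
qed

text \<open>The shifted segment lies inside the doubled one, and along a line the component of the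
  increment in the direction \<open>e\<close> grows with the segment.\<close>

lemma strain_le_double:
  assumes "\<bar>x\<bar> \<le> 1"
  shows "strain f (a + of_real x * e) e \<le> C * strain f a e"
proof -
  have "f (a + of_real x * e + e) \<bullet> e \<le> f (a + 2 * e) \<bullet> e"
    using inner_line_mono[of "x + 1" 2 a e] assms by (simp add: algebra_simps)
  moreover have "f (a - 2 * e) \<bullet> e \<le> f (a + of_real x * e - e) \<bullet> e"
    using inner_line_mono[of "-2" "x - 1" a e] assms by (simp add: algebra_simps)
  ultimately have le: "strain f (a + of_real x * e) e \<le> (f (a + 2 * e) - f (a - 2 * e)) \<bullet> e"
    by (simp add: strain_def inner_diff_left)
  have "strain f a (2 * e) = 2 * ((f (a + 2 * e) - f (a - 2 * e)) \<bullet> e)"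
    by (metis inner_scaleR_right scaleR_conv_of_real of_real_numeral strain_def)
  moreover have "0 \<le> (f (a + 2 * e) - f (a - 2 * e)) \<bullet> e"
    using strain_nonneg[of a "2 * e"] calculation by simp
  ultimately show ?thesis
    using le strain_double[of a e] by linarith
qed

text \<open>The segment from \<open>a\<close> to \<open>a + e\<close> is the middle third of the
  long one. Doubling it twice about its midpoint covers the long segment.\<close>

lemma strain_two_sided_le:
  "(f (a + 2 * e) - f (a - e)) \<bullet> e \<le> 2 * C\<^sup>2 * ((f (a + e) - f a) \<bullet> e)"
proof -
  define c where "c = a + e / 2"
  have s: "strain f c (2 * e) \<le> C * (C * strain f c (e / 2))"
    using strain_double[of c e] strain_double[of c "e / 2"] C_ge_1
    by (simp) (meson dual_order.trans mult_left_mono order_trans zero_le_one)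
  have half: "e / 2 = (1 / 2) *\<^sub>R e" and two: "2 * e = 2 *\<^sub>R e"
    by (simp_all add: scaleR_conv_of_real)
  have c: "c + e / 2 = a + e" "c - e / 2 = a"
    by (simp_all add: c_def)
  have 1: "strain f c (e / 2) = (1 / 2) * ((f (a + e) - f a) \<bullet> e)"
    unfolding strain_def c by (simp add: half)
  have 2: "strain f c (2 * e) = 2 * ((f (c + 2 * e) - f (c - 2 * e)) \<bullet> e)"
    unfolding strain_def by (simp add: two)
  have "f (a + 2 * e) \<bullet> e \<le> f (c + 2 * e) \<bullet> e"
    using inner_line_mono[of 2 "5/2" a e] by (simp add: c_def algebra_simps)
  moreover have "f (c - 2 * e) \<bullet> e \<le> f (a - e) \<bullet> e"
    using inner_line_mono[of "-3/2" "-1" a e] by (simp add: c_def algebra_simps)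
  ultimately have 3: "(f (a + 2 * e) - f (a - e)) \<bullet> e \<le> (f (c + 2 * e) - f (c - 2 * e)) \<bullet> e"
    by (simp add: inner_diff_left)
  have "0 \<le> (f (a + e) - f a) \<bullet> e"
    using inner_line_mono[of 0 1 a e] by (simp add: inner_diff_left)
  then have "0 \<le> C\<^sup>2 * ((f (a + e) - f a) \<bullet> e)"
    by simp
  then show ?thesis
    using s 3 unfolding 1 2 by (simp add: power2_eq_square)
qed

text \<open>The factor \<open>4 * C ^ 3\<close> comes from the four sides of a rectangle, each
  reached by at most three uses of the hypothesis, and \<open>2 * C\<^sup>2\<close> from
  \<open>strain_two_sided_le\<close>.\<close>

definition "C1 = 8 * C ^ 5"

lemma C1_ge_1: "1 \<le> C1"
  using one_le_power[OF C_ge_1, of 5] unfolding C1_def by linarith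

text \<open>The rectangle with diagonal from \<open>a\<close> to \<open>z\<close> and one side along \<open>b - a\<close> reduces the
  claim to segments parallel or orthogonal to \<open>b - a\<close>.\<close>

lemma work_comparison:
  assumes "cmod (z - a) \<le> cmod (b - a)"
  shows "cmod (b - a) * work f a z \<le> C1 * cmod (z - a) * work f a b"
proof (cases "b = a")
  case False
  define e where "e = b - a"
  define x where "x = Re ((z - a) / e)"
  define y where "y = Im ((z - a) / e)"
  have e0: "e \<noteq> 0" using False by (simp add: e_def)
  have "(z - a) / e = of_real x + \<i> * of_real y"
    by (simp add: x_def y_def complex_eq_iff)
  then have z: "z = a + of_real x * e + of_real y * (\<i> * e)"
    using e0 by (simp add: field_simps)
  have n: "cmod ((z - a) / e) \<le> 1"
    using assms e0 by (simp add: norm_divide e_def divide_le_eq_1)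
  have x1: "\<bar>x\<bar> \<le> cmod ((z - a) / e)" and y1: "\<bar>y\<bar> \<le> cmod ((z - a) / e)"
    by (simp_all add: x_def y_def abs_Re_le_cmod abs_Im_le_cmod)
  then have x: "\<bar>x\<bar> \<le> 1" and y: "\<bar>y\<bar> \<le> 1"
    using n by auto
  define S where "S = strain f a e"
  have S0: "0 \<le> S" by (simp add: S_def strain_nonneg)
  have Cpos: "0 \<le> C" using C_ge_1 by simp
  have mono: "strain f c' e' \<le> C * s \<Longrightarrow> s \<le> t \<Longrightarrow> strain f c' e' \<le> C * t" for c' e' s t
    using Cpos by (meson dual_order.trans mult_left_mono)
  have s1: "strain f (a + of_real x * e) e \<le> C * S"
    using strain_le_double[OF x] by (simp add: S_def)
  have s2: "strain f (a + of_real x * e) (\<i> * e) \<le> C * (C * S)"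
    using mono[OF strain_rotate s1] .
  have s3: "strain f a (\<i> * e) \<le> C * S"
    using strain_rotate by (simp add: S_def)
  have s4: "strain f (a + of_real y * (\<i> * e)) (\<i> * e) \<le> C * (C * S)"
    using mono[OF strain_le_double[OF y] s3] .
  \<comment> \<open>A second quarter turn leads to \<open>- e\<close>, whose strain is that of
    \<open>e\<close>.\<close>
  have s5: "strain f (a + of_real y * (\<i> * e)) e \<le> C * (C * (C * S))"
    using mono[OF strain_rotate s4] strain_minus[of _ e] by (simp add: mult.assoc[symmetric])
  have p: "S \<le> C ^ 3 * S" "C * S \<le> C ^ 3 * S" "C * (C * S) \<le> C ^ 3 * S" 
    using mult_right_mono[OF power_increasing[of 0 3 C] S0] mult_right_mono[OF power_increasing[of 1 3 C] S0]
      mult_right_mono[OF power_increasing[of 2 3 C] S0] C_ge_1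
    by (simp_all add: mult.assoc power2_eq_square)
  have w1: "work f a (a + of_real x * e) \<le> \<bar>x\<bar> * (C ^ 3 * S)"
    using work_le_strain[OF x, of a e] p(1) unfolding S_def
    by (meson abs_ge_zero dual_order.trans mult_left_mono)
  have w2: "work f (a + of_real x * e) (a + of_real x * e + of_real y * (\<i> * e)) \<le> \<bar>y\<bar> * (C ^ 3 * S)"
    using work_le_strain[OF y, of "a + of_real x * e" "\<i> * e"] s2 p(3)
    by (meson abs_ge_zero dual_order.trans mult_left_mono)
  have w3: "work f a (a + of_real y * (\<i> * e)) \<le> \<bar>y\<bar> * (C ^ 3 * S)"
    using work_le_strain[OF y, of a "\<i> * e"] s3 p(2)
    by (meson abs_ge_zero dual_order.trans mult_left_mono)
  have "strain f (a + of_real y * (\<i> * e)) e \<le> C ^ 3 * S"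
    using s5 by (simp add: power3_eq_cube mult.assoc)
  then have w4: "work f (a + of_real y * (\<i> * e)) (a + of_real x * e + of_real y * (\<i> * e)) \<le> \<bar>x\<bar> * (C ^ 3 * S)"
    using work_le_strain[OF x, of "a + of_real y * (\<i> * e)" e]
    by (simp add: add.assoc add.commute[of "of_real y * (\<i> * e)"])
       (meson abs_ge_zero dual_order.trans mult_left_mono)
  have "work f a z \<le> 2 * (\<bar>x\<bar> + \<bar>y\<bar>) * (C ^ 3 * S)"
    using work_parallelogram[of f a "of_real x * e" "of_real y * (\<i> * e)"] w1 w2 w3 w4
      work_nonneg[of "a + of_real x * e" "a + of_real y * (\<i> * e)"]
    unfolding z by (simp add: algebra_simps)
  also have "\<dots> \<le> 4 * cmod ((z - a) / e) * (C ^ 3 * S)"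
    using x1 y1 S0 Cpos by (intro mult_right_mono) auto
  finally have A: "work f a z \<le> 4 * cmod ((z - a) / e) * (C ^ 3 * S)" .
  have "f (a + e) \<bullet> e \<le> f (a + 2 * e) \<bullet> e"
    using inner_line_mono[of 1 2 a e] by simp
  then have "S \<le> 2 * C\<^sup>2 * ((f (a + e) - f a) \<bullet> e)"
    using strain_two_sided_le[of a e] by (simp add: S_def strain_def inner_diff_left)
  then have S: "S \<le> 2 * C\<^sup>2 * work f a b"
    by (simp add: work_def e_def)
  have "work f a z \<le> 4 * cmod ((z - a) / e) * (C ^ 3 * (2 * C\<^sup>2 * work f a b))"
    using A S Cpos by (meson dual_order.trans mult_left_mono mult_nonneg_nonneg norm_ge_zero zero_le_numeral zero_le_power)
  also have "\<dots> = C1 * cmod ((z - a) / e) * work f a b"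
    by (simp add: C1_def power2_eq_square eval_nat_numeral)
  finally show ?thesis
    using e0 by (simp add: norm_divide e_def[symmetric] field_simps)
qed (use assms in \<open>simp add: work_def\<close>)

section \<open>Comparison across dyadic scales\<close>

definition "C2 = 2 * C\<^sup>2"

lemma C2_ge_1: "1 \<le> C2"
  using one_le_power[OF C_ge_1, of 2] unfolding C2_def by linarith

lemma line_double_pow:
  "(f (a + 2 ^ n * e) - f a) \<bullet> e \<le> C2 ^ n * ((f (a + e) - f a) \<bullet> e)"
proof (induction n)
  case (Suc n)
  define e' where "e' = 2 ^ n * e"
  have e': "e' = (2 ^ n) *\<^sub>R e"
    by (simp add: e'_def scaleR_conv_of_real)
  have "f (a - e') \<bullet> e' \<le> f a \<bullet> e'"
    using inner_line_mono[of "-1" 0 a e'] by simp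
  then have "(f (a + 2 * e') - f a) \<bullet> e' \<le> C2 * ((f (a + e') - f a) \<bullet> e')"
    using strain_two_sided_le[of a e'] unfolding C2_def inner_diff_left by linarith
  then have "(f (a + 2 * e') - f a) \<bullet> e \<le> C2 * ((f (a + e') - f a) \<bullet> e)"
    unfolding e' by simp
  also have "\<dots> \<le> C2 * (C2 ^ n * ((f (a + e) - f a) \<bullet> e))"
    using Suc C2_ge_1 by (intro mult_left_mono) (auto simp: e'_def)
  finally show ?case
    by (simp add: e'_def mult.assoc)
qed simp

text \<open>Stretching \<open>b - a\<close> by \<open>2 ^ n\<close> puts \<open>z\<close> within
  reach of \<open>work_comparison\<close>; the stretching costs a factor \<open>C2\<close> per
  doubling.\<close>

lemma work_comparison_pow:
  assumes "cmod (z - a) \<le> 2 ^ n * cmod (b - a)"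
  shows "cmod (b - a) * work f a z \<le> C1 * C2 ^ n * cmod (z - a) * work f a b"
proof -
  define b' where "b' = a + 2 ^ n * (b - a)"
  have "b' - a = (2 ^ n) *\<^sub>R (b - a)"
    by (simp add: b'_def scaleR_conv_of_real)
  then have w: "work f a b' = 2 ^ n * ((f b' - f a) \<bullet> (b - a))"
    and nb: "cmod (b' - a) = 2 ^ n * cmod (b - a)"
    unfolding work_def by simp_all
  have "(f b' - f a) \<bullet> (b - a) \<le> C2 ^ n * work f a b"
    using line_double_pow[of a n "b - a"] by (simp add: b'_def work_def)
  then have "work f a b' \<le> 2 ^ n * (C2 ^ n * work f a b)"
    unfolding w by simp
  then have "C1 * cmod (z - a) * work f a b' \<le> C1 * cmod (z - a) * (2 ^ n * (C2 ^ n * work f a b))"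
    using C1_ge_1 by (intro mult_left_mono mult_nonneg_nonneg) auto
  moreover have "cmod (b' - a) * work f a z \<le> C1 * cmod (z - a) * work f a b'"
    by (rule work_comparison) (simp add: nb assms)
  ultimately have "cmod (b' - a) * work f a z \<le> C1 * cmod (z - a) * (2 ^ n * (C2 ^ n * work f a b))"
    by linarith
  then have "2 ^ n * (cmod (b - a) * work f a z) \<le> 2 ^ n * (C1 * C2 ^ n * cmod (z - a) * work f a b)"
    by (simp only: nb mult_ac)
  then show ?thesis
    by simp
qed

section \<open>Hoelder continuity\<close>

definition "eta = C1 / (1 + C1)"

lemma eta: "0 < eta" "eta < 1"
  using C1_ge_1 by (simp_all add: eta_def)

text \<open>Seen from the midpoint, the two halves of the segment are comparable up to
  \<open>C1\<close>, so the first carries at most the fraction \<open>C1 / (1 + C1)\<close> of the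
  whole. This contraction is the source of the Hoelder exponent.\<close>

lemma line_halve:
  "(f (a + e) - f a) \<bullet> e \<le> eta * ((f (a + 2 * e) - f a) \<bullet> e)"
proof (cases "e = 0")
  case False
  have "cmod e * work f (a + e) a \<le> C1 * cmod e * work f (a + e) (a + 2 * e)"
    using work_comparison[of a "a + e" "a + 2 * e"] by simp
  then have "work f (a + e) a \<le> C1 * work f (a + e) (a + 2 * e)"
    using False by (simp add: mult.left_commute)
  moreover have "work f (a + e) (a + 2 * e) = (f (a + 2 * e) - f (a + e)) \<bullet> e"
    by (simp add: work_def)
  ultimately have "(f (a + e) - f a) \<bullet> e \<le> C1 * ((f (a + 2 * e) - f (a + e)) \<bullet> e)"
    by (simp add: work_def inner_diff_left)
  then have "(1 + C1) * ((f (a + e) - f a) \<bullet> e) \<le> C1 * ((f (a + 2 * e) - f a) \<bullet> e)"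
    by (simp add: inner_diff_left algebra_simps)
  then show ?thesis
    using C1_ge_1 by (simp add: eta_def field_simps)
qed simp

lemma line_halve_pow:
  "(f (a + e) - f a) \<bullet> e \<le> eta ^ n * ((f (a + 2 ^ n * e) - f a) \<bullet> e)"
proof (induction n)
  case (Suc n)
  define e' where "e' = 2 ^ n * e"
  have e': "e' = (2 ^ n) *\<^sub>R e"
    by (simp add: e'_def scaleR_conv_of_real)
  have "(f (a + e') - f a) \<bullet> e \<le> eta * ((f (a + 2 * e') - f a) \<bullet> e)"
    using line_halve[of a e'] unfolding e' by simp
  then have "eta ^ n * ((f (a + e') - f a) \<bullet> e) \<le> eta ^ n * (eta * ((f (a + 2 * e') - f a) \<bullet> e))"
    using eta by (intro mult_left_mono) auto
  with Suc show ?case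
    by (simp add: e'_def mult.assoc mult.left_commute)
qed simp

text \<open>Strain does not control a whole increment: the rotation \<open>\<i> * z\<close> has zero
  strain. Affine maps cancel in second differences, and so both components can be bounded: along
  \<open>e\<close> by monotonicity, across \<open>e\<close> by the works from the three points to an
  apex \<open>s\<close> above the midpoint.\<close>

lemma second_difference_le:
  "cmod (f a + f (a + 2 * e) - 2 * f (a + e)) * cmod e \<le> 8 * C1 * ((f (a + 2 * e) - f a) \<bullet> e)"
proof (cases "e = 0")
  case False
  define X where "X = (f (a + 2 * e) - f a) \<bullet> e"
  define D where "D = f a + f (a + 2 * e) - 2 * f (a + e)"
  define s where "s = a + e + \<i> * e"
  have two: "2 * e = 2 *\<^sub>R e" by (simp add: scaleR_conv_of_real)
  have m: "f a \<bullet> e \<le> f (a + e) \<bullet> e" "f (a + e) \<bullet> e \<le> f (a + 2 * e) \<bullet> e"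
    using inner_line_mono[of 0 1 a e] inner_line_mono[of 1 2 a e] by simp_all
  have De: "\<bar>D \<bullet> e\<bar> \<le> X"
  proof -
    have "D \<bullet> e = f a \<bullet> e + f (a + 2 * e) \<bullet> e - 2 * (f (a + e) \<bullet> e)"
      by (simp add: D_def inner_complex_def algebra_simps)
    then show ?thesis
      using m unfolding X_def inner_diff_left by linarith
  qed
  have X0: "0 \<le> X" using m by (simp add: X_def inner_diff_left)
  have wX: "work f a (a + 2 * e) = 2 * X"
    by (simp add: work_def X_def two)
  have wX': "work f (a + 2 * e) a = 2 * X"
    using wX by (simp add: work_commute)
  have r2: "cmod (1 + \<i>) \<le> 2" "cmod (\<i> - 1) \<le> 2"
    using norm_triangle_ineq[of 1 "\<i>"] norm_triangle_ineq4[of "\<i>" 1] by simp_all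
  have "s - a = (1 + \<i>) * e" "s - (a + 2 * e) = (\<i> - 1) * e"
    by (simp_all add: s_def algebra_simps)
  then have n1: "cmod (s - a) \<le> 2 * cmod e" and n2: "cmod (s - (a + 2 * e)) \<le> 2 * cmod e"
    using r2 by (simp_all add: norm_mult mult_right_mono)
  have step: "work f p q \<le> C1 * work f p q'"
    if "cmod (q - p) \<le> cmod (q' - p)" "q' \<noteq> p" for p q q'
  proof -
    have "cmod (q' - p) * work f p q \<le> C1 * cmod (q - p) * work f p q'"
      by (rule work_comparison[OF that(1)])
    also have "\<dots> \<le> C1 * cmod (q' - p) * work f p q'"
      using that(1) C1_ge_1 work_nonneg by (intro mult_right_mono mult_left_mono) auto
    finally have "cmod (q' - p) * work f p q \<le> cmod (q' - p) * (C1 * work f p q')"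
      by (simp only: mult_ac)
    then show ?thesis
      using that(2) by simp
  qed
  have w1: "work f a s \<le> 2 * C1 * X"
    using step[of s a "a + 2 * e"] n1 wX False by (simp add: norm_mult)
  have w2: "work f (a + 2 * e) s \<le> 2 * C1 * X"
    using step[of s "a + 2 * e" a] n2 wX' False by (simp add: norm_mult)
  have "work f (a + e) s \<le> C1 * work f (a + e) a"
    using step[of s "a + e" a] False by (simp add: s_def norm_mult)
  also have "work f (a + e) a \<le> X"
    using m by (simp add: work_def X_def inner_diff_left)
  finally have w3: "work f (a + e) s \<le> C1 * X"
    using C1_ge_1 by simp
  \<comment> \<open>On expanding the works, all terms with \<open>f s\<close> cancel.\<close>
  have "D \<bullet> (\<i> * e) = X + 2 * work f (a + e) s - work f a s - work f (a + 2 * e) s"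
    by (simp add: D_def X_def work_def s_def inner_complex_def algebra_simps)
  moreover have "X \<le> C1 * X" using X0 C1_ge_1 by (simp add: mult_le_cancel_right1)
  ultimately have Di: "\<bar>D \<bullet> (\<i> * e)\<bar> \<le> 4 * C1 * X"
    using w1 w2 w3 work_nonneg[of "a + e" s] work_nonneg[of a s] work_nonneg[of "a + 2 * e" s] X0
    by (simp add: abs_le_iff)
  have "cmod D * cmod e = cmod (D * cnj e)"
    by (simp add: norm_mult)
  also have "\<dots> \<le> \<bar>Re (D * cnj e)\<bar> + \<bar>Im (D * cnj e)\<bar>"
    by (rule cmod_le)
  also have "\<dots> = \<bar>D \<bullet> e\<bar> + \<bar>D \<bullet> (\<i> * e)\<bar>"
    by (simp add: inner_complex_def algebra_simps)
  finally have "cmod D * cmod e \<le> X + 4 * C1 * X"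
    using De Di by linarith
  then show ?thesis
    using \<open>X \<le> C1 * X\<close> X0 unfolding D_def X_def by (simp add: mult.assoc)
qed simp

text \<open>At least \<open>eta\<close> for the decay of second differences, and at least
  \<open>3 / 4\<close> to close the induction in \<open>geometric_modulus\<close>, where
  \<open>(16 + 8) / 2 = 16 * (3 / 4)\<close>.\<close>

definition "theta = max eta (3 / 4)"

lemma theta: "0 < theta" "theta < 1" "eta \<le> theta" "3 / 4 \<le> theta"
  using eta by (auto simp: theta_def)

text \<open>The increment over \<open>e\<close> is half the increment over \<open>2 * e\<close>
  minus half a second difference. The latter is bounded by a strain, which
  \<open>line_halve_pow\<close> compares with the strain at the scale where \<open>M\<close>
  applies.\<close>

lemma geometric_modulus:
  assumes M: "\<And>e. cmod e \<le> 1 \<Longrightarrow> cmod (f (p + e) - f p) \<le> M"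
    and e: "2 ^ j * cmod e \<le> 1"
  shows "cmod (f (p + e) - f p) \<le> 16 * C1 * M * theta ^ j"
  using e
proof (induction j arbitrary: e)
  case 0
  have "0 \<le> M" using M[of 0] by simp
  then have "M \<le> 16 * C1 * M"
    using C1_ge_1 by (simp add: mult_le_cancel_right1)
  with M[of e] 0 show ?case by simp
next
  case (Suc j)
  have M0: "0 \<le> M" using M[of 0] by simp
  have IH: "cmod (f (p + 2 * e) - f p) \<le> 16 * C1 * M * theta ^ j"
    using Suc by (simp add: norm_mult mult_ac)
  show ?case
  proof (cases "e = 0")
    case True
    then show ?thesis
      using M0 C1_ge_1 theta by (simp del: power_Suc)
  next
    case False
    define D where "D = f p + f (p + 2 * e) - 2 * f (p + e)"
    have two: "2 * e = 2 *\<^sub>R e" by (simp add: scaleR_conv_of_real)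
    have "(f (p + 2 * e) - f p) \<bullet> e \<le> eta ^ j * ((f (p + 2 ^ j * (2 * e)) - f p) \<bullet> e)"
      using line_halve_pow[of p "2 * e" j] by (simp add: two)
    also have "\<dots> \<le> eta ^ j * (M * cmod e)"
    proof (intro mult_left_mono)
      have "(f (p + 2 ^ j * (2 * e)) - f p) \<bullet> e \<le> cmod (f (p + 2 ^ j * (2 * e)) - f p) * cmod e"
        by (rule norm_cauchy_schwarz)
      also have "\<dots> \<le> M * cmod e"
        using Suc.prems by (intro mult_right_mono M) (auto simp: norm_mult norm_power mult_ac)
      finally show "(f (p + 2 ^ j * (2 * e)) - f p) \<bullet> e \<le> M * cmod e" .
    qed (use eta in auto)
    finally have "8 * C1 * ((f (p + 2 * e) - f p) \<bullet> e) \<le> 8 * C1 * (eta ^ j * (M * cmod e))"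
      using C1_ge_1 by (intro mult_left_mono) auto
    then have "cmod D * cmod e \<le> (8 * C1 * M * eta ^ j) * cmod e"
      using second_difference_le[of p e] by (simp add: D_def mult_ac)
    then have "cmod D \<le> 8 * C1 * M * eta ^ j"
      using False by simp
    also have "\<dots> \<le> 8 * C1 * M * theta ^ j"
      using C1_ge_1 M0 eta theta by (intro mult_left_mono power_mono) auto
    finally have D: "cmod D \<le> 8 * C1 * M * theta ^ j" .
    have "f (p + e) - f p = (1 / 2) *\<^sub>R (f (p + 2 * e) - f p) - (1 / 2) *\<^sub>R D"
      by (simp add: D_def scaleR_conv_of_real algebra_simps) 
    then have "cmod (f (p + e) - f p) \<le> (1 / 2) * cmod (f (p + 2 * e) - f p) + (1 / 2) * cmod D"
      using norm_triangle_ineq4[of "(1 / 2) *\<^sub>R (f (p + 2 * e) - f p)" "(1 / 2) *\<^sub>R D"]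
      by simp
    also have "\<dots> \<le> 16 * C1 * M * (3 / 4) * theta ^ j"
      using IH D by linarith
    also have "\<dots> \<le> 16 * C1 * M * theta * theta ^ j"
      using C1_ge_1 M0 theta by (intro mult_right_mono mult_left_mono) auto
    finally show ?thesis
      by (simp add: mult_ac)
  qed
qed

end

section \<open>Dependence of solutions on their initial values\<close>

definition solves :: "(complex \<Rightarrow> complex) \<Rightarrow> real \<Rightarrow> real \<Rightarrow> (real \<Rightarrow> complex) \<Rightarrow> bool" where
  "solves f a b x \<longleftrightarrow> (\<forall>t\<in>{a..b}. (x has_vector_derivative f (x t)) (at t within {a..b}))"

lemma solves_subinterval:
  assumes "solves f a b x" "a \<le> s" "t \<le> b"
  shows "solves f s t x"
  unfolding solves_def
proof
  fix \<tau> assume "\<tau> \<in> {s..t}"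
  then have "(x has_vector_derivative f (x \<tau>)) (at \<tau> within {a..b})"
    using assms by (auto simp: solves_def)
  then show "(x has_vector_derivative f (x \<tau>)) (at \<tau> within {s..t})"
    using assms by (auto elim: has_vector_derivative_within_subset)
qed

lemma solves_shift:
  assumes "solves f (a + h) (b + h) x"
  shows "solves f a b (\<lambda>t. x (t + h))"
  unfolding solves_def
proof
  fix t assume t: "t \<in> {a..b}"
  have "((\<lambda>t. t + h) has_vector_derivative 1) (at t within {a..b})"
    by (auto intro!: derivative_eq_intros)
  moreover have "(x has_vector_derivative f (x (t + h))) (at (t + h) within (\<lambda>t. t + h) ` {a..b})"
    using assms t by (simp add: solves_def image_add_atLeastAtMost')
  ultimately show "((\<lambda>t. x (t + h)) has_vector_derivative f (x (t + h))) (at t within {a..b})"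
    using vector_diff_chain_within[of "\<lambda>t. t + h" 1 t "{a..b}" x] by (simp add: o_def)
qed

lemma solves_continuous_on: "solves f a b x \<Longrightarrow> continuous_on {a..b} x"
  unfolding solves_def continuous_on_eq_continuous_within
  using has_vector_derivative_continuous by blast

lemma solves_zero: "f 0 = 0 \<Longrightarrow> solves f a b (\<lambda>_. 0)"
  by (simp add: solves_def)

lemma solves_distance_has_derivative:
  assumes "solves f a b x" "solves f a b y" "t \<in> {a..b}" "x t \<noteq> y t"
  shows "((\<lambda>t. cmod (y t - x t)) has_derivative
    (\<lambda>h. h * (work f (x t) (y t) / cmod (y t - x t)))) (at t within {a..b})"
proof -
  have "((\<lambda>t. y t - x t) has_derivative (\<lambda>h. h *\<^sub>R (f (y t) - f (x t)))) (at t within {a..b})"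
    using assms has_vector_derivative_diff unfolding solves_def has_vector_derivative_def[symmetric]
    by blast
  moreover have "(norm has_derivative (\<lambda>h. h \<bullet> sgn (y t - x t))) (at (y t - x t))"
    using assms by (intro has_derivative_norm) auto
  ultimately have "((\<lambda>t. cmod (y t - x t)) has_derivative
      (\<lambda>h. (h *\<^sub>R (f (y t) - f (x t))) \<bullet> sgn (y t - x t))) (at t within {a..b})"
    using has_derivative_compose by fastforce
  moreover have "(h *\<^sub>R (f (y t) - f (x t))) \<bullet> sgn (y t - x t) =
      h * (work f (x t) (y t) / cmod (y t - x t))" for h
    by (simp add: work_def sgn_div_norm divide_inverse_commute)
  ultimately show ?thesis
    by simp
qed

lemma solves_lipschitz:
  assumes "solves f a b x" "\<And>t. t \<in> {a..b} \<Longrightarrow> cmod (f (x t)) \<le> M" "s \<in> {a..b}" "t \<in> {a..b}"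
  shows "cmod (x t - x s) \<le> M * \<bar>t - s\<bar>"
proof -
  have "norm (x t - x s) \<le> M * norm (t - s)"
  proof (rule differentiable_bound[of "{a..b}" x "\<lambda>t h. h *\<^sub>R f (x t)"])
    show "onorm (\<lambda>h. h *\<^sub>R f (x u)) \<le> M" if "u \<in> {a..b}" for u
      using assms(2)[OF that] by (intro onorm_le) (simp add: mult.commute[of M] mult_left_mono)
  qed (use assms in \<open>auto simp: solves_def has_vector_derivative_def\<close>)
  then show ?thesis
    by simp
qed

lemma solves_linearization:
  assumes "solves f t (t + h) x" "0 \<le> h"
    and "\<And>s. s \<in> {t..t + h} \<Longrightarrow> cmod (f (x s) - f (x t)) \<le> \<delta>"
  shows "\<bar>cmod (x (t + h) - x t) - h * cmod (f (x t))\<bar> \<le> h * \<delta>"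
proof -
  have "norm (x (t + h) - x t - (t + h - t) *\<^sub>R f (x t)) \<le> norm (t + h - t) * \<delta>"
    using assms unfolding solves_def
    by (intro vector_differentiable_bound_linearization[of "{t..t + h}"])
       (auto simp: closed_segment_eq_real_ivl)
  moreover have "\<bar>cmod (x (t + h) - x t) - cmod (h *\<^sub>R f (x t))\<bar> \<le> cmod (x (t + h) - x t - h *\<^sub>R f (x t))"
    by (rule norm_triangle_ineq3)
  ultimately show ?thesis
    using assms(2) by simp
qed

context doubling_field
begin

lemma distance_mono:
  assumes x: "solves f a b x" and y: "solves f a b y" and st: "a \<le> s" "s \<le> t" "t \<le> b"
  shows "cmod (y s - x s) \<le> cmod (y t - x t)"
proof -
  \<comment> \<open>The square of the distance is differentiable even at times where the curves
    meet.\<close>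
  define g where "g = (\<lambda>t. (y t - x t) \<bullet> (y t - x t))"
  have "(g has_derivative (\<lambda>h. h * (2 * work f (x u) (y u)))) (at u within {s..t})"
    if "s \<le> u" "u \<le> t" for u
  proof -
    have "((\<lambda>t. y t - x t) has_derivative (\<lambda>h. h *\<^sub>R (f (y u) - f (x u)))) (at u within {s..t})"
      using solves_subinterval[OF x, of s t] solves_subinterval[OF y, of s t] st that
      unfolding solves_def has_vector_derivative_def[symmetric]
      by (intro has_vector_derivative_diff) auto
    note has_derivative_inner[OF this this]
    moreover have "(y u - x u) \<bullet> (h *\<^sub>R (f (y u) - f (x u))) + (h *\<^sub>R (f (y u) - f (x u))) \<bullet> (y u - x u)
        = h * (2 * work f (x u) (y u))" for h
      by (simp add: work_def inner_commute)
    ultimately show ?thesis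
      by (simp add: g_def)
  qed
  then obtain u where "g t - g s = (t - s) * (2 * work f (x u) (y u))"
    using mvt_very_simple[OF st(2), of g "\<lambda>u h. h * (2 * work f (x u) (y u))"] by blast
  then have "g s \<le> g t"
    using work_nonneg[of "x u" "y u"] st by (smt (verit) mult_nonneg_nonneg)
  then show ?thesis
    by (simp add: g_def dot_square_norm)
qed

text \<open>The origin is a stationary solution, so \<open>cmod (x t)\<close> is itself a distance
  of two solutions; its growth rate is \<open>f (x t) \<bullet> x t / cmod (x t)\<close>.\<close>

lemma norm_growth:
  assumes x: "solves f a b x" and 0: "f 0 = 0" "0 < r" and r: "\<And>t. t \<in> {a..b} \<Longrightarrow> r \<le> cmod (x t)"
    and c: "\<And>z. r \<le> cmod z \<Longrightarrow> c * cmod z \<le> f z \<bullet> z"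
    and st: "a \<le> s" "s \<le> t" "t \<le> b"
  shows "c * (t - s) \<le> cmod (x t) - cmod (x s)"
proof -
  have nz: "x u \<noteq> 0" if "s \<le> u" "u \<le> t" for u
    using r[of u] that st 0 by auto
  have "((\<lambda>t. cmod (x t)) has_derivative (\<lambda>h. h * (work f 0 (x u) / cmod (x u)))) (at u within {s..t})"
    if "s \<le> u" "u \<le> t" for u
    using solves_distance_has_derivative[OF solves_zero[of f s t] solves_subinterval[OF x, of s t], of u]
      nz[OF that] st 0 that by simp
  from mvt_very_simple[OF st(2) this] obtain u where u: "u \<in> {s..t}"
    "cmod (x t) - cmod (x s) = (t - s) * (work f 0 (x u) / cmod (x u))" by auto
  have "c * cmod (x u) \<le> work f 0 (x u)"
    using c[of "x u"] r[of u] u st 0 by (simp add: work_def)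
  then have "c \<le> work f 0 (x u) / cmod (x u)"
    using nz[of u] u by (simp add: pos_le_divide_eq)
  then show ?thesis
    using u(2) st mult_left_mono[of c "work f 0 (x u) / cmod (x u)" "t - s"]
    by (simp only: mult.commute[of c])
qed

text \<open>The displacement \<open>x (t + h) - x t\<close> is itself a difference of two solutions. As long as it is
  longer than \<open>y t - x t\<close>, comparing the two shows that it expands at least at a comparable rate.\<close>

lemma distance_increment_le:
  assumes x: "solves f a b x" and y: "solves f a b y"
    and st: "a \<le> s" "s \<le> t" "t + h \<le> b" "0 \<le> h"
    and u: "\<And>\<tau>. \<tau> \<in> {s..t} \<Longrightarrow> x \<tau> \<noteq> y \<tau> \<and> cmod (y \<tau> - x \<tau>) \<le> cmod (x (\<tau> + h) - x \<tau>)"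
  shows "cmod (y t - x t) - cmod (y s - x s) \<le>
    C1 * (cmod (x (t + h) - x t) - cmod (x (s + h) - x s))"
proof -
  \<comment> \<open>By \<open>work_comparison\<close>, \<open>C1\<close> times the growth rate of
    the longer distance dominates that of the shorter, so \<open>g\<close> is nondecreasing.\<close>
  define g where "g = (\<lambda>\<tau>. C1 * cmod (x (\<tau> + h) - x \<tau>) - cmod (y \<tau> - x \<tau>))"
  define w where "w = (\<lambda>\<tau>. C1 * (work f (x \<tau>) (x (\<tau> + h)) / cmod (x (\<tau> + h) - x \<tau>))
    - work f (x \<tau>) (y \<tau>) / cmod (y \<tau> - x \<tau>))"
  have xs: "solves f s t x" and ys: "solves f s t y" and xh: "solves f s t (\<lambda>\<tau>. x (\<tau> + h))"
    using solves_subinterval[OF x] solves_subinterval[OF y] st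
    by (auto intro!: solves_shift)
  have ne: "x (\<tau> + h) \<noteq> x \<tau>" if "\<tau> \<in> {s..t}" for \<tau>
    using u[OF that] by auto
  have "(g has_derivative (\<lambda>h. h * w \<tau>)) (at \<tau> within {s..t})" if "s \<le> \<tau>" "\<tau> \<le> t" for \<tau>
    using solves_distance_has_derivative[OF xs ys, of \<tau>] solves_distance_has_derivative[OF xs xh, of \<tau>]
      u[of \<tau>] ne[of \<tau>] that
    unfolding g_def w_def
    by (auto intro!: derivative_eq_intros simp: algebra_simps)
  from mvt_very_simple[OF st(2) this] obtain \<tau> where \<tau>: "\<tau> \<in> {s..t}" "g t - g s = (t - s) * w \<tau>"
    by auto
  have pos: "0 < cmod (y \<tau> - x \<tau>)" "0 < cmod (x (\<tau> + h) - x \<tau>)"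
    using u[OF \<tau>(1)] ne[OF \<tau>(1)] by auto
  have "cmod (x (\<tau> + h) - x \<tau>) * work f (x \<tau>) (y \<tau>) \<le> C1 * cmod (y \<tau> - x \<tau>) * work f (x \<tau>) (x (\<tau> + h))"
    using work_comparison u[OF \<tau>(1)] by blast
  then have "0 \<le> w \<tau>"
    using pos by (simp add: w_def field_simps)
  then have "g s \<le> g t"
    using \<tau> st by (smt (verit) mult_nonneg_nonneg)
  then show ?thesis
    by (simp add: g_def right_diff_distrib)
qed

text \<open>While the distance doubles from \<open>2 ^ n * u\<close> to \<open>2 ^ Suc n * u\<close>, the mean speed of \<open>x\<close> over
  times of length \<open>h = 2 ^ Suc n * u / c\<close> grows by a fixed amount. It differs from the speed
  \<open>cmod (f (x t))\<close>, which is bounded, by errors that form a geometric series in \<open>n\<close>.\<close>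

lemma doubling_stages_le:
  fixes N q :: nat
  assumes ab: "a \<le> b" and x: "solves f a b x" and y: "solves f a b y" and f0: "f 0 = 0"
    and r: "0 < r" "\<And>t. t \<in> {a..b} \<Longrightarrow> r \<le> cmod (x t)"
    and R: "\<And>t. t \<in> {a..b} \<Longrightarrow> cmod (x t) \<le> R" "\<And>t. t \<in> {a..b} \<Longrightarrow> cmod (y t) \<le> R"
    and c: "0 < c" "\<And>z. r \<le> cmod z \<Longrightarrow> c * cmod z \<le> f z \<bullet> z"
    and M: "0 < M" "\<And>z. cmod z \<le> R \<Longrightarrow> cmod (f z) \<le> M"
    and A: "0 \<le> A" "\<And>p e j. \<lbrakk>cmod p \<le> R; 2 ^ j * cmod e \<le> 1\<rbrakk> \<Longrightarrow> cmod (f (p + e) - f p) \<le> A * theta ^ j"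
    and q: "4 * M * R / c \<le> 2 ^ q"
    and u: "0 < cmod (y a - x a)" "(1 + 2 * M / c) * 2 ^ (N + q) * cmod (y a - x a) \<le> cmod (y b - x b)"
  shows "real N * (c / (2 * C1)) \<le> M + 2 * A / (1 - theta)"
proof -
  define D where "D = (\<lambda>t. cmod (y t - x t))"
  \<comment> \<open>Chosen such that \<open>c * h n\<close> is the distance at the end of stage
    \<open>n\<close>. As \<open>cmod (x t)\<close> grows at a rate of at least \<open>c\<close>, the
    displacement of \<open>x\<close> over time \<open>h n\<close> is at least as long as
    \<open>D\<close> during the whole stage.\<close>
  define h where "h = (\<lambda>n::nat. 2 ^ Suc n * D a / c)"
  have D0: "0 < D a" using u by (simp add: D_def)
  have hpos: "0 < h n" for n using D0 c by (simp add: h_def)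
  have Dmono: "D s \<le> D t" if "a \<le> s" "s \<le> t" "t \<le> b" for s t
    unfolding D_def by (rule distance_mono[OF x y that])
  have big: "(1 + 2 * M / c) * 2 ^ k * D a \<le> D b" if "k \<le> N + q" for k
  proof -
    have "(1 + 2 * M / c) * 2 ^ k * D a \<le> (1 + 2 * M / c) * 2 ^ (N + q) * D a"
      using that D0 c M by (intro mult_right_mono mult_left_mono power_increasing) auto
    then show ?thesis
      using u by (simp add: D_def)
  qed
  have D2R: "D b \<le> 2 * R"
    using norm_triangle_ineq4[of "y b" "x b"] R[of b] ab by (simp add: D_def)
  have "\<forall>n\<in>{..N}. \<exists>t\<in>{a..b}. D t = 2 ^ n * D a"
  proof
    fix n assume n: "n \<in> {..N}"
    have "1 * (2 ^ n * D a) \<le> (1 + 2 * M / c) * (2 ^ n * D a)"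
      using D0 c M by (intro mult_right_mono) auto
    then have *: "2 ^ n * D a \<le> (1 + 2 * M / c) * (2 ^ n * D a)"
      unfolding mult_1 .
    have "2 ^ n * D a \<le> D b"
      using order_trans[OF *] big[of n] n by (simp add: mult.assoc)
    moreover have "1 * D a \<le> 2 ^ n * D a"
      using D0 by (intro mult_right_mono) auto
    moreover have "continuous_on {a..b} D"
      unfolding D_def using x y by (intro continuous_intros solves_continuous_on)
    ultimately show "\<exists>t\<in>{a..b}. D t = 2 ^ n * D a"
      using IVT'[of D a "2 ^ n * D a" b] ab by auto
  qed
  then obtain T where T: "\<And>n. n \<le> N \<Longrightarrow> T n \<in> {a..b} \<and> D (T n) = 2 ^ n * D a"
    by (metis atMost_iff)
  have fM: "cmod (f (x t)) \<le> M" "cmod (f (y t)) \<le> M" if "t \<in> {a..b}" for t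
    using M R that by auto
  have stage: "c / (2 * C1) \<le> cmod (f (x (T (Suc n)))) - cmod (f (x (T n))) + 2 * A * theta ^ (N - n)"
    if n: "n < N" for n
  proof -
    have Ts: "T n \<in> {a..b}" "T (Suc n) \<in> {a..b}" "D (T n) = 2 ^ n * D a" "D (T (Suc n)) = 2 ^ Suc n * D a"
      using T[of n] T[of "Suc n"] n by auto
    have TT: "T n \<le> T (Suc n)"
      using Dmono[of "T (Suc n)" "T n"] Ts D0 by (cases "T n \<le> T (Suc n)") auto
    \<comment> \<open>\<open>D\<close> grows at a rate of at most \<open>2 * M\<close>, and by
      \<open>big\<close> it still has to grow by at least \<open>2 * M * h n\<close> after the
      stage. Hence the interval extends by another \<open>h n\<close>.\<close>
    have "D b - D (T (Suc n)) \<le> cmod ((y b - y (T (Suc n))) - (x b - x (T (Suc n))))"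
      unfolding D_def using norm_triangle_ineq2[of "y b - x b" "y (T (Suc n)) - x (T (Suc n))"]
      by (simp add: algebra_simps)
    also have "\<dots> \<le> M * \<bar>b - T (Suc n)\<bar> + M * \<bar>b - T (Suc n)\<bar>"
      using Ts ab fM by (intro norm_triangle_le_diff add_mono solves_lipschitz[OF x] solves_lipschitz[OF y]) auto
    finally have "D b - D (T (Suc n)) \<le> 2 * M * (b - T (Suc n))"
      using Ts by simp
    moreover have "2 * M * h n \<le> D b - D (T (Suc n))"
      using big[of "Suc n"] n unfolding Ts(4) h_def by (simp add: field_simps)
    ultimately have "2 * M * h n \<le> 2 * M * (b - T (Suc n))"
      by linarith
    then have hb: "T (Suc n) + h n \<le> b"
      using M by simp
    have len: "c * h n \<le> cmod (x (\<tau> + h n) - x \<tau>)" if "\<tau> \<in> {T n..T (Suc n)}" for \<tau>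
    proof -
      have "c * h n \<le> cmod (x (\<tau> + h n)) - cmod (x \<tau>)"
        using norm_growth[OF x f0 r c(2), of \<tau> "\<tau> + h n"] that hb Ts hpos[of n] by auto
      then show ?thesis
        using norm_triangle_ineq2[of "x (\<tau> + h n)" "x \<tau>"] by linarith
    qed
    have inc: "D (T (Suc n)) - D (T n) \<le> C1 * (cmod (x (T (Suc n) + h n) - x (T (Suc n))) - cmod (x (T n + h n) - x (T n)))"
      unfolding D_def
    proof (rule distance_increment_le[OF x y])
      fix \<tau> assume \<tau>: "\<tau> \<in> {T n..T (Suc n)}"
      have "D \<tau> \<le> D (T (Suc n))" "D a \<le> D \<tau>"
        using \<tau> Ts(1,2) by (auto intro!: Dmono)
      then show "x \<tau> \<noteq> y \<tau> \<and> cmod (y \<tau> - x \<tau>) \<le> cmod (x (\<tau> + h n) - x \<tau>)"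
        using len[OF \<tau>] Ts(4) D0 c by (auto simp: D_def h_def)
    qed (use Ts TT hb hpos[of n] in auto)
    \<comment> \<open>Within time \<open>h n\<close> the curve moves by at most
      \<open>M * h n\<close>, which the \<open>q\<close> additional doublings force to be at most
      \<open>1 / 2 ^ (N - n)\<close>. The modulus of continuity at that scale is
      \<open>A * theta ^ (N - n)\<close>.\<close>
    have speed: "\<bar>cmod (x (t + h n) - x t) - h n * cmod (f (x t))\<bar> \<le> h n * (A * theta ^ (N - n))"
      if t: "t \<in> {T n..T (Suc n)}" for t
    proof (rule solves_linearization)
      show "solves f t (t + h n) x"
        using solves_subinterval[OF x] t Ts hb by auto
      show "0 \<le> h n" using hpos[of n] by simp
      fix s assume s: "s \<in> {t..t + h n}"
      have "cmod (x s - x t) \<le> M * \<bar>s - t\<bar>"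
        using s t Ts hb fM by (intro solves_lipschitz[OF x]) auto
      also have "\<dots> \<le> M * h n"
        using s M by (intro mult_left_mono) auto
      finally have "2 ^ (N - n) * cmod (x s - x t) \<le> 2 ^ (N - n) * (M * h n)"
        by simp
      also have "\<dots> = 2 * M / c * (2 ^ (N - n) * 2 ^ n) * D a"
        by (simp add: h_def)
      also have "2 ^ (N - n) * 2 ^ n = (2::real) ^ N"
        using n by (simp add: power_add[symmetric])
      also have "2 * M / c * 2 ^ N * D a \<le> 1"
      proof -
        have "1 * (2 ^ (N + q) * D a) \<le> (1 + 2 * M / c) * (2 ^ (N + q) * D a)"
          using D0 c M by (intro mult_right_mono) auto
        then have "2 ^ (N + q) * D a \<le> 2 * R"
          using big[OF order_refl] D2R unfolding mult.assoc mult_1 by linarith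
        then have "2 ^ q * (2 * M / c * 2 ^ N * D a) \<le> 2 * M / c * (2 * R)"
          using M c by (simp add: power_add field_simps)
        also have "\<dots> \<le> 2 ^ q * 1"
          using q by simp
        finally show ?thesis
          by (rule mult_left_le_imp_le) simp
      qed
      finally have "2 ^ (N - n) * cmod (x s - x t) \<le> 1" .
      from A(2)[OF _ this, of "x t"] show "cmod (f (x s) - f (x t)) \<le> A * theta ^ (N - n)"
        using R t Ts by auto
    qed
    have "2 ^ n * D a \<le> C1 * (h n * (cmod (f (x (T (Suc n)))) - cmod (f (x (T n))) + 2 * A * theta ^ (N - n)))"
    proof -
      have "cmod (x (T (Suc n) + h n) - x (T (Suc n))) - cmod (x (T n + h n) - x (T n)) \<le>
          h n * (cmod (f (x (T (Suc n)))) - cmod (f (x (T n))) + 2 * A * theta ^ (N - n))"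
        using speed[of "T n"] speed[of "T (Suc n)"] TT by (simp add: abs_le_iff algebra_simps)
      then have "D (T (Suc n)) - D (T n) \<le> C1 * (h n * (cmod (f (x (T (Suc n)))) - cmod (f (x (T n))) + 2 * A * theta ^ (N - n)))"
        using inc C1_ge_1 by (meson dual_order.trans mult_left_mono order_trans zero_le_one)
      then show ?thesis
        unfolding Ts(3,4) by (simp add: mult.commute)
    qed
    \<comment> \<open>As \<open>h n\<close> is proportional to \<open>2 ^ n * D a\<close>, the
      initial distance cancels, and the gain of speed per stage does not depend on it.\<close>
    also have "\<dots> = (2 ^ n * D a) * ((2 * C1 / c) * (cmod (f (x (T (Suc n)))) - cmod (f (x (T n))) + 2 * A * theta ^ (N - n)))"
      by (simp add: h_def)
    finally have "(2 ^ n * D a) * 1 \<le> (2 ^ n * D a) * ((2 * C1 / c) * (cmod (f (x (T (Suc n)))) - cmod (f (x (T n))) + 2 * A * theta ^ (N - n)))"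
      unfolding mult_1_right .
    then have "1 \<le> (2 * C1 / c) * (cmod (f (x (T (Suc n)))) - cmod (f (x (T n))) + 2 * A * theta ^ (N - n))"
      by (rule mult_left_le_imp_le) (simp add: D0)
    then show ?thesis
      using c C1_ge_1 by (simp add: field_simps)
  qed
  have "real N * (c / (2 * C1)) = (\<Sum>n<N. c / (2 * C1))"
    by simp
  also have "\<dots> \<le> (\<Sum>n<N. cmod (f (x (T (Suc n)))) - cmod (f (x (T n))) + 2 * A * theta ^ (N - n))"
    using stage by (intro sum_mono) auto
  also have "\<dots> = cmod (f (x (T N))) - cmod (f (x (T 0))) + 2 * A * (\<Sum>n<N. theta ^ (N - n))"
    by (simp add: sum.distrib sum_lessThan_telescope[of "\<lambda>n. cmod (f (x (T n)))"] sum_distrib_left)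
  finally have le: "real N * (c / (2 * C1)) \<le> cmod (f (x (T N))) - cmod (f (x (T 0))) + 2 * A * (\<Sum>n<N. theta ^ (N - n))" .
  have "(\<Sum>n<N. theta ^ (N - n)) \<le> (\<Sum>n<N. theta ^ (N - Suc n))"
    using theta by (intro sum_mono power_decreasing) auto
  also have "\<dots> = (\<Sum>n<N. theta ^ n)"
    by (rule sum.nat_diff_reindex)
  also have "\<dots> \<le> 1 / (1 - theta)"
    using theta by (simp add: sum_gp_strict divide_right_mono)
  finally have "2 * A * (\<Sum>n<N. theta ^ (N - n)) \<le> 2 * A * (1 / (1 - theta))"
    using A(1) by (intro mult_left_mono) auto
  moreover have "cmod (f (x (T N))) - cmod (f (x (T 0))) \<le> M"
    using fM(1)[of "T N"] T[of N] norm_ge_zero[of "f (x (T 0))"] by linarith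
  ultimately show ?thesis
    using le by simp
qed

text \<open>With this \<open>N\<close>, the stages would require more speed than is available. This
  bounds the growth from every time at which the distance is positive.\<close>

lemma expansion_bound:
  fixes N q :: nat
  assumes ab: "a \<le> b" and x: "solves f a b x" and y: "solves f a b y" and f0: "f 0 = 0"
    and r: "0 < r" "\<And>t. t \<in> {a..b} \<Longrightarrow> r \<le> cmod (x t)"
    and R: "\<And>t. t \<in> {a..b} \<Longrightarrow> cmod (x t) \<le> R" "\<And>t. t \<in> {a..b} \<Longrightarrow> cmod (y t) \<le> R"
    and c: "0 < c" "\<And>z. r \<le> cmod z \<Longrightarrow> c * cmod z \<le> f z \<bullet> z"
    and M: "0 < M" "\<And>z. cmod z \<le> R \<Longrightarrow> cmod (f z) \<le> M"
    and A: "0 \<le> A" "\<And>p e j. \<lbrakk>cmod p \<le> R; 2 ^ j * cmod e \<le> 1\<rbrakk> \<Longrightarrow> cmod (f (p + e) - f p) \<le> A * theta ^ j"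
    and q: "4 * M * R / c \<le> 2 ^ q"
    and N: "M + 2 * A / (1 - theta) < real N * (c / (2 * C1))"
  shows "cmod (y b - x b) \<le> (1 + 2 * M / c) * 2 ^ (N + q) * cmod (y a - x a)"
proof -
  define B where "B = (1 + 2 * M / c) * 2 ^ (N + q)"
  have "1 * 1 \<le> B"
    unfolding B_def using M c by (intro mult_mono) auto
  then have B: "1 \<le> B" by simp
  have pos: "cmod (y b - x b) \<le> B * cmod (y s - x s)" if s: "s \<in> {a..b}" and "0 < cmod (y s - x s)" for s
  proof (rule ccontr)
    assume "\<not> ?thesis"
    then have "real N * (c / (2 * C1)) \<le> M + 2 * A / (1 - theta)"
      using s that(2) x y f0 r R c M A q
      by (intro doubling_stages_le[where a = s and b = b and x = x and y = y and r = r and R = R and q = q])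
         (auto simp: B_def intro: solves_subinterval)
    with N show False by simp
  qed
  show ?thesis
  proof (cases "y a = x a")
    case False
    then show ?thesis
      using pos[of a] ab by (simp add: B_def)
  next
    case True
    \<comment> \<open>Uniqueness of solutions, which continuity of \<open>f\<close> alone does not
      give. If the curves separated, their distance would take the value \<open>v\<close> at some
      time, and expansion by at most \<open>B\<close> from then on could not reach the final
      distance \<open>2 * B * v\<close>.\<close>
    have "y b = x b"
    proof (rule ccontr)
      assume ne: "y b \<noteq> x b"
      define v where "v = cmod (y b - x b) / (2 * B)"
      have v: "0 < v" "v \<le> cmod (y b - x b)"
        using ne B by (auto simp: v_def divide_le_eq mult_le_cancel_left1)
      have "continuous_on {a..b} (\<lambda>t. cmod (y t - x t))"
        using x y by (intro continuous_intros solves_continuous_on)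
      then obtain s where "s \<in> {a..b}" "cmod (y s - x s) = v"
        using IVT'[of "\<lambda>t. cmod (y t - x t)" a v b] True v ab by auto
      then have "cmod (y b - x b) \<le> B * v"
        using pos[of s] v by simp
      then show False
        using ne B by (simp add: v_def)
    qed
    then show ?thesis
      using True by simp
  qed
qed

end

text \<open>The normalization says that \<open>work f 0 1 = 1\<close>, and comparison then bounds
  the works based at \<open>0\<close>, \<open>1\<close> and \<open>\<i>\<close>. Two base points
  recover a component of the field: \<open>work f 0 z - work f 1 z\<close> is
  \<open>Re (f z)\<close> up to a term in \<open>f 1\<close>, which \<open>d\<close> controls, and
  \<open>\<i>\<close> in place of \<open>1\<close> yields \<open>Im (f z)\<close>.\<close>

lemma (in doubling_field) normalized_bounds:
  fixes n :: nat
  assumes f: "f 0 = 0" "Re (f 1) = 1" "cmod (f 1) \<le> d"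
  defines "G \<equiv> C1 * C2 ^ n"
  shows lower_bound: "\<And>z. 1 \<le> 2 ^ n * cmod z \<Longrightarrow> 1 / G * cmod z \<le> f z \<bullet> z"
    and upper_bound: "\<And>z R. 1 \<le> R \<Longrightarrow> R + 1 \<le> 2 ^ n \<Longrightarrow> cmod z \<le> R \<Longrightarrow>
      cmod (f z) \<le> 9 * G ^ 2 * (d + 1) * (R + 1) ^ 2"
proof -
  have G: "1 \<le> G"
    unfolding G_def using mult_mono[OF C1_ge_1 one_le_power[OF C2_ge_1, of n]] C1_ge_1 by simp
  have d: "1 \<le> d"
    using f abs_Re_le_cmod[of "f 1"] by simp
  have w01: "work f 0 1 = 1"
    using f by (simp add: work_def inner_complex_def)
  show "1 / G * cmod z \<le> f z \<bullet> z" if "1 \<le> 2 ^ n * cmod z" for z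
    using work_comparison_pow[of 1 0 n z] that w01 f G by (simp add: work_def G_def field_simps)
  fix z and R :: real assume R: "1 \<le> R" "R + 1 \<le> 2 ^ n" and z: "cmod z \<le> R"
  have w0: "work f 0 z \<le> G * cmod z" if "cmod z \<le> 2 ^ n" for z
    using work_comparison_pow[of z 0 n 1] that w01 by (simp add: G_def)
  have Re: "\<bar>Re (f z)\<bar> \<le> (2 * G + d) * (R + 1)" if z: "cmod z \<le> R" for z
  proof -
    have z1: "cmod (z - 1) \<le> R + 1"
      using norm_triangle_ineq4[of z 1] z by simp
    have "work f 1 0 = 1"
      using w01 by (simp add: work_commute)
    then have "work f 1 z \<le> G * cmod (z - 1)"
      using work_comparison_pow[of z 1 n 0] z1 R by (simp add: G_def)
    also have "\<dots> \<le> G * (R + 1)"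
      using G z1 by (intro mult_left_mono) auto
    finally have 1: "work f 1 z \<le> G * (R + 1)" .
    have "G * cmod z \<le> G * (R + 1)"
      using G z by (intro mult_left_mono) auto
    then have 2: "work f 0 z \<le> G * (R + 1)"
      using w0[of z] z R by simp
    have "\<bar>f 1 \<bullet> (z - 1)\<bar> \<le> cmod (f 1) * cmod (z - 1)"
      by (rule Cauchy_Schwarz_ineq2)
    also have "\<dots> \<le> d * (R + 1)"
      using f z1 d by (intro mult_mono) auto
    finally have 3: "\<bar>f 1 \<bullet> (z - 1)\<bar> \<le> d * (R + 1)" .
    have "Re (f z) = work f 0 z - work f 1 z - f 1 \<bullet> (z - 1)"
      using f by (simp add: work_def inner_complex_def algebra_simps)
    then show ?thesis
      using 1 2 3 work_nonneg[of 0 z] work_nonneg[of 1 z] R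
      by (simp add: abs_le_iff algebra_simps)
  qed
  have wi: "work f 0 \<i> \<le> G"
    using w0[of \<i>] R by simp
  have "Im (f \<i>) = work f 0 \<i>"
    using f by (simp add: work_def inner_complex_def)
  then have fi: "cmod (f \<i>) \<le> (2 * G + d) * (R + 1) + G"
    using cmod_le[of "f \<i>"] Re[of \<i>] wi work_nonneg[of 0 \<i>] R by simp
  have zi: "cmod (z - \<i>) \<le> R + 1"
    using norm_triangle_ineq4[of z \<i>] z by simp
  have "work f \<i> z \<le> G * cmod (z - \<i>) * work f \<i> 0"
    using work_comparison_pow[of z \<i> n 0] zi R by (simp add: G_def)
  also have "\<dots> \<le> G * (R + 1) * G"
    using G zi wi work_commute[of f 0 \<i>] work_nonneg[of \<i> 0] R
    by (intro mult_mono mult_nonneg_nonneg) auto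
  finally have 1: "work f \<i> z \<le> G * (R + 1) * G" .
  have "G * cmod z \<le> G * (R + 1)"
    using G z by (intro mult_left_mono) auto
  then have 2: "work f 0 z \<le> G * (R + 1)"
    using w0[of z] z R by simp
  have "\<bar>f \<i> \<bullet> (z - \<i>)\<bar> \<le> cmod (f \<i>) * cmod (z - \<i>)"
    by (rule Cauchy_Schwarz_ineq2)
  also have "\<dots> \<le> ((2 * G + d) * (R + 1) + G) * (R + 1)"
    using fi zi G d R by (intro mult_mono) auto
  finally have 3: "\<bar>f \<i> \<bullet> (z - \<i>)\<bar> \<le> ((2 * G + d) * (R + 1) + G) * (R + 1)" .
  have "Im (f z) = work f 0 z - work f \<i> z - f \<i> \<bullet> (z - \<i>)"
    using f by (simp add: work_def inner_complex_def algebra_simps)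
  then have Im: "\<bar>Im (f z)\<bar> \<le> G * (R + 1) * G + G * (R + 1) + ((2 * G + d) * (R + 1) + G) * (R + 1)"
    using 1 2 3 work_nonneg[of 0 z] work_nonneg[of \<i> z] by (simp add: abs_le_iff)
  define S where "S = R + 1"
  have S: "1 \<le> S" using R by (simp add: S_def)
  define P where "P = G ^ 2 * (d + 1) * S ^ 2"
  have mono: "G ^ i * e * S ^ j \<le> P" if "i \<le> 2" "j \<le> 2" "0 \<le> e" "e \<le> d + 1" for i j e
    unfolding P_def using that G S by (intro mult_mono power_increasing) auto
  have "cmod (f z) \<le> (2 * G + d) * S + G * S * G + G * S + ((2 * G + d) * S + G) * S"
    using cmod_le[of "f z"] Re[OF z] Im by (simp add: S_def)
  \<comment> \<open>Nine monomials counted with multiplicity, each at most \<open>P\<close>.\<close>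
  also have "\<dots> = 2 * (G ^ 1 * 1 * S ^ 1) + G ^ 0 * d * S ^ 1 + G ^ 2 * 1 * S ^ 1 + G ^ 1 * 1 * S ^ 1
      + 2 * (G ^ 1 * 1 * S ^ 2) + G ^ 0 * d * S ^ 2 + G ^ 1 * 1 * S ^ 1"
    by (simp add: algebra_simps power2_eq_square)
  also have "\<dots> \<le> 9 * P"
    using mono[of 1 1 1] mono[of 0 1 d] mono[of 2 1 1] mono[of 1 2 1] mono[of 0 2 d] d by auto
  finally show "cmod (f z) \<le> 9 * G ^ 2 * (d + 1) * (R + 1) ^ 2"
    unfolding P_def S_def by simp
qed

lemma uniform_curve_bounds:
  fixes C d r R :: real
  assumes C: "1 \<le> C" and r: "0 < r" "r < R"
  shows "\<exists>A B. 0 \<le> A \<and> 1 \<le> B \<and> (\<forall>f a b x y. doubling_field C f \<and> f 0 = 0 \<and> Re (f 1) = 1 \<and> cmod (f 1) \<le> d \<and>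
    a \<le> b \<and> solves f a b x \<and> solves f a b y \<and> {x a, x b, y a, y b} \<subseteq> closed_annulus r R \<longrightarrow>
    cmod (x b - x a) \<le> A * (b - a) \<and> cmod (x b - y b) \<le> B * cmod (x a - y a))"
proof -
  \<comment> \<open>One exponent \<open>n\<close> has to serve both parts of
    \<open>normalized_bounds\<close>: \<open>S + 1 \<le> 2 ^ n\<close> for the upper bound on the
    disc of radius \<open>S = R + 2\<close>, and \<open>1 \<le> 2 ^ n * r\<close> for the lower
    one.\<close>
  obtain n1 where n1: "R + 3 < 2 ^ n1" using real_arch_pow[of 2] by auto
  obtain n2 where n2: "1 / r < 2 ^ n2" using real_arch_pow[of 2] by auto
  define n where "n = n1 + n2"
  have "2 ^ n1 \<le> (2::real) ^ n" "2 ^ n2 \<le> (2::real) ^ n"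
    unfolding n_def by (rule power_increasing; simp)+
  then have n: "R + 3 \<le> 2 ^ n" "1 \<le> 2 ^ n * r"
    using n1 n2 r mult_right_mono[of "2 ^ n2" "2 ^ n" r] unfolding pos_divide_less_eq[OF r(1)] by linarith+
  define G where "G = doubling_field.C1 C * doubling_field.C2 C ^ n"
  define S where "S = R + 2"
  define M where "M = 9 * G ^ 2 * (\<bar>d\<bar> + 1) * (S + 1) ^ 2"
  define c where "c = 1 / G"
  define A where "A = 16 * doubling_field.C1 C * (2 * M)"
  define \<theta> where "\<theta> = doubling_field.theta C"
  obtain q where q: "4 * M * R / c < 2 ^ q" using real_arch_pow[of 2] by auto
  obtain N :: nat where N: "(M + 2 * A / (1 - \<theta>)) / (c / (2 * doubling_field.C1 C)) < real N"
    using reals_Archimedean2 by auto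
  define B where "B = max 1 ((1 + 2 * M / c) * 2 ^ (N + q))"
  have M0: "0 \<le> M"
    by (simp add: M_def)
  show ?thesis
  proof (rule exI[of _ M], rule exI[of _ B], intro conjI allI impI)
    show "0 \<le> M" by fact
    show "1 \<le> B" by (simp add: B_def)
    fix f and a b :: real and x y
    assume *: "doubling_field C f \<and> f 0 = 0 \<and> Re (f 1) = 1 \<and> cmod (f 1) \<le> d \<and>
      a \<le> b \<and> solves f a b x \<and> solves f a b y \<and> {x a, x b, y a, y b} \<subseteq> closed_annulus r R"
    then interpret doubling_field C f by simp
    have ab: "a \<le> b" and x: "solves f a b x" and y: "solves f a b y"
      and f: "f 0 = 0" "Re (f 1) = 1" "cmod (f 1) \<le> \<bar>d\<bar>"
      using * by auto
    have G: "1 \<le> G"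
      unfolding G_def using mult_mono[OF C1_ge_1 one_le_power[OF C2_ge_1, of n]] C1_ge_1 by simp
    then have c0: "0 < c" by (simp add: c_def)
    have Mpos: "0 < M" using G r by (simp add: M_def S_def)
    have c: "c * cmod z \<le> f z \<bullet> z" if "r \<le> cmod z" for z
    proof -
      have "2 ^ n * r \<le> 2 ^ n * cmod z" using that by (intro mult_left_mono) auto
      then show ?thesis
        using lower_bound[OF f, of n z] n(2) unfolding c_def G_def by linarith
    qed
    have M: "cmod (f z) \<le> M" if "cmod z \<le> S" for z
      using upper_bound[OF f, where n = n, of S z] that n r unfolding M_def G_def S_def by auto
    have A: "cmod (f (p + e) - f p) \<le> A * theta ^ j" if "cmod p \<le> R" "2 ^ j * cmod e \<le> 1" for p e j
      unfolding A_def
    proof (rule geometric_modulus[OF _ that(2)])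
      fix e :: complex assume "cmod e \<le> 1"
      then have "cmod (p + e) \<le> S" "cmod p \<le> S"
        using that norm_triangle_ineq[of p e] by (auto simp: S_def)
      then show "cmod (f (p + e) - f p) \<le> 2 * M"
        using M[of "p + e"] M[of p] norm_triangle_ineq4[of "f (p + e)" "f p"] by linarith
    qed
    \<comment> \<open>The distance to the stationary solution \<open>0\<close> never decreases, so a
      curve with both ends in the annulus stays there in between.\<close>
    have range: "r \<le> cmod (z t) \<and> cmod (z t) \<le> R"
      if z: "solves f a b z" "z a \<in> closed_annulus r R" "z b \<in> closed_annulus r R" and t: "t \<in> {a..b}" for z t
      using distance_mono[OF solves_zero[of f, OF f(1)] z(1), of a t] distance_mono[OF solves_zero[of f, OF f(1)] z(1), of t b]
        z t by (simp add: closed_annulus_def)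
    have xr: "r \<le> cmod (x t)" "cmod (x t) \<le> R" and yr: "cmod (y t) \<le> R" if "t \<in> {a..b}" for t
      using range[OF x, of t] range[OF y, of t] that * by auto
    have "cmod (x b - x a) \<le> M * \<bar>b - a\<bar>"
      using xr(2) ab by (intro solves_lipschitz[OF x]) (force simp: S_def intro: M)+
    then show "cmod (x b - x a) \<le> M * (b - a)"
      using ab by simp
    have "0 \<le> A" using M0 C1_ge_1 by (simp add: A_def)
    moreover have "M + 2 * A / (1 - theta) < real N * (c / (2 * C1))"
      using N C1_ge_1 c0 by (simp add: \<theta>_def pos_divide_less_eq pos_less_divide_eq)
    ultimately have "cmod (y b - x b) \<le> (1 + 2 * M / c) * 2 ^ (N + q) * cmod (y a - x a)"
      using ab x y f r xr yr c0 c Mpos A q M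
      by (intro expansion_bound[where r = r and R = R and A = A]) (auto simp: S_def)
    also have "\<dots> \<le> B * cmod (y a - x a)"
      by (intro mult_right_mono) (auto simp: B_def)
    finally show "cmod (x b - y b) \<le> B * cmod (x a - y a)"
      by (simp add: norm_minus_commute)
  qed
qed

section \<open>Integral curves on arbitrary intervals\<close>

lemma integral_curve_solves:
  assumes "integral_curve f I x" "a \<in> I" "b \<in> I"
  shows "solves f a b x"
proof -
  have "{a..b} \<subseteq> I"
    using assms unfolding integral_curve_def is_interval_1 by (meson atLeastAtMost_iff subsetI)
  then show ?thesis
    using assms unfolding solves_def integral_curve_def
    by (meson has_vector_derivative_within_subset subsetD)
qed

lemma integral_curve_dependence:
  fixes C d r R :: real
  assumes C: "1 \<le> C" and r: "0 < r" "r < R"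
    and F: "\<And>f. f \<in> F \<Longrightarrow> doubling_field C f \<and> f 0 = 0 \<and> Re (f 1) = 1 \<and> cmod (f 1) \<le> d"
  shows "\<exists>A B :: real. \<forall>f\<in>F.
    \<forall>(I :: real set) (J :: real set) (x :: real \<Rightarrow> complex) (y :: real \<Rightarrow> complex) (t0 :: real) x0 y0.
      integral_curve f I x \<and> t0 \<in> I \<and> x t0 = x0 \<and> x0 \<in> closed_annulus r R \<and>
      integral_curve f J y \<and> t0 \<in> J \<and> y t0 = y0 \<and> y0 \<in> closed_annulus r R \<longrightarrow>
      (\<forall>t\<in>I. \<forall>s\<in>J. x t \<in> closed_annulus r R \<longrightarrow> y s \<in> closed_annulus r R \<longrightarrow>
         cmod (x t - y s) \<le> A * \<bar>t - s\<bar> + B * cmod (x0 - y0)) \<and>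
      (\<forall>t\<in>I \<inter> J. \<forall>s\<in>I \<inter> J.
         {x t, y t, x s, y s} \<subseteq> closed_annulus r R \<longrightarrow>
         cmod (x t - y t) \<le> B * cmod (x s - y s))"
proof -
  obtain A B where A0: "0 \<le> A" and B1: "1 \<le> B" and AB: "\<And>f a b x y. \<lbrakk>doubling_field C f; f 0 = 0;
      Re (f 1) = 1; cmod (f 1) \<le> d; a \<le> b; solves f a b x; solves f a b y;
      {x a, x b, y a, y b} \<subseteq> closed_annulus r R\<rbrakk> \<Longrightarrow>
      cmod (x b - x a) \<le> A * (b - a) \<and> cmod (x b - y b) \<le> B * cmod (x a - y a)"
    using uniform_curve_bounds[OF C r, of d] by metis
  show ?thesis
  proof (rule exI[of _ A], rule exI[of _ B], intro ballI allI impI conjI)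
    fix f I J x y t0 x0 y0
    assume fF: "f \<in> F" and h: "integral_curve f I x \<and> t0 \<in> I \<and> x t0 = x0 \<and> x0 \<in> closed_annulus r R \<and>
      integral_curve f J y \<and> t0 \<in> J \<and> y t0 = y0 \<and> y0 \<in> closed_annulus r R"
    interpret doubling_field C f using F[OF fF] by simp
    have ineq: "a \<le> b \<Longrightarrow> solves f a b v \<Longrightarrow> solves f a b w \<Longrightarrow> {v a, v b, w a, w b} \<subseteq> closed_annulus r R \<Longrightarrow>
      cmod (v b - v a) \<le> A * (b - a) \<and> cmod (v b - w b) \<le> B * cmod (v a - w a)" for a b v w
      using AB[of f] F[OF fF] by blast
    have f0: "f 0 = 0" using F[OF fF] by simp
    have sx: "solves f a b x" if "a \<in> I" "b \<in> I" for a b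
      using integral_curve_solves h that by blast
    have sy: "solves f a b y" if "a \<in> J" "b \<in> J" for a b
      using integral_curve_solves h that by blast
    have IJ: "t \<in> I" if "t1 \<in> I" "t2 \<in> I" "t1 \<le> t" "t \<le> t2" for t t1 t2
      using that h unfolding integral_curve_def is_interval_1 by blast
    have JJ: "t \<in> J" if "t1 \<in> J" "t2 \<in> J" "t1 \<le> t" "t \<le> t2" for t t1 t2
      using that h unfolding integral_curve_def is_interval_1 by blast
    have ann: "z t \<in> closed_annulus r R"
      if z: "solves f a b z" "z a \<in> closed_annulus r R" "z b \<in> closed_annulus r R" "a \<le> t" "t \<le> b" for z t a b
      using distance_mono[OF solves_zero[of f, OF f0] z(1), of a t] distance_mono[OF solves_zero[of f, OF f0] z(1), of t b]
        z by (simp add: closed_annulus_def)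
    have lip: "cmod (z t - z s) \<le> A * \<bar>t - s\<bar>"
      if "solves f (min s t) (max s t) z" "z s \<in> closed_annulus r R" "z t \<in> closed_annulus r R" for z s t
      using ineq[of "min s t" "max s t" z z] that
      by (cases "s \<le> t") (auto simp: norm_minus_commute)
    have sync: "cmod (x t - y t) \<le> B * cmod (x s - y s)"
      if "t \<in> I \<inter> J" "s \<in> I \<inter> J" "{x t, y t, x s, y s} \<subseteq> closed_annulus r R" for t s
    proof (cases "s \<le> t")
      case True
      then show ?thesis
        using ineq[of s t x y] sx[of s t] sy[of s t] that by auto
    next
      case False
      \<comment> \<open>Backward in time the distance does not increase, and
        \<open>1 \<le> B\<close>.\<close>
      then have "cmod (y t - x t) \<le> cmod (y s - x s)"
        using distance_mono[OF sx[of t s] sy[of t s], of t s] that by auto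
      also have "\<dots> \<le> B * cmod (y s - x s)"
        using B1 by (simp add: mult_le_cancel_right1)
      finally show ?thesis
        by (simp add: norm_minus_commute)
    qed
    show "cmod (x t - y t) \<le> B * cmod (x s - y s)"
      if "t \<in> I \<inter> J" "s \<in> I \<inter> J" "{x t, y t, x s, y s} \<subseteq> closed_annulus r R" for t s
      using that by (rule sync)
    fix t s assume t: "t \<in> I" "x t \<in> closed_annulus r R" and s: "s \<in> J" "y s \<in> closed_annulus r R"
    have tI: "min t t0 \<in> I" "max t t0 \<in> I" "min t0 t \<in> I" "max t0 t \<in> I" and sJ: "min s t0 \<in> J" "max s t0 \<in> J" "min t0 s \<in> J" "max t0 s \<in> J"
      using t s h by (auto simp: min_def max_def)
    \<comment> \<open>The time at which to change from \<open>x\<close> to \<open>y\<close>. It lies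
      between \<open>t0\<close> and \<open>t\<close> and between \<open>t0\<close> and
      \<open>s\<close>, where both curves are defined, and also between \<open>t\<close> and
      \<open>s\<close>, so that the two Lipschitz terms add up to
      \<open>A * \<bar>t - s\<bar>\<close>.\<close>
    define m where "m = (if t0 \<le> t \<and> t0 \<le> s then min t s else if t \<le> t0 \<and> s \<le> t0 then max t s else t0)"
    have mt: "min t0 t \<le> m" "m \<le> max t0 t" and ms: "min t0 s \<le> m" "m \<le> max t0 s"
      and sum: "\<bar>t - m\<bar> + \<bar>m - s\<bar> = \<bar>t - s\<bar>"
      by (auto simp: m_def)
    have mI: "m \<in> I" "m \<in> J"
      using IJ[OF tI(3,4) mt] JJ[OF sJ(3,4) ms] by auto
    have xm: "x m \<in> closed_annulus r R"
      using ann[OF sx[OF tI(3,4)] _ _ mt] t h by (auto simp: min_def max_def split: if_splits)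
    have ym: "y m \<in> closed_annulus r R"
      using ann[OF sy[OF sJ(3,4)] _ _ ms] s h by (auto simp: min_def max_def split: if_splits)
    have "cmod (x t - y s) \<le> cmod (x t - x m) + cmod (x m - y m) + cmod (y m - y s)"
      using norm_triangle_ineq[of "x t - x m" "x m - y s"] norm_triangle_ineq[of "x m - y m" "y m - y s"]
      by (simp add: algebra_simps)
    moreover have "cmod (x t - x m) \<le> A * \<bar>t - m\<bar>"
      using t xm mI by (intro lip sx) (auto simp: min_def max_def)
    moreover have "cmod (y m - y s) \<le> A * \<bar>m - s\<bar>"
      using s ym mI by (intro lip sy) (auto simp: min_def max_def)
    moreover have "cmod (x m - y m) \<le> B * cmod (x t0 - y t0)"
      using mI h xm ym by (intro sync) auto
    ultimately show "cmod (x t - y s) \<le> A * \<bar>t - s\<bar> + B * cmod (x0 - y0)"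
      using h sum[symmetric] by (simp add: distrib_left)
  qed
qed

section \<open>Smooth reduced fields\<close>

lemma has_real_derivative_max_0_power:
  fixes s :: real
  shows "((\<lambda>s. max 0 s ^ (k + 2)) has_real_derivative real (k + 2) * max 0 s ^ (k + 1)) (at s)"
proof -
  consider "0 < s" | "s < 0" | "s = 0" by linarith
  then show ?thesis
  proof cases
    case 1
    have "((\<lambda>s. s ^ (k + 2)) has_real_derivative real (k + 2) * s ^ (k + 1)) (at s)"
      using DERIV_pow[of "k + 2" s UNIV] by simp
    then have "((\<lambda>s. max 0 s ^ (k + 2)) has_real_derivative real (k + 2) * s ^ (k + 1)) (at s)"
      by (rule has_field_derivative_transform_within_open[where S = "{0<..}"]) (use 1 in auto)
    with 1 show ?thesis by simp
  next
    case 2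
    have "((\<lambda>s. 0) has_real_derivative 0) (at s)" by simp
    then have "((\<lambda>s. max 0 s ^ (k + 2)) has_real_derivative 0) (at s)"
      by (rule has_field_derivative_transform_within_open[where S = "{..<0}"]) (use 2 in auto)
    with 2 show ?thesis by simp
  next
    case 3
    have "((\<lambda>h::real. max 0 h ^ (k + 1)) \<longlongrightarrow> max 0 0 ^ (k + 1)) (at 0)"
      by (intro tendsto_intros)
    then have lim: "((\<lambda>h::real. max 0 h ^ (k + 1)) \<longlongrightarrow> 0) (at 0)" by simp
    have "((\<lambda>h::real. max 0 h ^ (k + 2) / h) \<longlongrightarrow> 0) (at 0)"
      by (rule Lim_null_comparison[OF _ lim]) (auto simp: max_def intro!: always_eventually)
    with 3 show ?thesis
      by (simp add: DERIV_def)
  qed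
qed

lemma has_real_derivative_max_0_power_compose [derivative_intros]:
  assumes "(g has_real_derivative g') (at x within S)"
  shows "((\<lambda>x. max 0 (g x) ^ (k + 2)) has_real_derivative real (k + 2) * max 0 (g x) ^ (k + 1) * g') (at x within S)"
  using DERIV_chain2[OF has_real_derivative_max_0_power assms] .

lemma integral_by_parts_real:
  fixes p p' g g' :: "real \<Rightarrow> real"
  assumes "a \<le> b"
    and p: "\<And>x. x \<in> {a..b} \<Longrightarrow> (p has_real_derivative p' x) (at x)"
    and g: "\<And>x. x \<in> {a..b} \<Longrightarrow> (g has_real_derivative g' x) (at x)"
    and "continuous_on {a..b} p'" "continuous_on {a..b} g'"
  shows "integral {a..b} (\<lambda>x. p x * g' x) = p b * g b - p a * g a - integral {a..b} (\<lambda>x. p' x * g x)"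
proof -
  have cont: "continuous_on {a..b} p" "continuous_on {a..b} g"
    using p g DERIV_isCont by (blast intro: continuous_at_imp_continuous_on)+
  have hi: "((\<lambda>x. p x * g' x + p' x * g x) has_integral (p b * g b - p a * g a)) {a..b}"
  proof (rule fundamental_theorem_of_calculus[OF assms(1)])
    fix x assume x: "x \<in> {a..b}"
    from DERIV_mult[OF p[OF x] g[OF x]]
    have "((\<lambda>x. p x * g x) has_real_derivative (p x * g' x + p' x * g x)) (at x within {a..b})"
      by (simp add: has_field_derivative_at_within algebra_simps)
    then show "((\<lambda>x. p x * g x) has_vector_derivative (p x * g' x + p' x * g x)) (at x within {a..b})"
      by (simp add: has_real_derivative_iff_has_vector_derivative)
  qed
  moreover have "(\<lambda>x. p x * g' x) integrable_on {a..b}" "(\<lambda>x. p' x * g x) integrable_on {a..b}"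
    using assms cont by (auto intro!: integrable_continuous_interval continuous_intros)
  ultimately show ?thesis
    using integral_add[of "\<lambda>x. p x * g' x" "{a..b}" "\<lambda>x. p' x * g x"] integral_unique[OF hi]
    by linarith
qed

definition cont2 :: "(real \<Rightarrow> real \<Rightarrow> real) \<Rightarrow> bool" where
  "cont2 F \<longleftrightarrow> continuous_on UNIV (\<lambda>p. F (fst p) (snd p))"

text \<open>Only the upper half of a square: its lower edge is the crease, and the lower half is
  reached by reflecting the field.\<close>

definition rect :: "real \<Rightarrow> (real \<Rightarrow> real \<Rightarrow> real) \<Rightarrow> real" where
  "rect L F = integral (cbox (- L, 0) (L, L)) (\<lambda>p. F (fst p) (snd p))"

lemma cont2_integrable: "cont2 F \<Longrightarrow> (\<lambda>p. F (fst p) (snd p)) integrable_on cbox a b"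
  unfolding cont2_def by (intro integrable_continuous) (rule continuous_on_subset, auto)

lemma cont2_slice:
  assumes "cont2 F"
  shows "continuous_on S (\<lambda>x. F x y)" "continuous_on S (\<lambda>y. F x y)"
proof -
  have "continuous_on S (\<lambda>x. (\<lambda>p. F (fst p) (snd p)) (x, y))"
    by (rule continuous_on_compose2[OF assms[unfolded cont2_def]]) (auto intro!: continuous_intros)
  then show "continuous_on S (\<lambda>x. F x y)" by simp
  have "continuous_on S (\<lambda>y. (\<lambda>p. F (fst p) (snd p)) (x, y))"
    by (rule continuous_on_compose2[OF assms[unfolded cont2_def]]) (auto intro!: continuous_intros)
  then show "continuous_on S (\<lambda>y. F x y)" by simp
qed

lemma cont2_compose:
  assumes "cont2 F" "continuous_on S g" "continuous_on S h"
  shows "continuous_on S (\<lambda>p. F (g p) (h p))"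
  using continuous_on_compose2[OF assms(1)[unfolded cont2_def], of S "\<lambda>p. (g p, h p)"] assms
  by (auto intro!: continuous_intros)

lemma cont2_add: "cont2 F \<Longrightarrow> cont2 G \<Longrightarrow> cont2 (\<lambda>x y. F x y + G x y)"
  and cont2_diff: "cont2 F \<Longrightarrow> cont2 G \<Longrightarrow> cont2 (\<lambda>x y. F x y - G x y)"
  and cont2_mult: "cont2 F \<Longrightarrow> cont2 G \<Longrightarrow> cont2 (\<lambda>x y. F x y * G x y)"
  and cont2_power: "cont2 F \<Longrightarrow> cont2 (\<lambda>x y. F x y ^ n)"
  and cont2_max: "cont2 F \<Longrightarrow> cont2 (\<lambda>x y. max 0 (F x y))"
  and cont2_const: "cont2 (\<lambda>x y. c)"
  and cont2_fst: "cont2 (\<lambda>x y. x)"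
  and cont2_snd: "cont2 (\<lambda>x y. y)"
  unfolding cont2_def by (auto intro!: continuous_intros)

lemmas cont2_intros = cont2_add cont2_diff cont2_mult cont2_power cont2_max cont2_const cont2_fst cont2_snd

lemma rect_add: "cont2 F \<Longrightarrow> cont2 G \<Longrightarrow> rect L (\<lambda>x y. F x y + G x y) = rect L F + rect L G"
  unfolding rect_def by (intro integral_add cont2_integrable)

lemma rect_diff: "cont2 F \<Longrightarrow> cont2 G \<Longrightarrow> rect L (\<lambda>x y. F x y - G x y) = rect L F - rect L G"
  unfolding rect_def by (intro integral_diff cont2_integrable)

lemma rect_cmult: "rect L (\<lambda>x y. c * F x y) = c * rect L F"
  unfolding rect_def by simp

lemma rect_mono:
  assumes "cont2 F" "cont2 G" "\<And>x y. x \<in> {- L..L} \<Longrightarrow> y \<in> {0..L} \<Longrightarrow> F x y \<le> G x y"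
  shows "rect L F \<le> rect L G"
  unfolding rect_def using assms by (intro integral_le cont2_integrable) auto

lemma rect_mono_subset:
  assumes "cont2 F" "cont2 G" "L \<le> L'" "\<And>x y. x \<in> {- L..L} \<Longrightarrow> y \<in> {0..L} \<Longrightarrow> F x y \<le> G x y"
    "\<And>x y. x \<in> {- L'..L'} \<Longrightarrow> y \<in> {0..L'} \<Longrightarrow> 0 \<le> G x y"
  shows "rect L F \<le> rect L' G"
proof -
  have "rect L F \<le> rect L G" by (rule rect_mono) fact+
  also have "\<dots> \<le> rect L' G"
    unfolding rect_def using assms by (intro integral_subset_le cont2_integrable) auto
  finally show ?thesis .
qed

lemma rect_iterated:
  assumes "cont2 F"
  shows "rect L F = integral {- L..L} (\<lambda>x. integral {0..L} (\<lambda>y. F x y))"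
    and "rect L F = integral {0..L} (\<lambda>y. integral {- L..L} (\<lambda>x. F x y))"
proof -
  have c: "continuous_on (cbox (- L, 0) (L, L)) (\<lambda>p. F (fst p) (snd p))"
    using assms continuous_on_subset unfolding cont2_def by blast
  show 1: "rect L F = integral {- L..L} (\<lambda>x. integral {0..L} (\<lambda>y. F x y))"
    using integral_prod_continuous[OF c] by (simp add: rect_def)
  show "rect L F = integral {0..L} (\<lambda>y. integral {- L..L} (\<lambda>x. F x y))"
    using integral_swap_continuous[of "- L" 0 L L F] c 1 by (simp add: case_prod_beta')
qed

lemma rect_by_parts_x:
  assumes "0 \<le> L" and c: "cont2 p" "cont2 p'" "cont2 g" "cont2 g'"
    and p: "\<And>x y. ((\<lambda>x. p x y) has_real_derivative p' x y) (at x)"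
    and g: "\<And>x y. ((\<lambda>x. g x y) has_real_derivative g' x y) (at x)"
    and z: "\<And>y. y \<in> {0..L} \<Longrightarrow> p L y = 0 \<and> p (- L) y = 0"
  shows "rect L (\<lambda>x y. p x y * g' x y) = - rect L (\<lambda>x y. p' x y * g x y)"
proof -
  have "rect L (\<lambda>x y. p x y * g' x y) = integral {0..L} (\<lambda>y. integral {- L..L} (\<lambda>x. p x y * g' x y))"
    using c by (intro rect_iterated cont2_mult)
  also have "\<dots> = integral {0..L} (\<lambda>y. - integral {- L..L} (\<lambda>x. p' x y * g x y))"
  proof (rule integral_cong)
    fix y assume "y \<in> {0..L}"
    then show "integral {- L..L} (\<lambda>x. p x y * g' x y) = - integral {- L..L} (\<lambda>x. p' x y * g x y)"
      using integral_by_parts_real[of "- L" L "\<lambda>x. p x y" "\<lambda>x. p' x y" "\<lambda>x. g x y" "\<lambda>x. g' x y"]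
        assms cont2_slice by simp
  qed
  also have "\<dots> = - rect L (\<lambda>x y. p' x y * g x y)"
    using c by (simp add: rect_iterated(2)[OF cont2_mult])
  finally show ?thesis .
qed

lemma rect_by_parts_y:
  assumes "0 \<le> L" and c: "cont2 p" "cont2 p'" "cont2 g" "cont2 g'"
    and p: "\<And>x y. ((\<lambda>y. p x y) has_real_derivative p' x y) (at y)"
    and g: "\<And>x y. ((\<lambda>y. g x y) has_real_derivative g' x y) (at y)"
    and z: "\<And>x. x \<in> {-L..L} \<Longrightarrow> p x L = 0"
  shows "rect L (\<lambda>x y. p x y * g' x y) = - integral {-L..L} (\<lambda>x. p x 0 * g x 0) - rect L (\<lambda>x y. p' x y * g x y)"
proof -
  have "rect L (\<lambda>x y. p x y * g' x y) = integral {-L..L} (\<lambda>x. integral {0..L} (\<lambda>y. p x y * g' x y))"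
    using c by (intro rect_iterated cont2_mult)
  also have "\<dots> = integral {-L..L} (\<lambda>x. - (p x 0 * g x 0) - integral {0..L} (\<lambda>y. p' x y * g x y))"
  proof (rule integral_cong)
    fix x assume "x \<in> {-L..L}"
    then show "integral {0..L} (\<lambda>y. p x y * g' x y) = - (p x 0 * g x 0) - integral {0..L} (\<lambda>y. p' x y * g x y)"
      using integral_by_parts_real[of 0 L "\<lambda>y. p x y" "\<lambda>y. p' x y" "\<lambda>y. g x y" "\<lambda>y. g' x y"]
        assms cont2_slice by simp
  qed
  also have "\<dots> = - integral {-L..L} (\<lambda>x. p x 0 * g x 0) - integral {-L..L} (\<lambda>x. integral {0..L} (\<lambda>y. p' x y * g x y))"
  proof (subst integral_diff)
    show "(\<lambda>x. - (p x 0 * g x 0)) integrable_on {-L..L}"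
      using c cont2_slice by (intro integrable_continuous_interval continuous_intros) auto
    have "continuous_on ({-L..L} \<times> cbox 0 L) (\<lambda>(x, y). p' x y * g x y)"
      using cont2_mult[OF c(2,3)] unfolding cont2_def case_prod_beta' by (rule continuous_on_subset) auto
    from integral_continuous_on_param[OF this]
    show "(\<lambda>x. integral {0..L} (\<lambda>y. p' x y * g x y)) integrable_on {-L..L}"
      by (intro integrable_continuous_interval) simp
  qed simp_all
  also have "\<dots> = - integral {-L..L} (\<lambda>x. p x 0 * g x 0) - rect L (\<lambda>x y. p' x y * g x y)"
    using c by (simp add: rect_iterated(1)[OF cont2_mult])
  finally show ?thesis .
qed

text \<open>If \<open>p\<close>, \<open>q\<close>, \<open>s\<close> are the second derivatives \<open>\<Phi>\<^sub>y\<^sub>y\<close>, \<open>\<Phi>\<^sub>x\<^sub>y\<close>, \<open>\<Phi>\<^sub>x\<^sub>x\<close> of a function \<open>\<Phi>\<close>, then the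
  tensor with entries \<open>p\<close>, \<open>- q\<close>, \<open>s\<close> has zero divergence.\<close>

lemma rect_airy:
  assumes "0 \<le> L" and c: "cont2 p" "cont2 q" "cont2 s" "cont2 t1" "cont2 t2"
      "cont2 u" "cont2 ux" "cont2 uy" "cont2 v" "cont2 vx" "cont2 vy"
    and p: "\<And>x y. ((\<lambda>x. p x y) has_real_derivative t1 x y) (at x)"
    and q1: "\<And>x y. ((\<lambda>y. q x y) has_real_derivative t1 x y) (at y)"
    and q2: "\<And>x y. ((\<lambda>x. q x y) has_real_derivative t2 x y) (at x)"
    and s: "\<And>x y. ((\<lambda>y. s x y) has_real_derivative t2 x y) (at y)"
    and u: "\<And>x y. ((\<lambda>x. u x y) has_real_derivative ux x y) (at x)"
      "\<And>x y. ((\<lambda>y. u x y) has_real_derivative uy x y) (at y)"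
    and v: "\<And>x y. ((\<lambda>x. v x y) has_real_derivative vx x y) (at x)"
      "\<And>x y. ((\<lambda>y. v x y) has_real_derivative vy x y) (at y)"
    and zx: "\<And>y. y \<in> {0..L} \<Longrightarrow> p L y = 0 \<and> p (- L) y = 0 \<and> q L y = 0 \<and> q (- L) y = 0"
    and zy: "\<And>x. x \<in> {-L..L} \<Longrightarrow> q x L = 0 \<and> s x L = 0"
  shows "rect L (\<lambda>x y. p x y * ux x y + s x y * vy x y - q x y * (uy x y + vx x y)) =
    integral {-L..L} (\<lambda>x. q x 0 * u x 0) - integral {-L..L} (\<lambda>x. s x 0 * v x 0)"
proof -
  have "rect L (\<lambda>x y. p x y * ux x y + s x y * vy x y - q x y * (uy x y + vx x y)) =
      rect L (\<lambda>x y. p x y * ux x y) + rect L (\<lambda>x y. s x y * vy x y) -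
      (rect L (\<lambda>x y. q x y * uy x y) + rect L (\<lambda>x y. q x y * vx x y))"
    using c by (simp add: rect_add rect_diff cont2_intros distrib_left)
  moreover have "rect L (\<lambda>x y. p x y * ux x y) = - rect L (\<lambda>x y. t1 x y * u x y)"
    using assms by (intro rect_by_parts_x) auto
  moreover have "rect L (\<lambda>x y. q x y * vx x y) = - rect L (\<lambda>x y. t2 x y * v x y)"
    using assms by (intro rect_by_parts_x) auto
  moreover have "rect L (\<lambda>x y. q x y * uy x y) = - integral {-L..L} (\<lambda>x. q x 0 * u x 0) - rect L (\<lambda>x y. t1 x y * u x y)"
    using assms by (intro rect_by_parts_y) auto
  moreover have "rect L (\<lambda>x y. s x y * vy x y) = - integral {-L..L} (\<lambda>x. s x 0 * v x 0) - rect L (\<lambda>x y. t2 x y * v x y)"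
    using assms by (intro rect_by_parts_y) auto
  ultimately show ?thesis
    by linarith
qed

text \<open>Here \<open>a\<close> and \<open>b\<close> are the Wirtinger derivatives of
  \<open>f\<close>, and \<open>k\<close> stands for \<open>(K - 1) / (K + 1)\<close>. Directional
  derivatives along lines are what integration by parts uses.\<close>

definition smooth_reduced :: "real \<Rightarrow> (complex \<Rightarrow> complex) \<Rightarrow> (complex \<Rightarrow> complex) \<Rightarrow> (complex \<Rightarrow> complex) \<Rightarrow> bool" where
  "smooth_reduced k f a b \<longleftrightarrow> continuous_on UNIV f \<and> continuous_on UNIV a \<and> continuous_on UNIV b \<and>
     (\<forall>z v. ((\<lambda>t. f (z + of_real t * v)) has_vector_derivative a z * v + b z * cnj v) (at 0)) \<and>
     (\<forall>z. 0 \<le> Re (a z) \<and> cmod (b z) \<le> k * Re (a z))"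

lemma smooth_reduced_derivative:
  assumes "smooth_reduced k f a b"
  shows "((\<lambda>t. f (z + of_real t * v)) has_vector_derivative
    a (z + of_real t * v) * v + b (z + of_real t * v) * cnj v) (at t)"
proof -
  define D where "D = a (z + of_real t * v) * v + b (z + of_real t * v) * cnj v"
  have "((\<lambda>s. f ((z + of_real t * v) + of_real s * v)) has_vector_derivative D) (at (t - t))"
    using assms by (simp add: smooth_reduced_def D_def)
  moreover have "((\<lambda>s. s - t) has_vector_derivative 1) (at t)"
    by (auto intro!: derivative_eq_intros)
  ultimately have "((\<lambda>s. f ((z + of_real t * v) + of_real s * v)) \<circ> (\<lambda>s. s - t) has_vector_derivative 1 *\<^sub>R D) (at t)"
    by (intro vector_diff_chain_at)
  then show ?thesis
    by (simp add: D_def o_def algebra_simps)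
qed

text \<open>The substitution multiplies \<open>b\<close> by the unimodular factor
  \<open>cnj e / e\<close>, which leaves the cone invariant. It maps the segment from
  \<open>-1\<close> to \<open>1\<close> onto the one from \<open>c - e\<close> to
  \<open>c + e\<close>.\<close>

lemma smooth_reduced_similarity:
  assumes f: "smooth_reduced k f a b" and e: "e \<noteq> 0"
  shows "smooth_reduced k (\<lambda>z. f (c + e * z) / e) (\<lambda>z. a (c + e * z)) (\<lambda>z. b (c + e * z) * (cnj e / e))"
  unfolding smooth_reduced_def
proof (intro conjI allI)
  have cont: "continuous_on UNIV (\<lambda>z. g (c + e * z))" if "continuous_on UNIV g" for g :: "complex \<Rightarrow> complex"
    by (rule continuous_on_compose2[OF that]) (auto intro!: continuous_intros)
  show "continuous_on UNIV (\<lambda>z. f (c + e * z) / e)" "continuous_on UNIV (\<lambda>z. a (c + e * z))"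
    "continuous_on UNIV (\<lambda>z. b (c + e * z) * (cnj e / e))"
    using f e unfolding smooth_reduced_def by (auto intro!: continuous_intros cont)
  fix z v
  have "((\<lambda>t. f ((c + e * z) + of_real t * (e * v))) has_vector_derivative
      a (c + e * z) * (e * v) + b (c + e * z) * cnj (e * v)) (at 0)"
    using f unfolding smooth_reduced_def by blast
  from has_vector_derivative_divide[OF this, of e]
  show "((\<lambda>t. f (c + e * (z + of_real t * v)) / e) has_vector_derivative
      a (c + e * z) * v + b (c + e * z) * (cnj e / e) * cnj v) (at 0)"
    using e by (simp add: algebra_simps add_divide_distrib)
next
  fix z
  have "cmod (b (c + e * z) * (cnj e / e)) = cmod (b (c + e * z))"
    using e by (simp add: norm_mult norm_divide)
  then show "0 \<le> Re (a (c + e * z))" "cmod (b (c + e * z) * (cnj e / e)) \<le> k * Re (a (c + e * z))"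
    using f by (simp_all add: smooth_reduced_def)
qed

lemma smooth_reduced_reflection:
  assumes f: "smooth_reduced k f a b"
  shows "smooth_reduced k (\<lambda>z. cnj (f (cnj z))) (\<lambda>z. cnj (a (cnj z))) (\<lambda>z. cnj (b (cnj z)))"
  unfolding smooth_reduced_def
proof (intro conjI allI)
  have cont: "continuous_on UNIV (\<lambda>z. cnj (g (cnj z)))" if "continuous_on UNIV g" for g :: "complex \<Rightarrow> complex"
    by (rule continuous_on_cnj, rule continuous_on_compose2[OF that]) (auto intro!: continuous_intros)
  show "continuous_on UNIV (\<lambda>z. cnj (f (cnj z)))" "continuous_on UNIV (\<lambda>z. cnj (a (cnj z)))"
    "continuous_on UNIV (\<lambda>z. cnj (b (cnj z)))"
    using f unfolding smooth_reduced_def by (auto intro!: cont)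
  fix z v
  have "((\<lambda>t. f (cnj z + of_real t * cnj v)) has_vector_derivative
      a (cnj z) * cnj v + b (cnj z) * cnj (cnj v)) (at 0)"
    using f unfolding smooth_reduced_def by blast
  from has_vector_derivative_cnj[OF this]
  show "((\<lambda>t. cnj (f (cnj (z + of_real t * v)))) has_vector_derivative
      cnj (a (cnj z)) * v + cnj (b (cnj z)) * cnj v) (at 0)"
    by simp
next
  fix z show "0 \<le> Re (cnj (a (cnj z)))" "cmod (cnj (b (cnj z))) \<le> k * Re (cnj (a (cnj z)))"
    using f by (simp_all add: smooth_reduced_def)
qed

lemma cont2_Complex:
  assumes "continuous_on UNIV g"
  shows "cont2 (\<lambda>x y. Re (g (Complex x y)))" "cont2 (\<lambda>x y. Im (g (Complex x y)))"
proof -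
  have "continuous_on UNIV (\<lambda>p::real \<times> real. g (Complex (fst p) (snd p)))"
    by (rule continuous_on_compose2[OF assms]) (auto simp: complex_eq intro!: continuous_intros)
  then show "cont2 (\<lambda>x y. Re (g (Complex x y)))" "cont2 (\<lambda>x y. Im (g (Complex x y)))"
    unfolding cont2_def by (auto intro!: continuous_intros)
qed

lemma smooth_reduced_partials:
  assumes "smooth_reduced k f a b"
  defines "A \<equiv> \<lambda>x y. a (Complex x y)" and "B \<equiv> \<lambda>x y. b (Complex x y)"
  shows "((\<lambda>x. Re (f (Complex x y))) has_real_derivative Re (A x y) + Re (B x y)) (at x)"
    and "((\<lambda>y. Re (f (Complex x y))) has_real_derivative Im (B x y) - Im (A x y)) (at y)"
    and "((\<lambda>x. Im (f (Complex x y))) has_real_derivative Im (A x y) + Im (B x y)) (at x)"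
    and "((\<lambda>y. Im (f (Complex x y))) has_real_derivative Re (A x y) - Re (B x y)) (at y)"
proof -
  have Cx: "Complex 0 y + of_real x * 1 = Complex x y" for x y
    by (simp add: complex_eq_iff)
  have Cy: "Complex x 0 + of_real y * \<i> = Complex x y" for x y
    by (simp add: complex_eq_iff)
  note dx = smooth_reduced_derivative[OF assms(1), of "Complex 0 y" 1 x, unfolded Cx]
  note dy = smooth_reduced_derivative[OF assms(1), of "Complex x 0" \<i> y, unfolded Cy]
  show "((\<lambda>x. Re (f (Complex x y))) has_real_derivative Re (A x y) + Re (B x y)) (at x)"
    and "((\<lambda>x. Im (f (Complex x y))) has_real_derivative Im (A x y) + Im (B x y)) (at x)"
    using bounded_linear.has_vector_derivative[OF bounded_linear_Re dx]
      bounded_linear.has_vector_derivative[OF bounded_linear_Im dx]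
    by (auto simp: has_real_derivative_iff_has_vector_derivative A_def B_def)
  show "((\<lambda>y. Re (f (Complex x y))) has_real_derivative Im (B x y) - Im (A x y)) (at y)"
    and "((\<lambda>y. Im (f (Complex x y))) has_real_derivative Re (A x y) - Re (B x y)) (at y)"
    using bounded_linear.has_vector_derivative[OF bounded_linear_Re dy]
      bounded_linear.has_vector_derivative[OF bounded_linear_Im dy]
    by (auto simp: has_real_derivative_iff_has_vector_derivative A_def B_def)
qed

lemma smooth_reduced_pointwise:
  assumes "smooth_reduced k f a b"
  shows "0 \<le> Re (a z)" "cmod (b z) \<le> k * Re (a z)" "\<bar>Re (b z)\<bar> \<le> k * Re (a z)"
  using assms abs_Re_le_cmod[of "b z"] unfolding smooth_reduced_def by (auto intro: order_trans)

text \<open>Second derivatives of \<open>max 0 \<Psi> ^ (j + 4) / (j + 4)\<close> with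
  \<open>\<Psi> = A - x\<^sup>2 - B * y + N * y\<^sup>2\<close>.\<close>

context
  fixes A B N :: real and j :: nat
begin

definition "Psi x y = A - x\<^sup>2 - B * y + N * y\<^sup>2"

definition "Psi_yy x y =
  (j + 3) * max 0 (Psi x y) ^ (j + 2) * (2 * N * y - B)\<^sup>2 + 2 * N * max 0 (Psi x y) ^ (j + 3)"

definition "Psi_xy x y = (j + 3) * max 0 (Psi x y) ^ (j + 2) * (- 2 * x) * (2 * N * y - B)"

definition "Psi_xx x y =
  (j + 3) * max 0 (Psi x y) ^ (j + 2) * (4 * x\<^sup>2) - 2 * max 0 (Psi x y) ^ (j + 3)"

definition "Psi_xyy x y =
  (j + 3) * (j + 2) * max 0 (Psi x y) ^ (j + 1) * (- 2 * x) * (2 * N * y - B)\<^sup>2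
  + (j + 3) * max 0 (Psi x y) ^ (j + 2) * (- 2 * x) * (2 * N)"

definition "Psi_xxy x y =
  (j + 3) * (j + 2) * max 0 (Psi x y) ^ (j + 1) * (4 * x\<^sup>2) * (2 * N * y - B)
  - 2 * (j + 3) * max 0 (Psi x y) ^ (j + 2) * (2 * N * y - B)"

lemma Psi_derivatives:
  "((\<lambda>x. Psi x y) has_real_derivative - 2 * x) (at x)"
  "((\<lambda>y. Psi x y) has_real_derivative 2 * N * y - B) (at y)"
  unfolding Psi_def by (auto intro!: derivative_eq_intros simp: power2_eq_square)

lemma max_Psi_derivatives:
  "((\<lambda>x. max 0 (Psi x y) ^ (i + 2)) has_real_derivative real (i + 2) * max 0 (Psi x y) ^ (i + 1) * (- 2 * x)) (at x)"
  "((\<lambda>y. max 0 (Psi x y) ^ (i + 2)) has_real_derivative real (i + 2) * max 0 (Psi x y) ^ (i + 1) * (2 * N * y - B)) (at y)"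
  by (rule has_real_derivative_max_0_power_compose Psi_derivatives)+

lemma Psi_second_derivatives:
  "((\<lambda>x. Psi_yy x y) has_real_derivative Psi_xyy x y) (at x)"
  "((\<lambda>y. Psi_xy x y) has_real_derivative Psi_xyy x y) (at y)"
  "((\<lambda>x. Psi_xy x y) has_real_derivative Psi_xxy x y) (at x)"
  "((\<lambda>y. Psi_xx x y) has_real_derivative Psi_xxy x y) (at y)"
proof -
  have F: "max 0 (Psi x y) ^ (j + 3) = max 0 (Psi x y) ^ (j + 1 + 2)" for x y
    by (simp add: numeral_3_eq_3)
  show "((\<lambda>x. Psi_yy x y) has_real_derivative Psi_xyy x y) (at x)"
    unfolding Psi_yy_def Psi_xyy_def F
    by (rule derivative_eq_intros max_Psi_derivatives refl)+ (simp add: algebra_simps power2_eq_square)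
  show "((\<lambda>y. Psi_xy x y) has_real_derivative Psi_xyy x y) (at y)"
    unfolding Psi_xy_def Psi_xyy_def F
    by (rule derivative_eq_intros max_Psi_derivatives refl)+ (simp add: algebra_simps power2_eq_square)
  show "((\<lambda>x. Psi_xy x y) has_real_derivative Psi_xxy x y) (at x)"
    unfolding Psi_xy_def Psi_xxy_def F
    by (rule derivative_eq_intros max_Psi_derivatives refl)+ (simp add: algebra_simps power2_eq_square)
  show "((\<lambda>y. Psi_xx x y) has_real_derivative Psi_xxy x y) (at y)"
    unfolding Psi_xx_def Psi_xxy_def F
    by (rule derivative_eq_intros max_Psi_derivatives refl)+ (simp add: algebra_simps power2_eq_square)
qed

lemma Psi_cont2:
  "cont2 Psi" "cont2 Psi_yy" "cont2 Psi_xy" "cont2 Psi_xx" "cont2 Psi_xyy" "cont2 Psi_xxy"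
proof -
  show P: "cont2 Psi"
    unfolding Psi_def cont2_def by (intro continuous_intros)
  have [continuous_intros]: "continuous_on UNIV (\<lambda>p::real \<times> real. Psi (fst p) (snd p))"
    using P by (simp add: cont2_def)
  show "cont2 Psi_yy" "cont2 Psi_xy" "cont2 Psi_xx" "cont2 Psi_xyy" "cont2 Psi_xxy"
    unfolding cont2_def Psi_yy_def Psi_xy_def Psi_xx_def Psi_xyy_def Psi_xxy_def
    by (intro continuous_intros)+
qed

text \<open>Adding the identities for \<open>f\<close> and its reflection cancels the boundary term that
  involves \<open>Im f\<close>. The remaining one is a weighted strain of the real axis.\<close>

lemma airy_identity:
  assumes f: "smooth_reduced k f a b" and L: "0 \<le> L"
    and Z: "\<And>x y. x \<in> {-L..L} \<Longrightarrow> y \<in> {0..L} \<Longrightarrow> \<bar>x\<bar> = L \<or> y = L \<Longrightarrow> Psi x y \<le> 0"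
  defines "E \<equiv> \<lambda>a b x y. Psi_yy x y * (Re (a (Complex x y)) + Re (b (Complex x y)))
      + Psi_xx x y * (Re (a (Complex x y)) - Re (b (Complex x y)))
      - Psi_xy x y * (2 * Im (b (Complex x y)))"
  shows "rect L (E a b) + rect L (E (\<lambda>z. cnj (a (cnj z))) (\<lambda>z. cnj (b (cnj z)))) =
    2 * B * integral {-L..L} (\<lambda>x. max 0 (A - x\<^sup>2) ^ (j + 3) *
      (Re (a (of_real x)) + Re (b (of_real x))))"
proof -
  have half: "rect L (E a b) = integral {-L..L} (\<lambda>x. Psi_xy x 0 * Re (f (Complex x 0)))
      - integral {-L..L} (\<lambda>x. Psi_xx x 0 * Im (f (Complex x 0)))"
    if f: "smooth_reduced k f a b" for f a b
  proof -
    have ca: "continuous_on UNIV f" "continuous_on UNIV a" "continuous_on UNIV b"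
      using f by (auto simp: smooth_reduced_def)
    have z: "max 0 (Psi x y) = 0" if "x \<in> {-L..L}" "y \<in> {0..L}" "\<bar>x\<bar> = L \<or> y = L" for x y
      using Z[OF that] by simp
    \<comment> \<open>\<open>Im a\<close> occurs only in the sum of the two mixed derivatives, where
      it cancels.\<close>
    have "rect L (\<lambda>x y. Psi_yy x y * (Re (a (Complex x y)) + Re (b (Complex x y)))
      + Psi_xx x y * (Re (a (Complex x y)) - Re (b (Complex x y)))
      - Psi_xy x y * ((Im (b (Complex x y)) - Im (a (Complex x y))) + (Im (a (Complex x y)) + Im (b (Complex x y)))))
      = integral {-L..L} (\<lambda>x. Psi_xy x 0 * Re (f (Complex x 0)))
      - integral {-L..L} (\<lambda>x. Psi_xx x 0 * Im (f (Complex x 0)))"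
    proof (rule rect_airy[OF L _ _ _ _ _ _ _ _ _ _ _ Psi_second_derivatives smooth_reduced_partials[OF f]])
      fix y assume "y \<in> {0..L}"
      then have "max 0 (Psi L y) = 0" "max 0 (Psi (-L) y) = 0"
        using L by (auto intro!: z)
      then show "Psi_yy L y = 0 \<and> Psi_yy (-L) y = 0 \<and> Psi_xy L y = 0 \<and> Psi_xy (-L) y = 0"
        by (simp add: Psi_yy_def Psi_xy_def)
    next
      fix x assume "x \<in> {-L..L}"
      then have "max 0 (Psi x L) = 0"
        using L by (auto intro!: z)
      then show "Psi_xy x L = 0 \<and> Psi_xx x L = 0"
        by (simp add: Psi_xx_def Psi_xy_def)
    qed (intro Psi_cont2 cont2_intros cont2_Complex ca)+
    then show ?thesis
      by (simp add: E_def)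
  qed
  define g where "g = (\<lambda>x. Re (f (Complex x 0)))"
  \<comment> \<open>An antiderivative of \<open>Psi_xy x 0\<close>. A second integration by parts,
    along the axis, replaces \<open>Re f\<close> by its derivative.\<close>
  define P where "P = (\<lambda>x. - B * max 0 (A - x\<^sup>2) ^ (j + 3))"
  have "rect L (E a b) + rect L (E (\<lambda>z. cnj (a (cnj z))) (\<lambda>z. cnj (b (cnj z)))) =
      2 * integral {-L..L} (\<lambda>x. Psi_xy x 0 * g x)"
  proof -
    have "cnj (Complex x 0) = Complex x 0" for x
      by (simp add: complex_eq_iff)
    then show ?thesis
      unfolding half[OF f] half[OF smooth_reduced_reflection[OF f]] by (simp add: g_def)
  qed
  also have "integral {-L..L} (\<lambda>x. Psi_xy x 0 * g x) =
      - integral {-L..L} (\<lambda>x. P x * (Re (a (Complex x 0)) + Re (b (Complex x 0))))"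
  proof -
    have D: "(P has_real_derivative Psi_xy x 0) (at x)" for x
      using DERIV_cmult[OF max_Psi_derivatives(1)[of 0 "j + 1" x], of "- B"]
      by (simp add: P_def Psi_xy_def Psi_def algebra_simps eval_nat_numeral)
    have PL: "P L = 0" "P (-L) = 0"
      using Z[of L 0] Z[of "-L" 0] L by (auto simp: P_def Psi_def max_def)
    have "cont2 (\<lambda>x y. Re (a (Complex x y)) + Re (b (Complex x y)))"
      using f unfolding smooth_reduced_def by (intro cont2_intros cont2_Complex) auto
    then have "continuous_on {-L..L} (\<lambda>x. Re (a (Complex x 0)) + Re (b (Complex x 0)))"
      using cont2_slice(1)[of "\<lambda>x y. Re (a (Complex x y)) + Re (b (Complex x y))" "{-L..L}" 0] by simp
    with integral_by_parts_real[of "-L" L P "\<lambda>x. Psi_xy x 0" g "\<lambda>x. Re (a (Complex x 0)) + Re (b (Complex x 0))"]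
    show ?thesis
      using L D PL smooth_reduced_partials(1)[OF f, of 0] cont2_slice(1)[OF Psi_cont2(3)]
      unfolding g_def by simp
  qed
  also have "integral {-L..L} (\<lambda>x. P x * (Re (a (Complex x 0)) + Re (b (Complex x 0)))) =
      - B * integral {-L..L} (\<lambda>x. max 0 (A - x\<^sup>2) ^ (j + 3) * (Re (a (Complex x 0)) + Re (b (Complex x 0))))"
    unfolding P_def mult.assoc by (rule integral_mult_right)
  finally show ?thesis
    by (simp add: complex_of_real_def)
qed

text \<open>The Hessian of a power of \<open>Psi\<close> consists of a rank one part from the
  gradient and a multiple of the constant Hessian of \<open>Psi\<close>, which has eigenvalues
  \<open>2 * N\<close> and \<open>- 2\<close>. Up to powers of \<open>max 0 (Psi x y)\<close>, the
  first contributes \<open>(cmod w)\<^sup>2 * Re a + Re (w\<^sup>2 * b)\<close> and the second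
  \<open>2 * (N - 1) * Re a + 2 * (N + 1) * Re b\<close>. The terms in \<open>b\<close> form the
  error.\<close>

lemma airy_integrand_bound:
  assumes "cmod b \<le> k * Re a"
  defines "F2 \<equiv> \<lambda>x y. (j + 3) * max 0 (Psi x y) ^ (j + 2) * ((2 * N * y - B)\<^sup>2 + 4 * x\<^sup>2)"
    and "F3 \<equiv> \<lambda>x y. max 0 (Psi x y) ^ (j + 3)"
  shows "\<bar>Psi_yy x y * (Re a + Re b) + Psi_xx x y * (Re a - Re b) - Psi_xy x y * (2 * Im b)
      - (F2 x y + 2 * (N - 1) * F3 x y) * Re a\<bar> \<le> (F2 x y + 2 * \<bar>N + 1\<bar> * F3 x y) * (k * Re a)"
proof -
  define w where "w = Complex (2 * N * y - B) (- 2 * x)"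
  define G where "G = (j + 3) * max 0 (Psi x y) ^ (j + 2)"
  have G: "0 \<le> G" "0 \<le> F3 x y"
    by (simp_all add: G_def F3_def)
  have w2: "(cmod w)\<^sup>2 = (2 * N * y - B)\<^sup>2 + 4 * x\<^sup>2"
    by (simp add: w_def cmod_power2)
  have F2: "F2 x y = G * (cmod w)\<^sup>2"
    by (simp add: F2_def G_def w2)
  have "\<bar>Re (w\<^sup>2 * b)\<bar> \<le> cmod (w\<^sup>2 * b)"
    by (rule abs_Re_le_cmod)
  also have "\<dots> = (cmod w)\<^sup>2 * cmod b"
    by (simp add: norm_mult norm_power)
  also have "\<dots> \<le> (cmod w)\<^sup>2 * (k * Re a)"
    using assms by (intro mult_left_mono) auto
  finally have "\<bar>G * Re (w\<^sup>2 * b)\<bar> \<le> F2 x y * (k * Re a)"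
    using G by (simp add: F2 abs_mult mult.assoc mult_left_mono)
  moreover have "\<bar>2 * (N + 1) * F3 x y * Re b\<bar> \<le> 2 * \<bar>N + 1\<bar> * F3 x y * (k * Re a)"
  proof -
    have "\<bar>Re b\<bar> \<le> k * Re a"
      using assms abs_Re_le_cmod[of b] by linarith
    then have "2 * \<bar>N + 1\<bar> * F3 x y * \<bar>Re b\<bar> \<le> 2 * \<bar>N + 1\<bar> * F3 x y * (k * Re a)"
      using G by (intro mult_left_mono) auto
    then show ?thesis
      by (simp only: abs_mult abs_numeral abs_of_nonneg[OF G(2)])
  qed
  moreover have "Psi_yy x y * (Re a + Re b) + Psi_xx x y * (Re a - Re b) - Psi_xy x y * (2 * Im b)
      - (F2 x y + 2 * (N - 1) * F3 x y) * Re a = G * Re (w\<^sup>2 * b) + 2 * (N + 1) * F3 x y * Re b"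
  proof -
    have Rw: "Re (w\<^sup>2 * b) = ((2 * N * y - B)\<^sup>2 - 4 * x\<^sup>2) * Re b + 4 * x * (2 * N * y - B) * Im b"
      by (simp add: w_def power2_eq_square algebra_simps)
    have eqs: "Psi_yy x y = G * (2 * N * y - B)\<^sup>2 + 2 * N * F3 x y"
      "Psi_xy x y = G * (- 2 * x) * (2 * N * y - B)"
      "Psi_xx x y = G * (4 * x\<^sup>2) - 2 * F3 x y"
      by (simp_all add: Psi_yy_def Psi_xy_def Psi_xx_def G_def F3_def)
    then show ?thesis
      unfolding Rw F2 w2 eqs by (simp add: algebra_simps)
  qed
  ultimately show ?thesis
    by (simp add: distrib_right)
qed

text \<open>The right-hand side is the contribution of the crease. When the weight on the left is
  positive, \<open>B > 0\<close> bounds the area by the axis; \<open>B < 0\<close> reverses the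
  roles and tolerates a negative weight; for \<open>B = 0\<close> there is no crease, and regions of
  positive and of negative weight are compared.\<close>

lemma airy_inequality:
  assumes f: "smooth_reduced k f a b" and L: "0 \<le> L"
    and Z: "\<And>x y. x \<in> {-L..L} \<Longrightarrow> y \<in> {0..L} \<Longrightarrow> \<bar>x\<bar> = L \<or> y = L \<Longrightarrow> Psi x y \<le> 0"
  shows "rect L (\<lambda>x y. ((1 - k) * ((j + 3) * max 0 (Psi x y) ^ (j + 2) * ((2 * N * y - B)\<^sup>2 + 4 * x\<^sup>2))
      + 2 * (N - 1 - \<bar>N + 1\<bar> * k) * max 0 (Psi x y) ^ (j + 3)) *
      (Re (a (Complex x y)) + Re (a (Complex x (- y))))) \<le>
    2 * B * integral {-L..L} (\<lambda>x. max 0 (A - x\<^sup>2) ^ (j + 3) * (Re (a (of_real x)) + Re (b (of_real x))))"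
proof -
  define Q where "Q = (\<lambda>x y. (1 - k) * ((j + 3) * max 0 (Psi x y) ^ (j + 2) * ((2 * N * y - B)\<^sup>2 + 4 * x\<^sup>2))
      + 2 * (N - 1 - \<bar>N + 1\<bar> * k) * max 0 (Psi x y) ^ (j + 3))"
  define E where "E = (\<lambda>a b x y. Psi_yy x y * (Re (a (Complex x y)) + Re (b (Complex x y)))
      + Psi_xx x y * (Re (a (Complex x y)) - Re (b (Complex x y)))
      - Psi_xy x y * (2 * Im (b (Complex x y))))"
  have cQ: "cont2 Q"
    unfolding Q_def by (intro cont2_intros Psi_cont2)
  have bound: "rect L (\<lambda>x y. Q x y * Re (a (Complex x y))) \<le> rect L (E a b)"
    if f: "smooth_reduced k f a b" for f a b
  proof (rule rect_mono)
    have c: "continuous_on UNIV a" "continuous_on UNIV b"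
      using f by (auto simp: smooth_reduced_def)
    show "cont2 (\<lambda>x y. Q x y * Re (a (Complex x y)))" "cont2 (E a b)"
      unfolding E_def by (intro cont2_intros cQ Psi_cont2 cont2_Complex c)+
    fix x y
    show "Q x y * Re (a (Complex x y)) \<le> E a b x y"
      using airy_integrand_bound[OF smooth_reduced_pointwise(2)[OF f], of x y "Complex x y"]
      unfolding Q_def E_def by (simp add: abs_le_iff algebra_simps)
  qed
  have C: "cnj (Complex x y) = Complex x (- y)" for x y
    by (simp add: complex_eq_iff)
  have f': "smooth_reduced k (\<lambda>z. cnj (f (cnj z))) (\<lambda>z. cnj (a (cnj z))) (\<lambda>z. cnj (b (cnj z)))"
    by (rule smooth_reduced_reflection[OF f])
  have "continuous_on UNIV a" "continuous_on UNIV (\<lambda>z. cnj (a (cnj z)))"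
    using f f' by (auto simp: smooth_reduced_def)
  note c = this[THEN cont2_Complex(1)]
  have "rect L (\<lambda>x y. Q x y * (Re (a (Complex x y)) + Re (a (Complex x (- y))))) =
      rect L (\<lambda>x y. Q x y * Re (a (Complex x y))) + rect L (\<lambda>x y. Q x y * Re (a (Complex x (- y))))"
    using c cQ by (simp add: distrib_left rect_add cont2_intros C)
  also have "\<dots> \<le> rect L (E a b) + rect L (E (\<lambda>z. cnj (a (cnj z))) (\<lambda>z. cnj (b (cnj z))))"
    using bound[OF f] bound[OF f'] by (simp add: C)
  also have "\<dots> = 2 * B * integral {-L..L} (\<lambda>x. max 0 (A - x\<^sup>2) ^ (j + 3) *
      (Re (a (of_real x)) + Re (b (of_real x))))"
    unfolding E_def by (rule airy_identity[OF f L Z])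
  finally show ?thesis
    unfolding Q_def .
qed

end

section \<open>Comparing the axis with the area\<close>

lemma smooth_reduced_axis:
  assumes f: "smooth_reduced k f a b" and k: "k \<le> 1"
  shows "0 \<le> Re (a (of_real x)) + Re (b (of_real x))"
    and "continuous_on S (\<lambda>x. Re (a (of_real x)) + Re (b (of_real x)))"
    and "s \<le> t \<Longrightarrow> integral {s..t} (\<lambda>x. Re (a (of_real x)) + Re (b (of_real x))) = Re (f (of_real t)) - Re (f (of_real s))"
proof -
  have "k * Re (a (of_real x)) \<le> 1 * Re (a (of_real x))"
    using smooth_reduced_pointwise(1)[OF f] k by (intro mult_right_mono) auto
  then show "0 \<le> Re (a (of_real x)) + Re (b (of_real x))"
    using smooth_reduced_pointwise(3)[OF f, of "of_real x"] by simp
  have "continuous_on S (\<lambda>x. a (of_real x))" "continuous_on S (\<lambda>x. b (of_real x))"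
    using f unfolding smooth_reduced_def
    by (auto intro!: continuous_on_compose2[of UNIV a] continuous_on_compose2[of UNIV b] continuous_intros)
  then show "continuous_on S (\<lambda>x. Re (a (of_real x)) + Re (b (of_real x)))"
    by (intro continuous_intros)
  assume "s \<le> t"
  then show "integral {s..t} (\<lambda>x. Re (a (of_real x)) + Re (b (of_real x))) = Re (f (of_real t)) - Re (f (of_real s))"
    using smooth_reduced_partials(1)[OF f, of 0]
    by (intro integral_unique fundamental_theorem_of_calculus)
       (auto simp: has_real_derivative_iff_has_vector_derivative[symmetric] complex_of_real_def
         intro: has_field_derivative_at_within)
qed

lemma smooth_reduced_area:
  assumes f: "smooth_reduced k f a b"
  defines "W \<equiv> \<lambda>x y. Re (a (Complex x y)) + Re (a (Complex x (- y)))"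
  shows "cont2 W" and "0 \<le> W x y"
proof -
  have "cnj (Complex x y) = Complex x (- y)" for x y
    by (simp add: complex_eq_iff)
  moreover have "continuous_on UNIV a" "continuous_on UNIV (\<lambda>z. cnj (a (cnj z)))"
    using f smooth_reduced_reflection[OF f] by (auto simp: smooth_reduced_def)
  ultimately show "cont2 W"
    unfolding W_def using cont2_add[OF cont2_Complex(1) cont2_Complex(1), of a "\<lambda>z. cnj (a (cnj z))"] by simp
  show "0 \<le> W x y"
    unfolding W_def using smooth_reduced_pointwise(1)[OF f] by simp
qed

text \<open>With \<open>B = -1\<close> the crease has the sign that bounds the axis by the area. The
  gradient term is nonnegative and is dropped; the rest of the weight is bounded below by a
  constant.\<close>

lemma axis_le_area:
  assumes f: "smooth_reduced k f a b" and k: "0 \<le> k" "k < 1"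
  shows "Re (f 2) - Re (f (- 2)) \<le> 71 * rect 4 (\<lambda>x y. Re (a (Complex x y)) + Re (a (Complex x (- y))))"
proof -
  define W where "W = (\<lambda>x y. Re (a (Complex x y)) + Re (a (Complex x (- y))))"
  have W: "cont2 W" "0 \<le> W x y" for x y
    using smooth_reduced_area[OF f] by (simp_all add: W_def)
  define g where "g = (\<lambda>x::real. Re (a (of_real x)) + Re (b (of_real x)))"
  have g: "0 \<le> g x" "continuous_on S g" "s \<le> t \<Longrightarrow> integral {s..t} g = Re (f (of_real t)) - Re (f (of_real s))" for x s t S
    using smooth_reduced_axis[OF f less_imp_le[OF k(2)]] by (simp_all add: g_def)
  define P where "P = Psi 9 (-1) (-2)"
  have P: "P x y = 9 - x\<^sup>2 + y - 2 * y\<^sup>2" for x y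
    by (simp add: P_def Psi_def)
  define Q where "Q = (\<lambda>x y. (1 - k) * (real (0 + 3) * max 0 (P x y) ^ (0 + 2) * ((2 * -2 * y - -1)\<^sup>2 + 4 * x\<^sup>2))
      + 2 * (-2 - 1 - \<bar>-2 + 1\<bar> * k) * max 0 (P x y) ^ (0 + 3))"
  have le: "rect 4 (\<lambda>x y. Q x y * W x y) \<le> 2 * -1 * integral {-4..4} (\<lambda>x. max 0 (9 - x\<^sup>2) ^ (0 + 3) * g x)"
    unfolding Q_def W_def g_def P_def
  proof (rule airy_inequality[OF f])
    fix x y :: real assume xy: "x \<in> {-4..4}" "y \<in> {0..4}" "\<bar>x\<bar> = 4 \<or> y = 4"
    from xy(3) show "Psi 9 (- 1) (- 2) x y \<le> 0"
    proof
      assume "\<bar>x\<bar> = 4"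
      then have "x\<^sup>2 = 16" by (metis power2_abs power2_eq_square mult_numeral_left_semiring_numeral num_double numeral_times_numeral)
      moreover have "0 \<le> y\<^sup>2" by simp
      ultimately show ?thesis using xy(2) unfolding Psi_def atLeastAtMost_iff by linarith
    next
      assume "y = 4"
      then have "Psi 9 (- 1) (- 2) x y = - 19 - x\<^sup>2"
        by (simp add: Psi_def)
      also have "\<dots> \<le> 0"
        using zero_le_power2[of x] by linarith
      finally show ?thesis .
    qed
  qed simp
  have cP: "cont2 P" unfolding P_def by (rule Psi_cont2)
  have cQ: "cont2 Q" unfolding Q_def by (intro cont2_intros cP)
  \<comment> \<open>\<open>17576 = 8 * 13 ^ 3\<close>, where \<open>8\<close> bounds
    \<open>6 + 2 * k\<close> and \<open>13\<close> bounds \<open>9 + y\<close>. The crease has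
    weight at least \<open>5 ^ 3\<close> on \<open>{-2..2}\<close>, and
    \<open>17576 / (2 * 5 ^ 3) < 71\<close>.\<close>
  have "rect 4 (\<lambda>x y. - 17576 * W x y) \<le> rect 4 (\<lambda>x y. Q x y * W x y)"
  proof (rule rect_mono)
    fix x y :: real assume "x \<in> {-4..4}" "y \<in> {0..4}"
    then have "max 0 (P x y) \<le> 13"
      using zero_le_power2[of x] zero_le_power2[of y] unfolding P atLeastAtMost_iff by linarith
    then have "max 0 (P x y) ^ 3 \<le> 13 ^ 3"
      by (intro power_mono) auto
    then have "(6 + 2 * k) * max 0 (P x y) ^ 3 \<le> 8 * 13 ^ 3"
      using k by (intro mult_mono) auto
    moreover have "0 \<le> (1 - k) * (3 * max 0 (P x y) ^ 2 * ((2 * -2 * y - -1)\<^sup>2 + 4 * x\<^sup>2))"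
      using k by simp
    moreover have "Q x y = (1 - k) * (3 * max 0 (P x y) ^ 2 * ((2 * -2 * y - -1)\<^sup>2 + 4 * x\<^sup>2)) - (6 + 2 * k) * max 0 (P x y) ^ 3"
      unfolding Q_def add_0 of_nat_numeral by (simp add: algebra_simps)
    ultimately have "- 17576 \<le> Q x y"
      by simp
    then show "- 17576 * W x y \<le> Q x y * W x y"
      by (intro mult_right_mono W)
  qed (intro cont2_intros cQ W)+
  then have "- 17576 * rect 4 W \<le> - 2 * integral {-4..4} (\<lambda>x. max 0 (9 - x\<^sup>2) ^ 3 * g x)"
    using le unfolding rect_cmult by simp
  moreover have "125 * (Re (f 2) - Re (f (- 2))) \<le> integral {-4..4} (\<lambda>x. max 0 (9 - x\<^sup>2) ^ 3 * g x)"
  proof -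
    have int: "(\<lambda>x. max 0 (9 - x\<^sup>2) ^ 3 * g x) integrable_on {s..t}" for s t
      by (intro integrable_continuous_interval continuous_intros g)
    have "125 * (Re (f 2) - Re (f (- 2))) = integral {-2..2} (\<lambda>x. 125 * g x)"
      using g(3)[of "-2" 2] by simp
    also have "\<dots> \<le> integral {-2..2} (\<lambda>x. max 0 (9 - x\<^sup>2) ^ 3 * g x)"
    proof (intro integral_le int integrable_continuous_interval continuous_intros g)
      fix x :: real assume "x \<in> {-2..2}"
      then have "\<bar>x\<bar> \<le> 2" by auto
      then have "x\<^sup>2 \<le> 2\<^sup>2" using abs_le_square_iff[of x 2] by simp
      then have "5 ^ 3 \<le> max 0 (9 - x\<^sup>2) ^ 3"
        by (intro power_mono) auto
      then show "125 * g x \<le> max 0 (9 - x\<^sup>2) ^ 3 * g x"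
        by (intro mult_right_mono g) simp
    qed
    also have "\<dots> \<le> integral {-4..4} (\<lambda>x. max 0 (9 - x\<^sup>2) ^ 3 * g x)"
      by (intro integral_subset_le int) (auto intro!: mult_nonneg_nonneg g)
    finally show ?thesis .
  qed
  moreover have "0 \<le> rect 4 W"
    unfolding rect_def by (intro integral_nonneg cont2_integrable W)
  ultimately show ?thesis
    unfolding W_def[symmetric] by simp
qed

text \<open>\<open>N\<close> solves \<open>N * (1 - k) = 3\<close>, so the critical coefficient
  \<open>N - 1 - (N + 1) * k\<close> equals \<open>2 - k\<close> and the weight is positive on the
  whole lens. Since \<open>N * y\<^sup>2 \<le> 8 * N * y\<close> on the half square, the coefficient
  \<open>8 * N + 1\<close> of \<open>y\<close> confines the lens to \<open>y < 1\<close>.\<close>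

lemma lens_le_axis:
  assumes f: "smooth_reduced k f a b" and k: "0 \<le> k" "k < 1"
  defines "N \<equiv> 3 / (1 - k)"
  shows "rect 8 (\<lambda>x y. max 0 (1 - x\<^sup>2 - (8 * N + 1) * y + N * y\<^sup>2) ^ 3 *
      (Re (a (Complex x y)) + Re (a (Complex x (- y))))) \<le> (8 * N + 1) * (Re (f 1) - Re (f (- 1)))"
proof -
  define W where "W = (\<lambda>x y. Re (a (Complex x y)) + Re (a (Complex x (- y))))"
  have W: "cont2 W" "0 \<le> W x y" for x y
    using smooth_reduced_area[OF f] by (simp_all add: W_def)
  define g where "g = (\<lambda>x::real. Re (a (of_real x)) + Re (b (of_real x)))"
  have g: "0 \<le> g x" "continuous_on S g" "s \<le> t \<Longrightarrow> integral {s..t} g = Re (f (of_real t)) - Re (f (of_real s))" for x s t S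
    using smooth_reduced_axis[OF f less_imp_le[OF k(2)]] by (simp_all add: g_def)
  define B where "B = 8 * N + 1"
  define P where "P = Psi 1 B N"
  have P: "P x y = 1 - x\<^sup>2 - B * y + N * y\<^sup>2" for x y
    by (simp add: P_def Psi_def)
  have N: "0 < N" using k by (simp add: N_def)
  have B: "1 \<le> B" using N by (simp add: B_def)
  define Q where "Q = (\<lambda>x y. (1 - k) * (real (0 + 3) * max 0 (P x y) ^ (0 + 2) * ((2 * N * y - B)\<^sup>2 + 4 * x\<^sup>2))
      + 2 * (N - 1 - \<bar>N + 1\<bar> * k) * max 0 (P x y) ^ (0 + 3))"
  have le: "rect 8 (\<lambda>x y. Q x y * W x y) \<le> 2 * B * integral {-8..8} (\<lambda>x. max 0 (1 - x\<^sup>2) ^ (0 + 3) * g x)"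
    unfolding Q_def W_def g_def P_def
  proof (rule airy_inequality[OF f])
    fix x y :: real assume xy: "x \<in> {-8..8}" "y \<in> {0..8}" "\<bar>x\<bar> = 8 \<or> y = 8"
    have "N * y * y \<le> N * y * 8"
      using xy N by (intro mult_left_mono) auto
    then have le: "P x y \<le> 1 - x\<^sup>2 - y"
      by (simp add: P B_def power2_eq_square algebra_simps)
    from xy(3) have "P x y \<le> 0"
    proof
      assume "\<bar>x\<bar> = 8"
      then have "\<bar>x\<bar>\<^sup>2 = 64" by simp
      then show ?thesis using xy le by simp
    next
      assume "y = 8"
      then show ?thesis using xy le by (smt (verit) zero_le_power2)
    qed
    then show "Psi 1 B N x y \<le> 0"
      by (simp add: P_def)
  qed simp
  have cP: "cont2 P" unfolding P_def by (rule Psi_cont2)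
  have cQ: "cont2 Q" unfolding Q_def by (intro cont2_intros cP)
  have "rect 8 (\<lambda>x y. 2 * (max 0 (P x y) ^ 3 * W x y)) \<le> rect 8 (\<lambda>x y. Q x y * W x y)"
  proof (rule rect_mono)
    fix x y :: real
    have "N - 1 - \<bar>N + 1\<bar> * k = N * (1 - k) - 1 - k"
      using N by (simp add: algebra_simps)
    also have "\<dots> = 2 - k"
    proof -
      have "1 - k \<noteq> 0" using k by simp
      then have "N * (1 - k) = 3"
        using nonzero_eq_divide_eq[of "1 - k" N 3] N_def by blast
      then show ?thesis by simp
    qed
    finally have "1 \<le> N - 1 - \<bar>N + 1\<bar> * k"
      using k by simp
    then have "2 * 1 * max 0 (P x y) ^ 3 \<le> 2 * (N - 1 - \<bar>N + 1\<bar> * k) * max 0 (P x y) ^ 3"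
      by (intro mult_right_mono mult_left_mono) auto
    moreover have "0 \<le> (1 - k) * (3 * max 0 (P x y) ^ 2 * ((2 * N * y - B)\<^sup>2 + 4 * x\<^sup>2))"
      using k by simp
    ultimately have "2 * max 0 (P x y) ^ 3 \<le> Q x y"
      unfolding Q_def add_0 of_nat_numeral by linarith
    then show "2 * (max 0 (P x y) ^ 3 * W x y) \<le> Q x y * W x y"
      unfolding mult.assoc[symmetric] by (intro mult_right_mono W)
  qed (intro cont2_intros cP cQ W)+
  then have "2 * rect 8 (\<lambda>x y. max 0 (P x y) ^ 3 * W x y) \<le> 2 * B * integral {-8..8} (\<lambda>x. max 0 (1 - x\<^sup>2) ^ 3 * g x)"
    using le unfolding rect_cmult by simp
  moreover have "integral {-8..8} (\<lambda>x. max 0 (1 - x\<^sup>2) ^ 3 * g x) \<le> Re (f 1) - Re (f (- 1))"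
  proof -
    have int: "(\<lambda>x. max 0 (1 - x\<^sup>2) ^ 3 * g x) integrable_on {s..t}" for s t
      by (intro integrable_continuous_interval continuous_intros g)
    have "max 0 (1 - x\<^sup>2) ^ 3 * g x = 0" if "1 \<le> \<bar>x\<bar>" for x
      using that by (simp add: abs_le_square_iff[of 1 x, simplified] max_def)
    then have zero: "integral {-8..-1} (\<lambda>x. max 0 (1 - x\<^sup>2) ^ 3 * g x) = 0"
      "integral {1..8} (\<lambda>x. max 0 (1 - x\<^sup>2) ^ 3 * g x) = 0"
      by (auto intro!: integral_unique has_integral_is_0)
    have "integral {-8..8} (\<lambda>x. max 0 (1 - x\<^sup>2) ^ 3 * g x) = integral {-1..1} (\<lambda>x. max 0 (1 - x\<^sup>2) ^ 3 * g x)"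
      using Henstock_Kurzweil_Integration.integral_combine[of "-8" "-1" 8 "\<lambda>x. max 0 (1 - x\<^sup>2) ^ 3 * g x"]
        Henstock_Kurzweil_Integration.integral_combine[of "-1" 1 8 "\<lambda>x. max 0 (1 - x\<^sup>2) ^ 3 * g x"] int zero by simp
    also have "\<dots> \<le> integral {-1..1} g"
    proof (intro integral_le int integrable_continuous_interval g)
      fix x :: real
      have "max 0 (1 - x\<^sup>2) ^ 3 \<le> 1" by (intro power_le_one) auto
      then show "max 0 (1 - x\<^sup>2) ^ 3 * g x \<le> g x"
        using g(1)[of x] mult_right_mono by fastforce
    qed
    also have "\<dots> = Re (f 1) - Re (f (- 1))"
      using g(3)[of "-1" 1] by simp
    finally show ?thesis .
  qed
  ultimately have "2 * rect 8 (\<lambda>x y. max 0 (P x y) ^ 3 * W x y) \<le> 2 * B * (Re (f 1) - Re (f (- 1)))"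
    using B by (smt (verit) mult_left_mono)
  then have "rect 8 (\<lambda>x y. max 0 (P x y) ^ 3 * W x y) \<le> B * (Re (f 1) - Re (f (- 1)))"
    by (simp add: mult.assoc)
  then show ?thesis
    unfolding P W_def B_def .
qed

text \<open>The radial test function controls the annulus by the disc of radius \<open>1 / (4 * B)\<close>, which lies
  in the support of the lens test function.\<close>

lemma area_le_lens:
  assumes f: "smooth_reduced k f a b" and k: "0 \<le> k" "k < 1"
  defines "N \<equiv> 3 / (1 - k)"
  assumes n: "65 * 16 * (8 * N + 1)\<^sup>2 \<le> (1 - k) * (real n + 3)"
  shows "rect 4 (\<lambda>x y. Re (a (Complex x y)) + Re (a (Complex x (- y)))) \<le>
    544 * 64 ^ (n + 2) * rect 8 (\<lambda>x y. max 0 (1 - x\<^sup>2 - (8 * N + 1) * y + N * y\<^sup>2) ^ 3 *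
      (Re (a (Complex x y)) + Re (a (Complex x (- y)))))"
proof -
  define W where "W = (\<lambda>x y. Re (a (Complex x y)) + Re (a (Complex x (- y))))"
  have W: "cont2 W" "0 \<le> W x y" for x y
    using smooth_reduced_area[OF f] by (simp_all add: W_def)
  define B where "B = 8 * N + 1"
  have N: "0 < N" using k by (simp add: N_def)
  have B: "1 \<le> B" using N by (simp add: B_def)
  \<comment> \<open>The radial case: \<open>N = -1\<close> removes the term in \<open>Re b\<close>,
    and \<open>B = 0\<close> removes the crease, so the right-hand side of
    \<open>airy_inequality\<close> is zero.\<close>
  define P where "P = Psi 64 0 (-1)"
  have P: "P x y = 64 - x\<^sup>2 - y\<^sup>2" for x y
    by (simp add: P_def Psi_def)
  define V where "V = (\<lambda>x y. max 0 (1 - x\<^sup>2 - B * y + N * y\<^sup>2) ^ 3)"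
  define Q where "Q = (\<lambda>x y. (1 - k) * (real (n + 3) * max 0 (P x y) ^ (n + 2) * ((2 * -1 * y - 0)\<^sup>2 + 4 * x\<^sup>2))
      + 2 * (-1 - 1 - \<bar>-1 + 1\<bar> * k) * max 0 (P x y) ^ (n + 3))"
  have le: "rect 8 (\<lambda>x y. Q x y * W x y) \<le> 2 * 0 * integral {-8..8} (\<lambda>x. max 0 (64 - x\<^sup>2) ^ (n + 3) *
      (Re (a (of_real x)) + Re (b (of_real x))))"
    unfolding Q_def W_def P_def
  proof (rule airy_inequality[OF f])
    fix x y :: real assume xy: "x \<in> {-8..8}" "y \<in> {0..8}" "\<bar>x\<bar> = 8 \<or> y = 8"
    then have "\<bar>x\<bar>\<^sup>2 = 8\<^sup>2 \<or> y\<^sup>2 = 8\<^sup>2" by metis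
    then show "Psi 64 0 (- 1) x y \<le> 0"
      by (auto simp: Psi_def)
  qed simp
  have cP: "cont2 P" unfolding P_def by (rule Psi_cont2)
  have cQ: "cont2 Q" unfolding Q_def by (intro cont2_intros cP)
  have cV: "cont2 V" unfolding V_def by (intro cont2_intros)
  define F where "F = (\<lambda>x y. max 0 (P x y) ^ (n + 2))"
  have cF: "cont2 F" unfolding F_def by (intro cont2_intros cP)
  have "rect 8 (\<lambda>x y. 4 * (F x y * W x y) - 2176 * 64 ^ (n + 2) * (V x y * W x y)) \<le> rect 8 (\<lambda>x y. Q x y * W x y)"
  proof (rule rect_mono)
    fix x y :: real assume xy: "x \<in> {-8..8}" "y \<in> {0..8}"
    have P64: "max 0 (P x y) \<le> 64"
      by (simp add: P)
    have F: "0 \<le> F x y" "F x y \<le> 64 ^ (n + 2)"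
      unfolding F_def using P64 by (auto intro: power_mono simp del: power_Suc power_add)
    have V: "0 \<le> V x y" by (simp add: V_def)
    have Q: "Q x y = F x y * (4 * (1 - k) * (real n + 3) * (x\<^sup>2 + y\<^sup>2) - 4 * max 0 (P x y))"
      by (simp add: Q_def F_def eval_nat_numeral algebra_simps)
    have "4 * F x y - 2176 * 64 ^ (n + 2) * V x y \<le> Q x y"
    proof (cases "1 \<le> 16 * B\<^sup>2 * (x\<^sup>2 + y\<^sup>2)")
      case True
      \<comment> \<open>Away from the center a high power makes the gradient term win: by the choice
        of \<open>n\<close> it is at least \<open>4 * 65\<close>, against at most
        \<open>4 * 64\<close>.\<close>
      have "65 * 1 \<le> 65 * (16 * B\<^sup>2 * (x\<^sup>2 + y\<^sup>2))"
        using True by (intro mult_left_mono) auto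
      also have "\<dots> = 65 * 16 * B\<^sup>2 * (x\<^sup>2 + y\<^sup>2)" by simp
      also have "\<dots> \<le> (1 - k) * (real n + 3) * (x\<^sup>2 + y\<^sup>2)"
        using n by (intro mult_right_mono) (auto simp: B_def)
      finally have "4 \<le> 4 * (1 - k) * (real n + 3) * (x\<^sup>2 + y\<^sup>2) - 4 * max 0 (P x y)"
        using P64 by linarith
      then have "F x y * 4 \<le> Q x y"
        unfolding Q using F by (intro mult_left_mono)
      moreover have "0 \<le> 2176 * 64 ^ (n + 2) * V x y"
        using V by simp
      ultimately show ?thesis
        by linarith
    next
      case False
      have "1 * x\<^sup>2 \<le> B\<^sup>2 * x\<^sup>2"
        using B by (intro mult_right_mono) auto
      moreover have "16 * (B\<^sup>2 * x\<^sup>2) + 16 * (B\<^sup>2 * y\<^sup>2) < 1"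
        using False by (simp add: algebra_simps)
      moreover have "0 \<le> B\<^sup>2 * x\<^sup>2" "0 \<le> B\<^sup>2 * y\<^sup>2" by simp_all
      ultimately have x: "x\<^sup>2 \<le> 1 / 16" and "B\<^sup>2 * y\<^sup>2 \<le> 1 / 16"
        by linarith+
      then have "(B * y)\<^sup>2 \<le> (1 / 4)\<^sup>2"
        by (simp add: power_mult_distrib power_divide)
      then have y: "B * y \<le> 1 / 4"
        by (rule power2_le_imp_le) simp
      have "0 \<le> N * y\<^sup>2" using N by simp
      then have "1 / 2 \<le> 1 - x\<^sup>2 - B * y + N * y\<^sup>2"
        using x y by linarith
      then have "(1 / 2) ^ 3 \<le> V x y"
        unfolding V_def by (intro power_mono) auto
      then have V8: "1 \<le> 8 * V x y" by (simp add: power3_eq_cube)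
      have "0 \<le> 4 * (1 - k) * (real n + 3) * (x\<^sup>2 + y\<^sup>2)"
        using k by simp
      \<comment> \<open>Near the center the weight can be as low as \<open>- 256 * F x y\<close>,
        but there \<open>1 \<le> 8 * V x y\<close>, and a multiple of \<open>V\<close> compensates,
        since \<open>(256 + 4) * 8 \<le> 2176\<close>.\<close>
      then have "F x y * (- 256) \<le> Q x y"
        unfolding Q using F P64 by (intro mult_left_mono) auto
      moreover have "F x y * 1 \<le> 64 ^ (n + 2) * (8 * V x y)"
        using F V8 by (intro mult_mono) auto
      moreover have "64 ^ (n + 2) * (8 * V x y) = 8 * (64 ^ (n + 2) * V x y)" by simp
      moreover have "0 \<le> 64 ^ (n + 2) * V x y" using V by simp
      ultimately show ?thesis
        unfolding mult.assoc by linarith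
    qed
    then have "(4 * F x y - 2176 * 64 ^ (n + 2) * V x y) * W x y \<le> Q x y * W x y"
      by (intro mult_right_mono W)
    then show "4 * (F x y * W x y) - 2176 * 64 ^ (n + 2) * (V x y * W x y) \<le> Q x y * W x y"
      by (simp add: left_diff_distrib mult.assoc)
  qed (intro cont2_intros cF cV cQ W)+
  moreover have "rect 8 (\<lambda>x y. 4 * (F x y * W x y) - 2176 * 64 ^ (n + 2) * (V x y * W x y)) =
      4 * rect 8 (\<lambda>x y. F x y * W x y) - 2176 * 64 ^ (n + 2) * rect 8 (\<lambda>x y. V x y * W x y)"
  proof -
    have "cont2 (\<lambda>x y. 4 * (F x y * W x y))" "cont2 (\<lambda>x y. 2176 * 64 ^ (n + 2) * (V x y * W x y))"
      by (intro cont2_intros cF cV W)+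
    then show ?thesis
      by (simp only: rect_diff rect_cmult)
  qed
  moreover have "rect 4 W \<le> rect 8 (\<lambda>x y. F x y * W x y)"
  proof (rule rect_mono_subset)
    fix x y :: real assume "x \<in> {-4..4}" "y \<in> {0..4}"
    then have "\<bar>x\<bar> \<le> 4" "\<bar>y\<bar> \<le> 4" by auto
    then have "x\<^sup>2 \<le> 4\<^sup>2" "y\<^sup>2 \<le> 4\<^sup>2"
      using abs_le_square_iff[of x 4] abs_le_square_iff[of y 4] by auto
    then have "1 \<le> F x y"
      unfolding F_def P by (intro one_le_power) (auto simp: max_def)
    then show "W x y \<le> F x y * W x y"
      using W(2)[of x y] by (simp add: mult_le_cancel_right1)
  next
    show "0 \<le> F x y * W x y" for x y
      using W(2)[of x y] by (simp add: F_def)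
  qed (use W in \<open>auto intro!: cont2_intros cF\<close>)
  ultimately show ?thesis
    using le unfolding W_def V_def B_def by simp
qed

section \<open>The normalized Harnack inequality\<close>

lemma integral_symmetric_interval:
  fixes g :: "real \<Rightarrow> real"
  assumes "0 \<le> L" "continuous_on {-L..L} g"
  shows "integral {0..L} (\<lambda>y. g y + g (- y)) = integral {-L..L} g"
proof -
  have i: "g integrable_on {-L..L}" "g integrable_on {0..L}" "g integrable_on {-L..0}"
    using assms by (auto intro!: integrable_continuous_interval elim: continuous_on_subset)
  have "continuous_on {0..L} (\<lambda>y. g (- y))"
    by (rule continuous_on_compose2[OF assms(2)]) (auto intro!: continuous_intros)
  then have "(\<lambda>y. g (- y)) integrable_on {0..L}"
    by (rule integrable_continuous_interval)
  then have "integral {0..L} (\<lambda>y. g y + g (- y)) = integral {0..L} g + integral {0..L} (\<lambda>y. g (- y))"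
    using i by (intro integral_add)
  also have "integral {0..L} (\<lambda>y. g (- y)) = integral {-L..0} g"
    using Henstock_Kurzweil_Integration.integral_reflect_real[of 0 "-L" g] by simp
  finally show ?thesis
    using Henstock_Kurzweil_Integration.integral_combine[of "-L" 0 L g] i assms by simp
qed

text \<open>Both sides are the integral of \<open>w\<close> over the full square, folded along one
  axis or the other. Hence a quarter turn of the field leaves the area term unchanged.\<close>

lemma rect_transpose:
  assumes w: "cont2 w" and L: "0 \<le> L"
  shows "rect L (\<lambda>x y. w y x + w (- y) x) = rect L (\<lambda>x y. w x y + w x (- y))"
proof -
  have 1: "cont2 (\<lambda>x y. w y x + w (- y) x)"
    unfolding cont2_def by (intro continuous_intros cont2_compose[OF w])
  have 2: "cont2 (\<lambda>x y. w x y + w x (- y))"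
    unfolding cont2_def by (intro continuous_intros cont2_compose[OF w])
  have "continuous_on (cbox (- L, - L) (L, L)) (\<lambda>(x, y). w x y)"
    using w unfolding cont2_def case_prod_beta' by (rule continuous_on_subset) auto
  from integral_swap_continuous[OF this]
  have swap: "integral {-L..L} (\<lambda>x. integral {-L..L} (\<lambda>y. w x y)) = integral {-L..L} (\<lambda>x. integral {-L..L} (\<lambda>y. w y x))"
    by simp
  show ?thesis
    unfolding rect_iterated(1)[OF 1] rect_iterated(1)[OF 2]
    using integral_symmetric_interval[OF L cont2_slice(1)[OF w]]
      integral_symmetric_interval[OF L cont2_slice(2)[OF w]] swap by simp
qed

lemma axis_mono:
  assumes f: "smooth_reduced k f a b" and k: "k \<le> 1" and "s \<le> t"
  shows "Re (f (of_real s)) \<le> Re (f (of_real t))"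
  using smooth_reduced_axis[OF f k] \<open>s \<le> t\<close>
    integral_nonneg[of "\<lambda>x. Re (a (of_real x)) + Re (b (of_real x))" "{s..t}"]
  by (simp add: integrable_continuous_interval)

text \<open>The doubled and the perpendicular segment are both bounded by one area integral, the
  latter after a quarter turn; the area is bounded by the lens, and the lens by the axis from
  \<open>-1\<close> to \<open>1\<close>. In \<open>C\<close>, \<open>142\<close> is
  \<open>2 * 71\<close>.\<close>

lemma smooth_reduced_normalized_bound:
  assumes k: "0 \<le> k" "k < 1"
  shows "\<exists>C\<ge>1. \<forall>f a b. smooth_reduced k f a b \<longrightarrow>
    2 * (Re (f 2) - Re (f (- 2))) \<le> C * (Re (f 1) - Re (f (- 1))) \<and>
    Im (f \<i>) - Im (f (- \<i>)) \<le> C * (Re (f 1) - Re (f (- 1)))"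
proof -
  define N where "N = 3 / (1 - k)"
  obtain n where "65 * 16 * (8 * N + 1)\<^sup>2 / (1 - k) < real n"
    using reals_Archimedean2 by auto
  then have "65 * 16 * (8 * N + 1)\<^sup>2 < real n * (1 - k)"
    using k by (simp add: pos_divide_less_eq)
  also have "\<dots> \<le> (real n + 3) * (1 - k)"
    using k by (intro mult_right_mono) auto
  finally have n: "65 * 16 * (8 * N + 1)\<^sup>2 \<le> (1 - k) * (real n + 3)"
    by (simp add: mult.commute)
  define C where "C = 142 * (544 * 64 ^ (n + 2) * (8 * N + 1))"
  have N: "0 \<le> N" using k by (simp add: N_def)
  have "(1::real) \<le> 64 ^ (n + 2)"
    by (rule one_le_power) simp
  then have "1 * 1 \<le> 544 * 64 ^ (n + 2) * (8 * N + 1)"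
    using N by (intro mult_mono) auto
  then have "1 \<le> C" unfolding C_def by linarith
  moreover have "2 * (Re (f 2) - Re (f (- 2))) \<le> C * (Re (f 1) - Re (f (- 1))) \<and>
    Im (f \<i>) - Im (f (- \<i>)) \<le> C * (Re (f 1) - Re (f (- 1)))" if f: "smooth_reduced k f a b" for f a b
  proof -
    define A where "A = rect 4 (\<lambda>x y. Re (a (Complex x y)) + Re (a (Complex x (- y))))"
    have "A \<le> 544 * 64 ^ (n + 2) * ((8 * N + 1) * (Re (f 1) - Re (f (- 1))))"
      using area_le_lens[OF f k n[unfolded N_def]] lens_le_axis[OF f k]
      unfolding A_def N_def by (smt (verit) mult_left_mono zero_le_power)
    then have A: "142 * A \<le> C * (Re (f 1) - Re (f (- 1)))"
    proof -
      assume "A \<le> 544 * 64 ^ (n + 2) * ((8 * N + 1) * (Re (f 1) - Re (f (- 1))))"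
      then have "142 * A \<le> 142 * (544 * 64 ^ (n + 2) * ((8 * N + 1) * (Re (f 1) - Re (f (- 1)))))"
        by linarith
      then show ?thesis
        unfolding C_def mult.assoc .
    qed
    have A0: "0 \<le> A"
      unfolding A_def rect_def using smooth_reduced_area[OF f]
      by (intro integral_nonneg cont2_integrable)
    define h where "h = (\<lambda>z. f (0 + \<i> * z) / \<i>)"
    have h: "smooth_reduced k h (\<lambda>z. a (0 + \<i> * z)) (\<lambda>z. b (0 + \<i> * z) * (cnj \<i> / \<i>))"
      unfolding h_def by (rule smooth_reduced_similarity[OF f]) simp
    have C: "\<i> * Complex x y = Complex (- y) x" for x y
      by (simp add: complex_eq_iff)
    have "Re (h 2) - Re (h (- 2)) \<le> 71 * rect 4 (\<lambda>x y. Re (a (Complex (- y) x)) + Re (a (Complex y x)))"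
      using axis_le_area[OF h k] by (simp add: C)
    also have "rect 4 (\<lambda>x y. Re (a (Complex (- y) x)) + Re (a (Complex y x))) = A"
      unfolding A_def using f
      by (subst rect_transpose[symmetric, OF cont2_Complex(1)]) (auto simp: smooth_reduced_def add.commute)
    finally have "Re (h 2) - Re (h (- 2)) \<le> 71 * A" .
    moreover have "Re (h 1) \<le> Re (h 2)" "Re (h (- 2)) \<le> Re (h (- 1))"
      using axis_mono[OF h, of 1 2] axis_mono[OF h, of "-2" "-1"] k by auto
    moreover have "Re (h 1) = Im (f \<i>)" "Re (h (- 1)) = Im (f (- \<i>))"
      by (simp_all add: h_def Re_divide)
    ultimately have "Im (f \<i>) - Im (f (- \<i>)) \<le> 142 * A"
      using A0 by linarith
    moreover have "2 * (Re (f 2) - Re (f (- 2))) \<le> 142 * A"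
      using mult_left_mono[OF axis_le_area[OF f k, folded A_def], of 2] by simp
    ultimately show ?thesis
      using A by (auto intro: order_trans)
  qed
  ultimately show ?thesis
    by blast
qed

text \<open>The similarity \<open>c + e * z\<close> reduces every segment to the normalized one. All
  strains are multiplied by the same \<open>(cmod e)\<^sup>2\<close>, so the constant is
  unchanged.\<close>

lemma smooth_reduced_doubling:
  assumes k: "0 \<le> k" "k < 1"
  shows "\<exists>C\<ge>1. \<forall>f a b. smooth_reduced k f a b \<longrightarrow> doubling_strain C f"
proof -
  obtain C where C1: "1 \<le> C" and C: "\<And>f a b. smooth_reduced k f a b \<Longrightarrow>
    2 * (Re (f 2) - Re (f (- 2))) \<le> C * (Re (f 1) - Re (f (- 1))) \<and>
    Im (f \<i>) - Im (f (- \<i>)) \<le> C * (Re (f 1) - Re (f (- 1)))"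
    using smooth_reduced_normalized_bound[OF k] by metis
  have "doubling_strain C f" if f: "smooth_reduced k f a b" for f a b
    unfolding doubling_strain_def
  proof (intro allI)
    fix c e :: complex
    show "0 \<le> strain f c e \<and> strain f c (2 * e) \<le> C * strain f c e \<and> strain f c (\<i> * e) \<le> C * strain f c e"
    proof (cases "e = 0")
      case False
      define g where "g = (\<lambda>z. f (c + e * z) / e)"
      have g: "smooth_reduced k g (\<lambda>z. a (c + e * z)) (\<lambda>z. b (c + e * z) * (cnj e / e))"
        unfolding g_def by (rule smooth_reduced_similarity[OF f False])
      have s: "strain f c (v * e) = (cmod e)\<^sup>2 * ((g v - g (- v)) \<bullet> v)" for v
      proof -
        have "f (c + v * e) - f (c - v * e) = e * (g v - g (- v))"
          using False by (simp add: g_def algebra_simps)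
        then have "strain f c (v * e) = (e * (g v - g (- v))) \<bullet> (e * v)"
          by (simp add: strain_def mult.commute)
        also have "\<dots> = (cmod e)\<^sup>2 * ((g v - g (- v)) \<bullet> v)"
          unfolding cmod_power2 by (simp add: inner_complex_def power2_eq_square algebra_simps)
        finally show ?thesis .
      qed
      have "0 \<le> (g 1 - g (- 1)) \<bullet> 1" "(g 2 - g (- 2)) \<bullet> 2 \<le> C * ((g 1 - g (- 1)) \<bullet> 1)"
        "(g \<i> - g (- \<i>)) \<bullet> \<i> \<le> C * ((g 1 - g (- 1)) \<bullet> 1)"
        using C[OF g] axis_mono[OF g, of "-1" 1] k by (simp_all add: inner_complex_def)
      then show ?thesis
        using s[of 1] s[of 2] s[of \<i>] by (simp add: mult_left_mono mult.left_commute[of C])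
    qed (simp add: strain_def)
  qed
  then show ?thesis
    using C1 by blast
qed

section \<open>Mollification\<close>

text \<open>The standard smooth function that is flat at \<open>0\<close>; the powers in the
  denominator make the linear span of the family closed under differentiation.\<close>

definition flat :: "nat \<Rightarrow> real \<Rightarrow> real" where
  "flat m s = (if s \<le> 0 then 0 else exp (- (1 / s)) / s ^ m)"

lemma flat_nonneg: "0 \<le> flat m s"
  by (simp add: flat_def)

lemma flat_has_real_derivative:
  "(flat m has_real_derivative flat (m + 2) s - m * flat (m + 1) s) (at s)"
proof -
  consider "0 < s" | "s < 0" | "s = 0" by linarith
  then show ?thesis
  proof cases
    case 1
    have "((\<lambda>s. exp (- (1 / s)) / s ^ m) has_real_derivative
        (exp (- (1 / s)) * (1 / (s * s)) * s ^ m - exp (- (1 / s)) * (m * s ^ (m - 1))) / (s ^ m * s ^ m)) (at s)"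
      using 1 by (auto intro!: derivative_eq_intros)
    also have "(exp (- (1 / s)) * (1 / (s * s)) * s ^ m - exp (- (1 / s)) * (m * s ^ (m - 1))) / (s ^ m * s ^ m)
        = flat (m + 2) s - m * flat (m + 1) s"
      using 1 by (cases m) (simp_all add: flat_def field_simps)
    finally show ?thesis
      by (rule has_field_derivative_transform_within_open[where S = "{0<..}"]) (use 1 in \<open>auto simp: flat_def\<close>)
  next
    case 2
    have "((\<lambda>s. 0) has_real_derivative 0) (at s)" by simp
    then have "(flat m has_real_derivative 0) (at s)"
      by (rule has_field_derivative_transform_within_open[where S = "{..<0}"]) (use 2 in \<open>auto simp: flat_def\<close>)
    with 2 show ?thesis by (simp add: flat_def)
  next
    case 3
    have "((\<lambda>h. flat m h / h) \<longlongrightarrow> 0) (at_right 0)"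
    proof (rule tendsto_cong[THEN iffD1])
      show "((\<lambda>h::real. inverse h ^ (m + 1) / exp (inverse h)) \<longlongrightarrow> 0) (at_right 0)"
        using filterlim_compose[OF tendsto_power_div_exp_0 filterlim_inverse_at_top_right] .
      show "\<forall>\<^sub>F h in at_right 0. inverse h ^ (m + 1) / exp (inverse h) = flat m h / h"
        using eventually_at_right_less[of 0]
        by eventually_elim (simp add: flat_def exp_minus field_simps)
    qed
    moreover have "((\<lambda>h. flat m h / h) \<longlongrightarrow> 0) (at_left 0)"
    proof (rule tendsto_cong[THEN iffD1, OF _ tendsto_const])
      show "\<forall>\<^sub>F h in at_left 0. 0 = flat m h / h"
        by (simp add: eventually_at_filter flat_def)
    qed
    ultimately have "((\<lambda>h. flat m h / h) \<longlongrightarrow> 0) (at 0)"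
      by (simp add: filterlim_at_split)
    with 3 show ?thesis
      by (simp add: DERIV_def flat_def)
  qed
qed

lemma continuous_on_flat [continuous_intros]:
  "continuous_on S g \<Longrightarrow> continuous_on S (\<lambda>x. flat m (g x))"
  using continuous_on_compose2[of UNIV "flat m" S g] DERIV_isCont[OF flat_has_real_derivative]
  by (simp add: continuous_at_imp_continuous_on)

lemma flat_compose_has_derivative:
  assumes "(g has_derivative g') (at x)"
  shows "((\<lambda>x. flat m (g x)) has_derivative (\<lambda>h. g' h * (flat (m + 2) (g x) - m * flat (m + 1) (g x)))) (at x)"
  using has_derivative_compose[OF assms flat_has_real_derivative[of m "g x", unfolded has_field_derivative_def]]
  by (simp add: mult.commute)

text \<open>A class of functions that contains \<open>\<lambda>w. flat 0 (e\<^sup>2 - (cmod (w - z))\<^sup>2)\<close> and is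
  closed under directional derivatives.\<close>

inductive bump_span :: "complex \<Rightarrow> real \<Rightarrow> (complex \<Rightarrow> real) \<Rightarrow> bool" for z e where
  base: "bump_span z e (\<lambda>w. c * (Re (w - z) ^ i * Im (w - z) ^ j) * flat m (e\<^sup>2 - (cmod (w - z))\<^sup>2))"
| add: "bump_span z e F \<Longrightarrow> bump_span z e G \<Longrightarrow> bump_span z e (\<lambda>w. F w + G w)"

lemma cmod_diff_square_has_derivative:
  "((\<lambda>w. e\<^sup>2 - (cmod (w - z))\<^sup>2) has_derivative (\<lambda>v. - 2 * ((w - z) \<bullet> v))) (at w)"
proof -
  have "((\<lambda>w. (w - z) \<bullet> (w - z)) has_derivative (\<lambda>v. (w - z) \<bullet> v + v \<bullet> (w - z))) (at w)"
    by (intro has_derivative_inner) (auto intro!: derivative_eq_intros)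
  then have "((\<lambda>w. (cmod (w - z))\<^sup>2) has_derivative (\<lambda>v. 2 * ((w - z) \<bullet> v))) (at w)"
    by (simp add: dot_square_norm inner_commute)
  from has_derivative_diff[OF has_derivative_const this]
  show ?thesis by simp
qed

lemma bump_span_derivative:
  assumes "bump_span z e F"
  shows "\<exists>F'. (\<forall>w. (F has_derivative F' w) (at w)) \<and> (\<forall>v. bump_span z e (\<lambda>w. F' w v))"
  using assms
proof induction
  case (base c i j m)
  define G where "G = (\<lambda>k w. flat k (e\<^sup>2 - (cmod (w - z))\<^sup>2))"
  define F' where "F' = (\<lambda>w v.
      c * real i * Re v * (Re (w - z) ^ (i - 1) * Im (w - z) ^ j) * G m w +
      (c * real j * Im v * (Re (w - z) ^ i * Im (w - z) ^ (j - 1)) * G m w +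
      ((- 2 * c * Re v) * (Re (w - z) ^ (i + 1) * Im (w - z) ^ j) * G (m + 2) w +
      ((- 2 * c * Im v) * (Re (w - z) ^ i * Im (w - z) ^ (j + 1)) * G (m + 2) w +
      ((2 * c * m * Re v) * (Re (w - z) ^ (i + 1) * Im (w - z) ^ j) * G (m + 1) w +
      (2 * c * m * Im v) * (Re (w - z) ^ i * Im (w - z) ^ (j + 1)) * G (m + 1) w)))))"
  have "((\<lambda>w. c * (Re (w - z) ^ i * Im (w - z) ^ j) * G m w) has_derivative F' w) (at w)" for w
  proof -
    have "(G m has_derivative (\<lambda>v. - 2 * ((w - z) \<bullet> v) * (G (m + 2) w - m * G (m + 1) w))) (at w)"
      unfolding G_def by (rule flat_compose_has_derivative cmod_diff_square_has_derivative)+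
    moreover have "((\<lambda>w. Re (w - z) ^ i) has_derivative (\<lambda>v. real i * Re (w - z) ^ (i - 1) * Re v)) (at w)"
      "((\<lambda>w. Im (w - z) ^ j) has_derivative (\<lambda>v. real j * Im (w - z) ^ (j - 1) * Im v)) (at w)"
      by (auto intro!: derivative_eq_intros bounded_linear.has_derivative[OF bounded_linear_Re]
          bounded_linear.has_derivative[OF bounded_linear_Im])
    ultimately show ?thesis
      unfolding F'_def by (auto intro!: derivative_eq_intros simp: inner_complex_def algebra_simps)
  qed
  moreover have "bump_span z e (\<lambda>w. F' w v)" for v
    unfolding F'_def G_def by (intro bump_span.intros)
  ultimately show ?case
    unfolding G_def by blast
next
  case (add F G)
  then obtain F' G' where "\<forall>w. (F has_derivative F' w) (at w)" "\<forall>v. bump_span z e (\<lambda>w. F' w v)"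
    "\<forall>w. (G has_derivative G' w) (at w)" "\<forall>v. bump_span z e (\<lambda>w. G' w v)"
    by blast
  then show ?case
    by (intro exI[of _ "\<lambda>w v. F' w v + G' w v"]) (auto intro: has_derivative_add bump_span.add)
qed

lemma bump_span_Ck: "bump_span z e F \<Longrightarrow> Ck k F"
proof (induction k arbitrary: F)
  case 0
  then obtain F' where "\<forall>w. (F has_derivative F' w) (at w)"
    using bump_span_derivative by blast
  then show ?case
    by (auto intro: continuous_at_imp_continuous_on has_derivative_continuous)
next
  case (Suc k)
  obtain F' where F': "\<And>w. (F has_derivative F' w) (at w)" "\<And>v. bump_span z e (\<lambda>w. F' w v)"
    using bump_span_derivative[OF Suc.prems] by blast
  have "frechet_derivative F (at w) = F' w" for w
    using frechet_derivative_at[OF F'(1)] by simp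
  moreover have "F differentiable_on UNIV"
    using F'(1) by (auto simp: differentiable_on_def differentiable_def)
  ultimately show ?case
    using Suc.IH F'(2) by simp
qed

lemma bump_span_support:
  "bump_span z e F \<Longrightarrow> 0 \<le> e \<Longrightarrow> F w \<noteq> 0 \<Longrightarrow> w \<in> cball z e"
proof (induction rule: bump_span.induct)
  case (base c i j m)
  then have "flat m (e\<^sup>2 - (cmod (w - z))\<^sup>2) \<noteq> 0"
    by simp
  then have "(cmod (w - z))\<^sup>2 \<le> e\<^sup>2"
    unfolding flat_def by (metis diff_gt_0_iff_gt less_eq_real_def linorder_not_le)
  then have "cmod (w - z) \<le> e"
    using base.prems(1) by (rule power2_le_imp_le)
  then show ?case
    by (simp add: dist_norm norm_minus_commute)
next
  case (add F G)
  then show ?case by (cases "F w = 0") auto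
qed

lemma bump_span_test_function:
  assumes "bump_span z e F" "0 \<le> e"
  shows "test_function F"
proof -
  have "{w. F w \<noteq> 0} \<subseteq> cball z e"
    using bump_span_support[OF assms] by blast
  then have "bounded {w. F w \<noteq> 0}"
    using bounded_subset bounded_cball by blast
  then show ?thesis
    using bump_span_Ck[OF assms(1)] by (simp add: test_function_def compact_closure)
qed

section \<open>Mollified fields\<close>

definition bump :: "real \<Rightarrow> complex \<Rightarrow> complex \<Rightarrow> real" where
  "bump e z w = flat 0 (e\<^sup>2 - (cmod (w - z))\<^sup>2)"

text \<open>The derivative in direction \<open>v\<close> with respect to the center
  \<open>z\<close>, which is minus the one with respect to \<open>w\<close>. This sign cancels the
  one in \<open>weak_derivative\<close>.\<close>

definition bump' :: "real \<Rightarrow> complex \<Rightarrow> complex \<Rightarrow> complex \<Rightarrow> real" where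
  "bump' e v z w = 2 * flat 2 (e\<^sup>2 - (cmod (w - z))\<^sup>2) * ((w - z) \<bullet> v)"

lemma bump_span_bump: "bump_span z e (bump e z)"
  using bump_span.base[of z e 1 0 0 0] unfolding bump_def[abs_def] by simp

lemma bump_has_derivative:
  "(bump e z has_derivative (\<lambda>v. - bump' e v z w)) (at w)"
  using flat_compose_has_derivative[OF cmod_diff_square_has_derivative[of e z w], of 0]
  unfolding bump_def[abs_def] bump'_def by (simp add: mult_ac numeral_2_eq_2)

lemma bump_nonneg: "0 \<le> bump e z w"
  by (simp add: bump_def flat_nonneg)

lemma bump_outside: "0 \<le> e \<Longrightarrow> e < cmod (w - z) \<Longrightarrow> bump e z w = 0 \<and> bump' e v z w = 0"
  by (simp add: bump_def bump'_def flat_def power_mono)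

lemma continuous_on_bump [continuous_intros]:
  "continuous_on S g \<Longrightarrow> continuous_on S h \<Longrightarrow> continuous_on S (\<lambda>x. bump e (g x) (h x))"
  "continuous_on S g \<Longrightarrow> continuous_on S h \<Longrightarrow> continuous_on S (\<lambda>x. bump' e v (g x) (h x))"
  unfolding bump_def bump'_def by (intro continuous_intros; assumption)+

lemma lborel_integral_compact_support:
  fixes h :: "complex \<Rightarrow> complex"
  assumes "continuous_on UNIV h" "\<And>w. w \<notin> cbox a b \<Longrightarrow> h w = 0"
  shows "integrable lborel h" "(\<integral>w. h w \<partial>lborel) = integral (cbox a b) h"
proof -
  have "continuous_on (cbox a b) h"
    using assms(1) continuous_on_subset by blast
  then have i: "set_integrable lborel (cbox a b) h"
    unfolding set_integrable_def by (intro borel_integrable_compact compact_cbox)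
  have eq: "(\<lambda>w. indicator (cbox a b) w *\<^sub>R h w) = h"
    using assms(2) by (auto simp: indicator_def)
  show "integrable lborel h"
    using i unfolding set_integrable_def eq .
  show "(\<integral>w. h w \<partial>lborel) = integral (cbox a b) h"
    using set_borel_integral_eq_integral(2)[OF i] unfolding set_lebesgue_integral_def eq .
qed

definition square :: "complex \<Rightarrow> real \<Rightarrow> complex set" where
  "square z D = cbox (z - Complex D D) (z + Complex D D)"

lemma in_square_if: "cmod (w - z) \<le> D \<Longrightarrow> w \<in> square z D"
  using abs_Re_le_cmod[of "w - z"] abs_Im_le_cmod[of "w - z"]
  by (auto simp: square_def in_cbox_complex_iff abs_le_iff)

text \<open>Not divided by the mass of the bump: the cone and the doubling inequalities are
  invariant under positive factors, so normalization can wait until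
  \<open>mollify_pointwise_limit\<close>.\<close>

definition mollify :: "real \<Rightarrow> (complex \<Rightarrow> complex) \<Rightarrow> complex \<Rightarrow> complex" where
  "mollify e h z = (\<integral>w. bump e z w *\<^sub>R h w \<partial>lborel)"

lemma bump_zero_outside_square:
  assumes "0 \<le> e" "cmod (z - z0) + e \<le> D" "w \<notin> square z0 D"
  shows "bump e z w = 0" "bump' e v z w = 0"
proof -
  have "D < cmod (w - z0)"
    using in_square_if[of w z0 D] assms(3) by (meson not_le)
  also have "\<dots> \<le> cmod (w - z) + cmod (z - z0)"
    using norm_triangle_ineq[of "w - z" "z - z0"] by simp
  finally have "e < cmod (w - z)"
    using assms(2) by simp
  then show "bump e z w = 0" "bump' e v z w = 0"
    using bump_outside[OF assms(1)] by blast+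
qed

lemma bump_line_has_derivative:
  "((\<lambda>t. bump e (z + of_real t * v) w) has_real_derivative bump' e v (z + of_real t * v) w) (at t)"
proof -
  have eq: "bump e (z + of_real t * v) w = bump e z (w - of_real t * v)" for t
    by (simp add: bump_def algebra_simps)
  have "((\<lambda>t. w - of_real t * v) has_derivative (\<lambda>h. - (of_real h * v))) (at t)"
    by (auto intro!: derivative_eq_intros)
  from has_derivative_compose[OF this bump_has_derivative]
  have "((\<lambda>t. bump e z (w - of_real t * v)) has_derivative (\<lambda>h. - bump' e (- (of_real h * v)) z (w - of_real t * v))) (at t)" .
  moreover have "- bump' e (- (of_real h * v)) z (w - of_real t * v) = bump' e v (z + of_real t * v) w * h" for h
  proof -
    have "of_real h * v = h *\<^sub>R v"
      by (simp add: scaleR_conv_of_real)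
    then show ?thesis
      by (simp add: bump'_def algebra_simps)
  qed
  ultimately show ?thesis
    unfolding eq has_field_derivative_def by simp
qed

lemma mollify_has_vector_derivative:
  assumes e: "0 \<le> e" and f: "continuous_on UNIV f"
  shows "((\<lambda>t. mollify e f (z + of_real t * v)) has_vector_derivative
    (\<integral>w. bump' e v z w *\<^sub>R f w \<partial>lborel)) (at 0)"
proof -
  \<comment> \<open>For \<open>t\<close> in \<open>{-1..1}\<close> all bumps are supported in one
    square of half side \<open>D\<close>, so that differentiation under the integral takes place
    over a fixed compact set.\<close>
  define D where "D = cmod v + e"
  define a where "a = z - Complex D D"
  define b where "b = z + Complex D D"
  have Q: "square z D = cbox a b"
    by (simp add: square_def a_def b_def)
  have cf: "continuous_on S (\<lambda>x. f (g x))" if "continuous_on S g" for S and g :: "real \<times> complex \<Rightarrow> complex"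
    using continuous_on_compose2[OF f that] by simp
  have cf': "continuous_on S (\<lambda>x. bump e z' x *\<^sub>R f x)" "continuous_on S (\<lambda>x. bump' e v z' x *\<^sub>R f x)" for S z'
    by (intro continuous_intros continuous_on_subset[OF f]; simp)+
  have D: "cmod (z + of_real t * v - z) + e \<le> D" if "t \<in> {-1..1}" for t
    using that by (auto simp: D_def norm_mult abs_le_iff intro!: mult_left_le_one_le)
  have eq: "mollify e f (z + of_real t * v) = integral (cbox a b) (\<lambda>w. bump e (z + of_real t * v) w *\<^sub>R f w)"
    if "t \<in> {-1..1}" for t
    unfolding mollify_def using bump_zero_outside_square(1)[OF e D[OF that]] cf'
    by (intro lborel_integral_compact_support) (auto simp: Q)
  have eq0: "(\<integral>w. bump' e v z w *\<^sub>R f w \<partial>lborel) = integral (cbox a b) (\<lambda>w. bump' e v (z + of_real 0 * v) w *\<^sub>R f w)"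
    using bump_zero_outside_square(2)[OF e D[of 0]] cf'
    by (subst lborel_integral_compact_support) (auto simp: Q)
  have "((\<lambda>t. integral (cbox a b) (\<lambda>w. bump e (z + of_real t * v) w *\<^sub>R f w)) has_vector_derivative
      integral (cbox a b) (\<lambda>w. bump' e v (z + of_real 0 * v) w *\<^sub>R f w)) (at 0 within {-1..1})"
  proof (rule leibniz_rule_vector_derivative)
    fix t w
    have "((\<lambda>t. bump e (z + of_real t * v) w) has_vector_derivative bump' e v (z + of_real t * v) w) (at t within {-1..1})"
      using bump_line_has_derivative[of e z v w t]
      by (simp add: has_real_derivative_iff_has_vector_derivative has_vector_derivative_at_within)
    then show "((\<lambda>t. bump e (z + of_real t * v) w *\<^sub>R f w) has_vector_derivative
        bump' e v (z + of_real t * v) w *\<^sub>R f w) (at t within {-1..1})"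
      by (rule bounded_linear.has_vector_derivative[OF bounded_linear_scaleR_left])
  next
    show "(\<lambda>w. bump e (z + of_real t * v) w *\<^sub>R f w) integrable_on cbox a b" for t
      by (intro integrable_continuous cf')
  next
    show "continuous_on ({-1..1} \<times> cbox a b) (\<lambda>(t, w). bump' e v (z + of_real t * v) w *\<^sub>R f w)"
      unfolding case_prod_beta' by (intro continuous_intros cf)
  qed auto
  then have "((\<lambda>t. integral (cbox a b) (\<lambda>w. bump e (z + of_real t * v) w *\<^sub>R f w)) has_vector_derivative
      (\<integral>w. bump' e v z w *\<^sub>R f w \<partial>lborel)) (at 0)"
    unfolding eq0 by (simp add: at_within_interior[of 0 "{-1..1}"])
  then show ?thesis
    by (rule has_vector_derivative_transform_within_open[where S = "{-1<..<1}"]) (auto simp: eq)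
qed

lemma continuous_on_kernel_integral:
  fixes K :: "complex \<Rightarrow> complex \<Rightarrow> real" and f :: "complex \<Rightarrow> complex"
  assumes f: "continuous_on UNIV f" and K: "continuous_on UNIV (\<lambda>p. K (fst p) (snd p))"
    and out: "\<And>z w. e < cmod (w - z) \<Longrightarrow> K z w = 0"
  shows "continuous_on UNIV (\<lambda>z. \<integral>w. K z w *\<^sub>R f w \<partial>lborel)"
proof (rule continuous_at_imp_continuous_on, rule ballI)
  fix z0
  define a where "a = z0 - Complex (1 + e) (1 + e)"
  define b where "b = z0 + Complex (1 + e) (1 + e)"
  have Kf: "continuous_on UNIV (\<lambda>p. K (fst p) (snd p) *\<^sub>R f (snd p))"
    by (intro continuous_intros K continuous_on_compose2[OF f]) auto
  have Kz: "continuous_on UNIV (\<lambda>w. K z w *\<^sub>R f w)" for z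
  proof -
    have "continuous_on UNIV (\<lambda>w. (\<lambda>p. K (fst p) (snd p) *\<^sub>R f (snd p)) (z, w))"
      by (rule continuous_on_compose2[OF Kf]) (auto intro!: continuous_intros)
    then show ?thesis by simp
  qed
  have c: "continuous_on (ball z0 1) (\<lambda>z. integral (cbox a b) (\<lambda>w. K z w *\<^sub>R f w))"
    by (rule integral_continuous_on_param) (use continuous_on_subset[OF Kf] in \<open>auto simp: case_prod_beta'\<close>)
  have eq: "(\<integral>w. K z w *\<^sub>R f w \<partial>lborel) = integral (cbox a b) (\<lambda>w. K z w *\<^sub>R f w)"
    if z: "z \<in> ball z0 1" for z
  proof (rule lborel_integral_compact_support(2)[OF Kz])
    fix w assume "w \<notin> cbox a b"
    then have "1 + e < cmod (w - z0)"
      using in_square_if[of w z0 "1 + e"] unfolding square_def a_def b_def by (meson not_le)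
    then have "e < cmod (w - z)"
      using z norm_triangle_ineq[of "w - z" "z - z0"] by (simp add: dist_norm norm_minus_commute)
    then show "K z w *\<^sub>R f w = 0"
      by (simp add: out)
  qed
  have "continuous_on (ball z0 1) (\<lambda>z. \<integral>w. K z w *\<^sub>R f w \<partial>lborel)"
    by (rule continuous_on_eq[OF c]) (rule eq[symmetric])
  then show "isCont (\<lambda>z. \<integral>w. K z w *\<^sub>R f w \<partial>lborel) z0"
    by (simp add: continuous_on_eq_continuous_at)
qed

lemma continuous_on_bump_integral:
  assumes e: "0 \<le> e" and f: "continuous_on UNIV f"
  shows "continuous_on UNIV (mollify e f)"
    and "continuous_on UNIV (\<lambda>z. \<integral>w. bump' e v z w *\<^sub>R f w \<partial>lborel)"
  using bump_outside[OF e] unfolding mollify_def[abs_def]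
  by (auto intro!: continuous_on_kernel_integral[OF f, where e = e] continuous_intros)

text \<open>The bump is at most \<open>1\<close> and vanishes off a disc, and
  \<open>u \<le> u\<^sup>2 + 1\<close> with \<open>u = cmod (g w)\<close> gives an integrable
  majorant.\<close>

lemma L2_loc_bump_integrable:
  assumes "L2_loc g" "0 \<le> e"
  shows "integrable lborel (\<lambda>w. bump e z w *\<^sub>R g w)"
proof (rule Bochner_Integration.integrable_bound)
  have g: "g \<in> borel_measurable borel"
    using assms by (simp add: L2_loc_def)
  have "set_integrable lborel (cball z e) (\<lambda>w. (cmod (g w))\<^sup>2)"
    using assms by (auto simp: L2_loc_def)
  moreover have "set_integrable lborel (cball z e) (\<lambda>w. 1 :: real)"
    unfolding set_integrable_def by (intro borel_integrable_compact) auto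
  ultimately show "integrable lborel (\<lambda>w. indicator (cball z e) w *\<^sub>R (cmod (g w))\<^sup>2 + indicator (cball z e) w *\<^sub>R (1 :: real))"
    unfolding set_integrable_def by (rule Bochner_Integration.integrable_add)
  have "bump e z \<in> borel_measurable borel"
    using continuous_on_bump(1)[of UNIV "\<lambda>_. z" "\<lambda>w. w" e] by (intro borel_measurable_continuous_onI) simp
  then show "(\<lambda>w. bump e z w *\<^sub>R g w) \<in> borel_measurable lborel"
    using g by simp
  have "cmod (bump e z w *\<^sub>R g w) \<le> indicator (cball z e) w *\<^sub>R (cmod (g w))\<^sup>2 + indicator (cball z e) w *\<^sub>R (1 :: real)" for w
  proof (cases "w \<in> cball z e")
    case True
    have "bump e z w \<le> 1"
      by (simp add: bump_def flat_def)
    then have "cmod (bump e z w *\<^sub>R g w) \<le> cmod (g w)"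
      using bump_nonneg[of e z w] by (simp add: mult_left_le_one_le)
    also have "\<dots> \<le> (cmod (g w))\<^sup>2 + 1"
      using zero_le_power2[of "cmod (g w) - 1"] norm_ge_zero[of "g w"]
      unfolding power2_diff one_power2 mult_1_right by linarith
    finally show ?thesis
      using True by simp
  next
    case False
    then show ?thesis
      using bump_outside[OF assms(2), of w z] by (simp add: dist_norm norm_minus_commute)
  qed
  then show "AE w in lborel. norm (bump e z w *\<^sub>R g w) \<le> norm (indicator (cball z e) w *\<^sub>R (cmod (g w))\<^sup>2 + indicator (cball z e) w *\<^sub>R (1 :: real))"
    by (intro AE_I2) (auto intro: order_trans)
qed

lemma weak_derivative_mollify:
  assumes "weak_derivative v f g" "0 \<le> e"
  shows "(\<integral>w. bump' e v z w *\<^sub>R f w \<partial>lborel) = mollify e g z"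
proof -
  have "frechet_derivative (bump e z) (at w) = (\<lambda>v. - bump' e v z w)" for w
    using frechet_derivative_at[OF bump_has_derivative] by simp
  moreover have "test_function (bump e z)"
    using bump_span_test_function[OF bump_span_bump assms(2)] .
  ultimately show ?thesis
    using assms(1) unfolding weak_derivative_def mollify_def by fastforce
qed

text \<open>The admissible pairs of Wirtinger derivatives form the same convex cone at every point,
  and mollification integrates them against nonnegative weights.\<close>

lemma mollify_smooth_reduced:
  assumes f: "continuous_on UNIV f" and W: "W12_loc_partials f fx fy" and e: "0 \<le> e"
    and cone: "AE z in lborel. 0 \<le> Re (wirtinger (fx z) (fy z)) \<and>
      cmod (wirtinger_bar (fx z) (fy z)) \<le> k * Re (wirtinger (fx z) (fy z))"
  shows "smooth_reduced k (mollify e f) (\<lambda>z. wirtinger (mollify e fx z) (mollify e fy z))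
    (\<lambda>z. wirtinger_bar (mollify e fx z) (mollify e fy z))"
  unfolding smooth_reduced_def
proof (intro conjI allI)
  have L2: "L2_loc f" "L2_loc fx" "L2_loc fy" and wd: "weak_derivative 1 f fx" "weak_derivative \<i> f fy"
    using W by (auto simp: W12_loc_partials_def)
  have ix: "integrable lborel (\<lambda>w. bump e z w *\<^sub>R fx w)" and iy: "integrable lborel (\<lambda>w. bump e z w *\<^sub>R fy w)" for z
    using L2_loc_bump_integrable L2 e by blast+
  \<comment> \<open>The mollified weak derivatives equal integrals of the continuous
    \<open>f\<close> against \<open>bump'\<close>, and these are continuous.\<close>
  have cx: "continuous_on UNIV (mollify e fx)" and cy: "continuous_on UNIV (mollify e fy)"
    using continuous_on_bump_integral(2)[OF e f, of 1] continuous_on_bump_integral(2)[OF e f, of \<i>]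
    by (simp_all add: weak_derivative_mollify[OF wd(1) e] weak_derivative_mollify[OF wd(2) e])
  show "continuous_on UNIV (\<lambda>z. wirtinger (mollify e fx z) (mollify e fy z))"
    "continuous_on UNIV (\<lambda>z. wirtinger_bar (mollify e fx z) (mollify e fy z))"
    unfolding wirtinger_def wirtinger_bar_def by (intro continuous_intros cx cy; simp)+
  show "continuous_on UNIV (mollify e f)"
    by (rule continuous_on_bump_integral(1)[OF e f])
  show "((\<lambda>t. mollify e f (z + of_real t * v)) has_vector_derivative
      wirtinger (mollify e fx z) (mollify e fy z) * v + wirtinger_bar (mollify e fx z) (mollify e fy z) * cnj v) (at 0)" for z v
  proof -
    have i: "integrable lborel (\<lambda>w. bump' e v z w *\<^sub>R f w)" for v
    proof (rule lborel_integral_compact_support(1))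
      show "continuous_on UNIV (\<lambda>w. bump' e v z w *\<^sub>R f w)"
        by (intro continuous_intros f)
      show "bump' e v z w *\<^sub>R f w = 0" if "w \<notin> cbox (z - Complex e e) (z + Complex e e)" for w
        using bump_zero_outside_square(2)[of e z z e w] that e by (simp add: square_def)
    qed
    have "bump' e v z w *\<^sub>R f w = Re v *\<^sub>R (bump' e 1 z w *\<^sub>R f w) + Im v *\<^sub>R (bump' e \<i> z w *\<^sub>R f w)" for w
      by (simp add: bump'_def inner_complex_def algebra_simps scaleR_conv_of_real)
    then have "(\<integral>w. bump' e v z w *\<^sub>R f w \<partial>lborel) = Re v *\<^sub>R mollify e fx z + Im v *\<^sub>R mollify e fy z"
      using i by (simp add: weak_derivative_mollify[OF wd(1) e] weak_derivative_mollify[OF wd(2) e] del: scaleR_scaleR)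
    also have "\<dots> = wirtinger (mollify e fx z) (mollify e fy z) * v + wirtinger_bar (mollify e fx z) (mollify e fy z) * cnj v"
      by (simp add: wirtinger_def wirtinger_bar_def complex_eq_iff field_simps)
    finally show ?thesis
      using mollify_has_vector_derivative[OF e f, of z v] by simp
  qed
  fix z
  define A where "A = (\<lambda>w. wirtinger (fx w) (fy w))"
  define B where "B = (\<lambda>w. wirtinger_bar (fx w) (fy w))"
  have eA: "bump e z w *\<^sub>R A w = (bump e z w *\<^sub>R fx w - \<i> * (bump e z w *\<^sub>R fy w)) / 2"
    and eB: "bump e z w *\<^sub>R B w = (bump e z w *\<^sub>R fx w + \<i> * (bump e z w *\<^sub>R fy w)) / 2" for w
    by (simp_all add: A_def B_def wirtinger_def wirtinger_bar_def scaleR_conv_of_real field_simps)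
  have iA: "integrable lborel (\<lambda>w. bump e z w *\<^sub>R A w)" and iB: "integrable lborel (\<lambda>w. bump e z w *\<^sub>R B w)"
    unfolding eA eB using ix iy by (auto simp del: mult_scaleR_right)
  have A: "wirtinger (mollify e fx z) (mollify e fy z) = (\<integral>w. bump e z w *\<^sub>R A w \<partial>lborel)"
    and B: "wirtinger_bar (mollify e fx z) (mollify e fy z) = (\<integral>w. bump e z w *\<^sub>R B w \<partial>lborel)"
    unfolding eA eB wirtinger_def wirtinger_bar_def mollify_def using ix iy by (simp_all del: mult_scaleR_right)
  have RA: "Re (\<integral>w. bump e z w *\<^sub>R A w \<partial>lborel) = (\<integral>w. bump e z w * Re (A w) \<partial>lborel)"
    using integral_Re[OF iA] by simp
  have iRA: "integrable lborel (\<lambda>w. bump e z w * Re (A w))"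
    using integrable_Re[OF iA] by simp
  show "0 \<le> Re (wirtinger (mollify e fx z) (mollify e fy z))"
    unfolding A RA using cone
    by (intro integral_nonneg_AE) (auto simp: A_def bump_nonneg)
  have "cmod (\<integral>w. bump e z w *\<^sub>R B w \<partial>lborel) \<le> (\<integral>w. cmod (bump e z w *\<^sub>R B w) \<partial>lborel)"
    by (rule integral_norm_bound)
  also have "\<dots> \<le> (\<integral>w. k * (bump e z w * Re (A w)) \<partial>lborel)"
  proof (rule integral_mono_AE)
    show "AE w in lborel. cmod (bump e z w *\<^sub>R B w) \<le> k * (bump e z w * Re (A w))"
      using cone by eventually_elim
        (auto simp: A_def B_def bump_nonneg mult_left_mono mult.left_commute[of k])
  next
    show "integrable lborel (\<lambda>w. cmod (bump e z w *\<^sub>R B w))"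
      by (rule integrable_norm[OF iB])
    show "integrable lborel (\<lambda>w. k * (bump e z w * Re (A w)))"
      by (intro integrable_mult_right iRA)
  qed
  also have "\<dots> = k * (\<integral>w. bump e z w * Re (A w) \<partial>lborel)"
    by simp
  finally show "cmod (wirtinger_bar (mollify e fx z) (mollify e fy z)) \<le> k * Re (wirtinger (mollify e fx z) (mollify e fy z))"
    unfolding A B RA .
qed

lemma mollify_pointwise_limit:
  assumes f: "continuous_on UNIV f"
  defines "c \<equiv> \<lambda>e. \<integral>w. bump e 0 w \<partial>lborel"
  shows "((\<lambda>e. (1 / c e) *\<^sub>R mollify e f z) \<longlongrightarrow> f z) (at_right 0)"
proof (rule tendstoI)
  fix d :: real assume d: "0 < d"
  from f have "isCont f z" by (simp add: continuous_on_eq_continuous_at)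
  then obtain r where r: "0 < r" "\<And>w. cmod (w - z) < r \<Longrightarrow> cmod (f w - f z) < d / 2"
    using d unfolding continuous_at_eps_delta dist_norm by (meson half_gt_zero)
  have "cmod ((1 / c e) *\<^sub>R mollify e f z - f z) < d" if e: "0 < e" "e < r" for e
  proof -
    define b where "b = (\<lambda>w. bump e z w)"
    have out: "b w = 0" if "w \<notin> square z e" for w
      using bump_zero_outside_square(1)[of e z z e w] that e by (simp add: b_def)
    have cb: "continuous_on S b" for S
      unfolding b_def by (intro continuous_intros)
    have ib: "integrable lborel (\<lambda>w. b w *\<^sub>R h w)" if "continuous_on UNIV h" for h :: "complex \<Rightarrow> complex"
      using out unfolding square_def
      by (intro lborel_integral_compact_support(1)) (auto intro!: continuous_intros cb that)
    have ib1: "integrable lborel b"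
      using integrable_Re[OF ib[of "\<lambda>_. 1"]] by simp
    have cz: "c e = (\<integral>w. b w \<partial>lborel)"
    proof -
      have "(\<integral>w. b w \<partial>lborel) = (\<integral>w. b w \<partial>distr lborel borel ((+) z))"
        by (simp only: lborel_distr_plus)
      also have "\<dots> = (\<integral>w. b (z + w) \<partial>lborel)"
        using ib1 by (intro integral_distr) auto
      finally show ?thesis
        by (simp add: c_def b_def bump_def)
    qed
    \<comment> \<open>The value of the bump at distance \<open>e / 2\<close> from its center. It
      bounds the bump from below on the disc of half the radius and makes the mass
      \<open>c e\<close> positive.\<close>
    define m where "m = exp (- (4 / (3 * e\<^sup>2)))"
    have bm: "m \<le> b w" if "w \<in> cball z (e / 2)" for w
    proof -
      have "(cmod (w - z))\<^sup>2 \<le> (e / 2)\<^sup>2"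
        using that by (intro power_mono) (auto simp: dist_norm norm_minus_commute)
      then have s: "3 * e\<^sup>2 / 4 \<le> e\<^sup>2 - (cmod (w - z))\<^sup>2"
        by (simp add: power2_eq_square)
      have p: "0 < 3 * e\<^sup>2 / 4"
        using e by simp
      have q: "0 < e\<^sup>2 - (cmod (w - z))\<^sup>2"
        using s p by linarith
      have "1 / (e\<^sup>2 - (cmod (w - z))\<^sup>2) \<le> 1 / (3 * e\<^sup>2 / 4)"
        using s p q by (intro divide_left_mono mult_pos_pos) auto
      moreover note q
      ultimately show ?thesis
        unfolding m_def b_def bump_def flat_def by simp
    qed
    have "0 < m * measure lborel (cball z (e / 2))"
      using e by (simp add: m_def content_cball_pos)
    also have "\<dots> = (\<integral>w. indicator (cball z (e / 2)) w * m \<partial>lborel)"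
      by (simp add: mult.commute)
    also have "\<dots> \<le> (\<integral>w. b w \<partial>lborel)"
    proof (rule Bochner_Integration.integral_mono[OF _ ib1])
      show "integrable lborel (\<lambda>w. indicator (cball z (e / 2)) w * m)"
        using emeasure_lborel_cball_finite[of z "e / 2"] by (intro integrable_mult_left integrable_real_indicator) auto
      show "indicator (cball z (e / 2)) w * m \<le> b w" for w
        using bm[of w] bump_nonneg[of e z w] by (auto simp: indicator_def b_def)
    qed
    finally have cpos: "0 < c e"
      by (simp add: cz)
    have "c e *\<^sub>R ((1 / c e) *\<^sub>R mollify e f z - f z) = mollify e f z - c e *\<^sub>R f z"
      using cpos by (simp add: scaleR_right_diff_distrib)
    also have "\<dots> = (\<integral>w. b w *\<^sub>R (f w - f z) \<partial>lborel)"
      using ib[OF f] ib[OF continuous_on_const] ib1 unfolding cz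
      by (simp add: mollify_def b_def scaleR_right_diff_distrib)
    also have "cmod \<dots> \<le> (\<integral>w. b w * (d / 2) \<partial>lborel)"
    proof (rule Bochner_Integration.integral_norm_bound_integral)
      show "integrable lborel (\<lambda>w. b w *\<^sub>R (f w - f z))"
        by (intro ib continuous_intros f)
      show "integrable lborel (\<lambda>w. b w * (d / 2))"
        using ib1 by simp
      fix w
      show "cmod (b w *\<^sub>R (f w - f z)) \<le> b w * (d / 2)"
      proof (cases "cmod (w - z) \<le> e")
        case True
        then have "b w * cmod (f w - f z) \<le> b w * (d / 2)"
          using r(2)[of w] e bump_nonneg[of e z w] by (intro mult_left_mono) (auto simp: b_def)
        then show ?thesis
          using bump_nonneg[of e z w] by (simp add: b_def)
      next
        case False
        then show ?thesis
          using bump_outside[of e w z] e by (simp add: b_def)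
      qed
    qed
    also have "\<dots> = c e * (d / 2)"
      by (simp add: cz)
    finally have "cmod ((1 / c e) *\<^sub>R mollify e f z - f z) \<le> d / 2"
      using cpos by (simp add: mult.commute)
    then show ?thesis
      using d by simp
  qed
  then show "\<forall>\<^sub>F e in at_right 0. dist ((1 / c e) *\<^sub>R mollify e f z) (f z) < d"
    using r(1) by (auto simp: eventually_at_right_field dist_norm intro!: exI[of _ r])
qed

section \<open>Passage to the limit\<close>

lemma strain_scaleR: "strain (\<lambda>z. r *\<^sub>R f z) c e = r * strain f c e"
  by (simp add: strain_def scaleR_right_diff_distrib[symmetric])

lemma doubling_strain_scaleR:
  assumes "doubling_strain C f" "0 \<le> r"
  shows "doubling_strain C (\<lambda>z. r *\<^sub>R f z)"
  using assms unfolding doubling_strain_def strain_scaleR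
  by (auto simp: mult_left_mono mult.left_commute[of C])

text \<open>For fixed \<open>c\<close> and \<open>v\<close> each condition is a non-strict
  inequality between finitely many values of the field, hence closed under pointwise limits.\<close>

lemma doubling_strain_limit:
  assumes lim: "\<And>z. ((\<lambda>e. g e z) \<longlongrightarrow> f z) F" and F: "F \<noteq> bot"
    and g: "\<forall>\<^sub>F e in F. doubling_strain C (g e)"
  shows "doubling_strain C f"
proof -
  have s: "((\<lambda>e. strain (g e) c v) \<longlongrightarrow> strain f c v) F" for c v
    unfolding strain_def by (intro tendsto_intros lim)
  show ?thesis
    unfolding doubling_strain_def
  proof (intro allI conjI)
    fix c v
    show "0 \<le> strain f c v"
      using g by (intro tendsto_lowerbound[OF s _ F]) (auto elim!: eventually_mono simp: doubling_strain_def)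
    show "strain f c (2 * v) \<le> C * strain f c v" "strain f c (\<i> * v) \<le> C * strain f c v"
      using g by (intro tendsto_le[OF F tendsto_mult[OF tendsto_const s] s];
        auto elim!: eventually_mono simp: doubling_strain_def)+
  qed
qed

text \<open>The constant of \<open>smooth_reduced_doubling\<close> depends on \<open>k\<close> only,
  so it is the same for all mollification parameters and persists in the limit.\<close>

lemma reduced_fields_doubling:
  assumes "1 \<le> K"
  shows "\<exists>C\<ge>1. \<forall>d. \<forall>f\<in>reduced_fields K d. doubling_strain C f"
proof -
  define k where "k = (K - 1) / (K + 1)"
  have "0 \<le> k" "k < 1"
    using assms by (simp_all add: k_def)
  then obtain C where C: "1 \<le> C" "\<And>f a b. smooth_reduced k f a b \<Longrightarrow> doubling_strain C f"
    using smooth_reduced_doubling by metis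
  have "doubling_strain C f" if "f \<in> reduced_fields K d" for f d
  proof -
    have f: "continuous_on UNIV f"
      using that by (simp add: reduced_fields_def)
    have "\<exists>fx fy. W12_loc_partials f fx fy \<and>
        (AE z in lborel. 0 \<le> Re (wirtinger (fx z) (fy z)) \<and>
          cmod (wirtinger_bar (fx z) (fy z)) \<le> k * Re (wirtinger (fx z) (fy z)))"
      using that unfolding reduced_fields_def k_def mem_Collect_eq by (elim conjE)
    then obtain fx fy where W: "W12_loc_partials f fx fy"
      and cone: "AE z in lborel. 0 \<le> Re (wirtinger (fx z) (fy z)) \<and>
        cmod (wirtinger_bar (fx z) (fy z)) \<le> k * Re (wirtinger (fx z) (fy z))"
      by (elim exE conjE)
    show ?thesis
    proof (rule doubling_strain_limit[OF mollify_pointwise_limit[OF f]])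
      have "doubling_strain C (\<lambda>z. (1 / (\<integral>w. bump e 0 w \<partial>lborel)) *\<^sub>R mollify e f z)" if "0 < e" for e
        using C(2)[OF mollify_smooth_reduced[OF f W _ cone]] that
        by (intro doubling_strain_scaleR) (auto intro: Bochner_Integration.integral_nonneg bump_nonneg)
      then show "\<forall>\<^sub>F e in at_right 0. doubling_strain C (\<lambda>z. (1 / (\<integral>w. bump e 0 w \<partial>lborel)) *\<^sub>R mollify e f z)"
        using eventually_at_right_less[of 0] by (auto elim: eventually_mono)
    qed simp
  qed
  with C(1) show ?thesis
    by blast
qed

theorem theorem1p8:
  fixes K d r R :: real
  assumes "K \<ge> 1" and "d \<ge> 1" and "0 < r" and "r < R"
  shows "\<exists>A B :: real. \<forall>f\<in>reduced_fields K d.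
    \<forall>(I :: real set) (J :: real set) (x :: real \<Rightarrow> complex) (y :: real \<Rightarrow> complex) (t0 :: real) x0 y0.
      integral_curve f I x \<and> t0 \<in> I \<and> x t0 = x0 \<and> x0 \<in> closed_annulus r R \<and>
      integral_curve f J y \<and> t0 \<in> J \<and> y t0 = y0 \<and> y0 \<in> closed_annulus r R \<longrightarrow>
      (\<forall>t\<in>I. \<forall>s\<in>J. x t \<in> closed_annulus r R \<longrightarrow> y s \<in> closed_annulus r R \<longrightarrow>
         cmod (x t - y s) \<le> A * \<bar>t - s\<bar> + B * cmod (x0 - y0)) \<and>
      (\<forall>t\<in>I \<inter> J. \<forall>s\<in>I \<inter> J.
         {x t, y t, x s, y s} \<subseteq> closed_annulus r R \<longrightarrow>
         cmod (x t - y t) \<le> B * cmod (x s - y s))"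
proof -
  obtain C where C: "1 \<le> C" "\<And>f. f \<in> reduced_fields K d \<Longrightarrow> doubling_strain C f"
    using reduced_fields_doubling[OF assms(1)] by blast
  show ?thesis
    by (rule integral_curve_dependence[OF C(1) assms(3,4), where d = d])
       (auto simp: C doubling_field_def reduced_fields_def)
qed

end
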